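(* Let $a\in\Omega$ and let $\gamma:[t_0,+\infty)\to\Omega$ be any hyperbolic motion with $\gamma(t)=ta+o(t)$ as $t\to+\infty$. Then there exists $t_1>t_0$ such that the restriction of $\gamma$ to $[t_1,+\infty)$ is a hyperbolic geodesic ray. Moreover, for all $t\ge t_1$ the Busemann function $b_a$ is differentiable at $\gamma(t)$ and $\dot\gamma(t)=-\nabla b_a(\gamma(t))$.
   Context: Setting: $E$ is a Euclidean space of finite dimension $d\ge 2$, $N\ge 2$, and $m_1,\dots,m_N>0$ are masses. For $x=(r_1,\dots,r_N)\in E^N$, $U(x)=\sum_{i<j}m_im_j\|r_i-r_j\|_E^{-1}$ (with value $+\infty$ at collisions), and $\Omega=\{x\in E^N: r_i\ne r_j\ \forall i\neq j\}$. $E^N$ carries the mass inner product $\langle (r_i),(s_i)\rangle=\sum_i m_i\langle r_i,s_i\rangle_E$, with norm $\|\cdot\|$; gradients are taken with respect to it. A motion is a solution $x:I\to\Omega$ of $\ddot x=\nabla U(x)$; its energy $\frac12\|\dot x\|^2-U(x)$ is constant. A hyperbolic motion is a motion defined on an interval unbounded to the right with $x(t)=ta+o(t)$ as $t\to+\infty$ for some $a\in\Omega$; $a$ is called its limit shape (its energy is then $\frac12\|a\|^2$). For $h\ge 0$ and an absolutely continuous curve $\gamma:[s_0,s_1]\to E^N$, $\mathcal A_{L+h}(\gamma)=\int_{s_0}^{s_1}\big(\frac12\|\dot\gamma\|^2+U(\gamma)+h\big)dt\in[0,+\infty]$, and the Jacobi-Maupertuis distance $\phi_h(x,y)$ is the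 infimum of $\mathcal A_{L+h}(\gamma)$ over all absolutely continuous curves from $x$ to $y$ defined on compact intervals of arbitrary positive length. It is a distance on $E^N$. A hyperbolic geodesic ray (of energy $h>0$) is an absolutely continuous curve $\gamma:[t_0,+\infty)\to E^N$ such that $\gamma|_{(t_0,+\infty)}$ is a hyperbolic motion of energy $h$ and $\mathcal A_{L+h}(\gamma|_{[t_0,t]})=\phi_h(\gamma(t_0),\gamma(t))$ for all $t>t_0$. Its Busemann function is $b_\gamma(x)=\lim_{t\to+\infty}\big[\phi_h(x,\gamma(t))-\phi_h(\gamma(t),\gamma(t_0))\big]$, $x\in E^N$ (the limit exists). For $a\in\Omega$, the Busemann function of $a$ is $b_a:E^N\to\mathbb R$, $b_a(x)=b_\gamma(x)-b_\gamma(0)$, where $\gamma$ is any hyperbolic geodesic ray with limit shape $a$ (such rays exist, and $b_a$ does not depend on the choice of $\gamma$). *)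

theory Defs
  imports "HOL-Analysis.Analysis"
begin

text \<open>
  Configurations of \<open>N = CARD('n)\<close> bodies in a Euclidean space \<open>'e\<close> are elements of
  \<open>'e ^ 'n\<close>; the index type is linearly ordered so that sums over \<open>i < j\<close> make sense.
  Curves are total functions \<open>real \<Rightarrow> 'e ^ 'n\<close> of which only the restriction to the stated
  interval matters. The library topology and derivative on \<open>'e ^ 'n\<close> are those of the
  unweighted norm, which is equivalent to the mass norm.
\<close>

definition collision_free :: "('e::euclidean_space, 'n::finite) vec set" where
  "collision_free = {x. \<forall>i j. i \<noteq> j \<longrightarrow> x $ i \<noteq> x $ j}"

definition mass_inner :: "('n::finite \<Rightarrow> real) \<Rightarrow> ('e::euclidean_space, 'n) vec \<Rightarrow> ('e, 'n) vec \<Rightarrow> real" where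
  "mass_inner m x y = (\<Sum>i\<in>UNIV. m i * (x $ i \<bullet> y $ i))"

definition mass_norm :: "('n::finite \<Rightarrow> real) \<Rightarrow> ('e::euclidean_space, 'n) vec \<Rightarrow> real" where
  "mass_norm m x = sqrt (mass_inner m x x)"

text \<open>Meaningful only where \<open>f\<close> is differentiable and all masses are positive.\<close>

definition mass_grad ::
  "('n::finite \<Rightarrow> real) \<Rightarrow> (('e::euclidean_space, 'n) vec \<Rightarrow> real) \<Rightarrow> ('e, 'n) vec \<Rightarrow> ('e, 'n) vec" where
  "mass_grad m f x = (THE g. (f has_derivative (\<lambda>v. mass_inner m g v)) (at x))"

text \<open>
  The real-valued \<open>potential_real\<close> is only meaningful on \<open>collision_free\<close> (elsewhere it
  contains terms \<open>c / 0 = 0\<close>); \<open>potential\<close> is its extension by \<open>\<infinity>\<close> at collisions.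
\<close>

definition potential_real ::
  "('n::{finite,linorder} \<Rightarrow> real) \<Rightarrow> ('e::euclidean_space, 'n) vec \<Rightarrow> real" where
  "potential_real m x = (\<Sum>(i, j)\<in>{(i, j). i < j}. m i * m j / norm (x $ i - x $ j))"

definition potential ::
  "('n::{finite,linorder} \<Rightarrow> real) \<Rightarrow> ('e::euclidean_space, 'n) vec \<Rightarrow> ennreal" where
  "potential m x = (if x \<in> collision_free then ennreal (potential_real m x) else \<infinity>)"

definition motion ::
  "('n::{finite,linorder} \<Rightarrow> real) \<Rightarrow> real set \<Rightarrow> (real \<Rightarrow> ('e::euclidean_space, 'n) vec) \<Rightarrow> bool" where
  "motion m I x \<longleftrightarrow> is_interval I \<and>
    (\<forall>t\<in>I. x t \<in> collision_free \<and>
      x differentiable (at t within I) \<and>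
      ((\<lambda>s. vector_derivative x (at s within I)) has_vector_derivative
         mass_grad m (potential_real m) (x t)) (at t within I))"

definition energy ::
  "('n::{finite,linorder} \<Rightarrow> real) \<Rightarrow> real set \<Rightarrow> (real \<Rightarrow> ('e::euclidean_space, 'n) vec) \<Rightarrow> real \<Rightarrow> real" where
  "energy m I x t =
    1/2 * (mass_norm m (vector_derivative x (at t within I)))\<^sup>2 - potential_real m (x t)"

text \<open>\<open>x t = t a + o(t)\<close> as \<open>t \<rightarrow> \<infinity>\<close>.\<close>

definition asymptotic_to ::
  "('n::finite \<Rightarrow> real) \<Rightarrow> (real \<Rightarrow> ('e::euclidean_space, 'n) vec) \<Rightarrow> ('e, 'n) vec \<Rightarrow> bool" where
  "asymptotic_to m x a \<longleftrightarrow> (\<lambda>t. mass_norm m (x t - t *\<^sub>R a)) \<in> o[at_top](\<lambda>t. t)"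

definition hyperbolic_motion ::
  "('n::{finite,linorder} \<Rightarrow> real) \<Rightarrow> real set \<Rightarrow> (real \<Rightarrow> ('e::euclidean_space, 'n) vec) \<Rightarrow> bool" where
  "hyperbolic_motion m I x \<longleftrightarrow>
    motion m I x \<and> \<not> bdd_above I \<and> (\<exists>a\<in>collision_free. asymptotic_to m x a)"

definition absolutely_continuous_curve ::
  "real \<Rightarrow> real \<Rightarrow> (real \<Rightarrow> 'v::real_normed_vector) \<Rightarrow> bool" where
  "absolutely_continuous_curve s0 s1 c \<longleftrightarrow>
    (\<forall>\<epsilon>>0. \<exists>\<delta>>0. \<forall>(n::nat) p q.
       (\<forall>k<n. s0 \<le> p k \<and> p k \<le> q k \<and> q k \<le> s1) \<longrightarrow>
       disjoint_family_on (\<lambda>k. {p k<..<q k}) {..<n} \<longrightarrow>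
       (\<Sum>k<n. q k - p k) < \<delta> \<longrightarrow>
       (\<Sum>k<n. norm (c (q k) - c (p k))) < \<epsilon>)"

text \<open>
  An absolutely continuous curve is differentiable almost everywhere; the unspecified value
  of \<open>vector_derivative\<close> on the exceptional null set does not affect the integral.
\<close>

definition action ::
  "('n::{finite,linorder} \<Rightarrow> real) \<Rightarrow> real \<Rightarrow> real \<Rightarrow> real \<Rightarrow> (real \<Rightarrow> ('e::euclidean_space, 'n) vec) \<Rightarrow> ennreal" where
  "action m h s0 s1 c =
    (\<integral>\<^sup>+t\<in>{s0..s1}.
       (ennreal (1/2 * (mass_norm m (vector_derivative c (at t within {s0..s1})))\<^sup>2)
        + potential m (c t) + ennreal h) \<partial>lborel)"

definition jm_dist ::
  "('n::{finite,linorder} \<Rightarrow> real) \<Rightarrow> real \<Rightarrow> ('e::euclidean_space, 'n) vec \<Rightarrow> ('e, 'n) vec \<Rightarrow> ennreal" where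
  "jm_dist m h x y =
    Inf {action m h s0 s1 c | s0 s1 c.
           s0 < s1 \<and> absolutely_continuous_curve s0 s1 c \<and> c s0 = x \<and> c s1 = y}"

text \<open>
  Absolute continuity on the unbounded interval \<open>[t0, \<infinity>)\<close> means absolute continuity on each
  compact subinterval.
\<close>

definition hyperbolic_geodesic_ray ::
  "('n::{finite,linorder} \<Rightarrow> real) \<Rightarrow> real \<Rightarrow> real \<Rightarrow> (real \<Rightarrow> ('e::euclidean_space, 'n) vec) \<Rightarrow> bool" where
  "hyperbolic_geodesic_ray m h t0 c \<longleftrightarrow> h > 0 \<and>
    (\<forall>t>t0. absolutely_continuous_curve t0 t c) \<and>
    hyperbolic_motion m {t0<..} c \<and>
    (\<forall>t>t0. energy m {t0<..} c t = h) \<and>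
    (\<forall>t>t0. action m h t0 t c = jm_dist m h (c t0) (c t))"

text \<open>The values of \<open>jm_dist\<close> are finite, so \<open>enn2real\<close> loses nothing.\<close>

definition busemann_ray ::
  "('n::{finite,linorder} \<Rightarrow> real) \<Rightarrow> real \<Rightarrow> real \<Rightarrow> (real \<Rightarrow> ('e::euclidean_space, 'n) vec) \<Rightarrow> ('e, 'n) vec \<Rightarrow> real" where
  "busemann_ray m h t0 c x =
    Lim at_top (\<lambda>t. enn2real (jm_dist m h x (c t)) - enn2real (jm_dist m h (c t) (c t0)))"

text \<open>
  Any ray with limit shape \<open>a\<close> may be used: they exist, their energy is
  \<open>(mass_norm m a)\<^sup>2 / 2\<close>, and the resulting function does not depend on the ray.
\<close>

definition busemann ::
  "('n::{finite,linorder} \<Rightarrow> real) \<Rightarrow> ('e::euclidean_space, 'n) vec \<Rightarrow> ('e, 'n) vec \<Rightarrow> real" where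
  "busemann m a =
    (SOME b. \<exists>h t0 c. hyperbolic_geodesic_ray m h t0 c \<and> asymptotic_to m c a \<and>
       b = (\<lambda>x. busemann_ray m h t0 c x - busemann_ray m h t0 c 0))"

end

theory Submission
  imports Defs "HOL-Analysis.Analysis" "HOL-Real_Asymp.Real_Asymp"
begin

text \<open>
  In mass-scaled coordinates the Hamilton--Jacobi equation of energy \<open>h = |a|\<^sup>2/2\<close> is
  \<open>|\<nabla>S|\<^sup>2 = |a|\<^sup>2 + 2U\<close>, and along any absolutely continuous curve a subsolution grows at
  most like the action. Near a hyperbolic motion \<open>\<gamma>\<close> with limit shape \<open>a\<close>, write \<open>x = \<gamma>(\<tau>) + \<xi>\<close>
  with \<open>\<xi>\<close> orthogonal to \<open>a\<close>, and let \<open>\<sigma>\<close> be the action along \<open>\<gamma>\<close>. The function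
  \<open>S(x) = \<sigma>(\<tau>) + \<langle>\<gamma>'(\<tau>), \<xi>\<rangle> + |\<xi>|\<^sup>2/(8\<tau>)\<close> is a subsolution on a narrow cone around \<open>\<gamma>\<close>, and
  so is \<open>|a||x| - C\<close> everywhere, because \<open>U \<ge> 0\<close>. For suitable \<open>C\<close>, \<open>S\<close> is the smaller one on the
  boundary of the cone and, since \<open>\<sigma>(\<tau>) - |a||\<gamma>(\<tau>)|\<close> tends to infinity, the larger one along \<open>\<gamma>\<close> from
  some time on. Thus every curve joining two late points of \<open>\<gamma>\<close> has at least the action of \<open>\<gamma>\<close>,
  wherever it goes: \<open>\<gamma>\<close> is eventually a geodesic ray.

  Two motions with the same limit shape deviate by \<open>O(log t)\<close>, so that changing from one to the
  other over a time of order \<open>t\<close> costs only a boundary term plus \<open>o(1)\<close>. Hence the Busemann function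
  of any ray with limit shape \<open>a\<close> decreases along \<open>\<gamma>\<close> exactly by the action. Comparing the values
  near \<open>\<gamma>(t)\<close> with those at \<open>\<gamma>(t \<plusminus> 1)\<close> squeezes it between two functions that are smooth at \<open>\<gamma>(t)\<close>
  with the common gradient \<open>-\<gamma>'(t)\<close>.
\<close>

section \<open>Absolutely continuous curves\<close>

text \<open>A competitor is only an epsilon-delta absolutely continuous curve, possibly through
  collisions, so bounding its action from below means recovering the increment of a function along
  it from an almost everywhere derivative. As the integrand of the action is not shown to be
  measurable, the estimates are made with lower integrals. The two subsolutions are never glued:
  along each curve the estimate switches once, from |a||x| to S, at the last time at which S fails
  to dominate. This needs a reserve on both sides. On the lateral boundary it is of order t, because
  the Hessian of S is smaller than that of the spherical wave. Along \<gamma> it is the integral of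
  U, which diverges logarithmically because U decays only like 1/t. The same long range lets motions
  deviate logarithmically, so the boundary term for passing from one to another is not shown to be
  small; it enters the distances from \<gamma>(s) and from \<gamma>(t) in the same way and cancels
  in their difference. Rays are motions only on an open half-line and may start at a collision,
  which calls for a separate finiteness argument.\<close>

lemma division_real_D:
  fixes D :: "real set set"
  assumes "D division_of S" "K \<in> D"
  shows "K = {Inf K..Sup K}" "Inf K \<le> Sup K" "measure lborel K = Sup K - Inf K" "K \<subseteq> S" "Inf K \<in> S" "Sup K \<in> S" "K \<in> lmeasurable" "convex K"
proof -
  obtain u v where K: "K = cbox u v" "K \<noteq> {}" "K \<subseteq> S" using assms division_ofD(2,3,4) by metis
  then have "u \<le> v" by auto
  then show "K = {Inf K..Sup K}" "Inf K \<le> Sup K" "measure lborel K = Sup K - Inf K" "K \<subseteq> S" "Inf K \<in> S" "Sup K \<in> S" "K \<in> lmeasurable" "convex K"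
    using K by auto
qed

lemma absolutely_continuous_curveE:
  assumes "absolutely_continuous_curve a b f" "\<epsilon> > 0"
  obtains \<delta> where "\<delta> > 0"
    "\<And>(n::nat) p q. (\<And>k. k < n \<Longrightarrow> a \<le> p k \<and> p k \<le> q k \<and> q k \<le> b) \<Longrightarrow>
       disjoint_family_on (\<lambda>k. {p k<..<q k}) {..<n} \<Longrightarrow>
       (\<Sum>k<n. q k - p k) < \<delta> \<Longrightarrow>
       (\<Sum>k<n. norm (f (q k) - f (p k))) < \<epsilon>"
proof -
  have "\<exists>\<delta>>0. \<forall>(n::nat) p q.
       (\<forall>k<n. a \<le> p k \<and> p k \<le> q k \<and> q k \<le> b) \<longrightarrow>
       disjoint_family_on (\<lambda>k. {p k<..<q k}) {..<n} \<longrightarrow>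
       (\<Sum>k<n. q k - p k) < \<delta> \<longrightarrow>
       (\<Sum>k<n. norm (f (q k) - f (p k))) < \<epsilon>"
    using assms(1)[unfolded absolutely_continuous_curve_def, rule_format, OF assms(2)] .
  then show thesis using that by blast
qed

lemma absolutely_continuous_curveI:
  assumes "\<And>\<epsilon>. \<epsilon> > 0 \<Longrightarrow> \<exists>\<delta>>0. \<forall>(n::nat) p q.
       (\<forall>k<n. a \<le> p k \<and> p k \<le> q k \<and> q k \<le> b) \<longrightarrow>
       disjoint_family_on (\<lambda>k. {p k<..<q k}) {..<n} \<longrightarrow>
       (\<Sum>k<n. q k - p k) < \<delta> \<longrightarrow>
       (\<Sum>k<n. norm (f (q k) - f (p k))) < \<epsilon>"
  shows "absolutely_continuous_curve a b f"
  using assms unfolding absolutely_continuous_curve_def by simp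

text \<open>Covering arguments and gauge integrals produce finite sets of compact intervals with
  disjoint interiors, which is what \<open>division_of\<close> records. Enumerating such a set turns
  it into the indexed families of the definition.\<close>

lemma absolutely_continuous_curve_division:
  fixes f :: "real \<Rightarrow> 'v::real_normed_vector"
  assumes ac: "absolutely_continuous_curve a b f" and e: "\<epsilon> > 0"
  shows "\<exists>\<delta>>0. \<forall>D. D division_of \<Union>D \<longrightarrow> \<Union>D \<subseteq> {a..b} \<longrightarrow> (\<Sum>K\<in>D. Sup K - Inf K) < \<delta> \<longrightarrow>
       (\<Sum>K\<in>D. norm (f (Sup K) - f (Inf K))) < \<epsilon>"
proof (rule absolutely_continuous_curveE[OF ac e])
  fix \<delta> :: real assume d: "\<delta> > 0" and *: "\<And>(n::nat) p q. (\<And>k. k < n \<Longrightarrow> a \<le> p k \<and> p k \<le> q k \<and> q k \<le> b) \<Longrightarrow>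
       disjoint_family_on (\<lambda>k. {p k<..<q k}) {..<n} \<Longrightarrow>
       (\<Sum>k<n. q k - p k) < \<delta> \<Longrightarrow>
       (\<Sum>k<n. norm (f (q k) - f (p k))) < \<epsilon>"
  show ?thesis
  proof (intro exI[of _ \<delta>] conjI d allI impI)
    fix D assume D: "D division_of \<Union>D" "\<Union>D \<subseteq> {a..b}" "(\<Sum>K\<in>D. Sup K - Inf K) < \<delta>"
    note K = division_real_D[OF D(1)]
    have "finite D" using D(1) by (rule division_of_finite)
    then obtain h where h: "bij_betw h {..<card D} D"
      using ex_bij_betw_nat_finite[of D] by (auto simp: atLeast0LessThan)
    have hD: "h k \<in> D" if "k < card D" for k using bij_betwE[OF h] that by auto
    have re: "(\<Sum>k<card D. g (h k)) = (\<Sum>K\<in>D. g K)" for g :: "real set \<Rightarrow> real"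
      using sum.reindex_bij_betw[OF h] .
    have "(\<Sum>k<card D. norm (f (Sup (h k)) - f (Inf (h k)))) < \<epsilon>"
    proof (rule *)
      fix k assume "k < card D"
      note k = K(2,5,6)[OF hD[OF this]]
      have "Inf (h k) \<in> {a..b}" "Sup (h k) \<in> {a..b}" using k(2,3) D(2) by blast+
      then show "a \<le> Inf (h k) \<and> Inf (h k) \<le> Sup (h k) \<and> Sup (h k) \<le> b" using k(1) by simp
    next
      have int: "interior (h k) = {Inf (h k)<..<Sup (h k)}" if "k < card D" for k
        using arg_cong[where f = interior, OF K(1)[OF hD[OF that]]]
        unfolding interior_atLeastAtMost_real .
      show "disjoint_family_on (\<lambda>k. {Inf (h k)<..<Sup (h k)}) {..<card D}"
        unfolding disjoint_family_on_def
      proof (intro ballI impI)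
        fix i j assume ij: "i \<in> {..<card D}" "j \<in> {..<card D}" "i \<noteq> j"
        then have "h i \<noteq> h j" using h by (auto simp: bij_betw_def inj_on_def)
        then have "interior (h i) \<inter> interior (h j) = {}"
          using division_ofD(5)[OF D(1) hD[of i] hD[of j]] ij by simp
        then show "{Inf (h i)<..<Sup (h i)} \<inter> {Inf (h j)<..<Sup (h j)} = {}"
          using int[of i] int[of j] ij by simp
      qed
      show "(\<Sum>k<card D. Sup (h k) - Inf (h k)) < \<delta>" using D(3) re[of "\<lambda>K. Sup K - Inf K"] by simp
    qed
    then show "(\<Sum>K\<in>D. norm (f (Sup K) - f (Inf K))) < \<epsilon>"
      using re[of "\<lambda>K. norm (f (Sup K) - f (Inf K))"] by simp
  qed
qed

lemma absolutely_continuous_curve_pair: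
  fixes f :: "real \<Rightarrow> 'v::real_normed_vector"
  assumes ac: "absolutely_continuous_curve a b f" and e: "\<epsilon> > 0"
  obtains \<delta> where "\<delta> > 0"
    "\<And>x y. a \<le> x \<Longrightarrow> x \<le> y \<Longrightarrow> y \<le> b \<Longrightarrow> y - x < \<delta> \<Longrightarrow> norm (f y - f x) < \<epsilon>"
proof (rule absolutely_continuous_curveE[OF ac e])
  fix \<delta> :: real assume d: "\<delta> > 0" and *: "\<And>(n::nat) p q. (\<And>k. k < n \<Longrightarrow> a \<le> p k \<and> p k \<le> q k \<and> q k \<le> b) \<Longrightarrow>
       disjoint_family_on (\<lambda>k. {p k<..<q k}) {..<n} \<Longrightarrow>
       (\<Sum>k<n. q k - p k) < \<delta> \<Longrightarrow>
       (\<Sum>k<n. norm (f (q k) - f (p k))) < \<epsilon>"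
  show thesis
  proof (rule that[OF d])
    fix x y assume "a \<le> x" "x \<le> y" "y \<le> b" "y - x < \<delta>"
    then show "norm (f y - f x) < \<epsilon>" using *[of "Suc 0" "\<lambda>_. x" "\<lambda>_. y"]
      by (simp add: disjoint_family_on_def)
  qed
qed

lemma absolutely_continuous_curve_continuous:
  fixes f :: "real \<Rightarrow> 'v::real_normed_vector"
  assumes "absolutely_continuous_curve a b f"
  shows "continuous_on {a..b} f"
  unfolding continuous_on_iff
proof (intro ballI allI impI)
  fix x e :: real assume x: "x \<in> {a..b}" and e: "e > 0"
  show "\<exists>d>0. \<forall>x'\<in>{a..b}. dist x' x < d \<longrightarrow> dist (f x') (f x) < e"
  proof (rule absolutely_continuous_curve_pair[OF assms e], intro exI conjI ballI impI)
    fix \<delta> y assume d: "\<And>x y. a \<le> x \<Longrightarrow> x \<le> y \<Longrightarrow> y \<le> b \<Longrightarrow> y - x < \<delta> \<Longrightarrow> norm (f y - f x) < e"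
      and y: "y \<in> {a..b}" "dist y x < \<delta>"
    show "dist (f y) (f x) < e"
      using d[of x y] d[of y x] x y by (cases "x \<le> y") (simp_all add: dist_norm norm_minus_commute)
  qed
qed

lemma absolutely_continuous_curve_subinterval:
  assumes ac: "absolutely_continuous_curve a b f" and ab: "a \<le> a'" "b' \<le> b"
  shows "absolutely_continuous_curve a' b' f"
proof (rule absolutely_continuous_curveI)
  fix \<epsilon> :: real assume e: "\<epsilon> > 0"
  show "\<exists>\<delta>>0. \<forall>(n::nat) p q.
       (\<forall>k<n. a' \<le> p k \<and> p k \<le> q k \<and> q k \<le> b') \<longrightarrow>
       disjoint_family_on (\<lambda>k. {p k<..<q k}) {..<n} \<longrightarrow>
       (\<Sum>k<n. q k - p k) < \<delta> \<longrightarrow>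
       (\<Sum>k<n. norm (f (q k) - f (p k))) < \<epsilon>"
  proof (rule absolutely_continuous_curveE[OF ac e], intro exI conjI allI impI)
    fix \<delta> :: real and n :: nat and p q :: "nat \<Rightarrow> real"
    assume *: "\<And>(n::nat) p q. (\<And>k. k < n \<Longrightarrow> a \<le> p k \<and> p k \<le> q k \<and> q k \<le> b) \<Longrightarrow>
       disjoint_family_on (\<lambda>k. {p k<..<q k}) {..<n} \<Longrightarrow>
       (\<Sum>k<n. q k - p k) < \<delta> \<Longrightarrow>
       (\<Sum>k<n. norm (f (q k) - f (p k))) < \<epsilon>"
      and pq: "\<forall>k<n. a' \<le> p k \<and> p k \<le> q k \<and> q k \<le> b'"
      and 1: "disjoint_family_on (\<lambda>k. {p k<..<q k}) {..<n}" "(\<Sum>k<n. q k - p k) < \<delta>"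
    show "(\<Sum>k<n. norm (f (q k) - f (p k))) < \<epsilon>"
    proof (rule *[OF _ 1])
      fix k assume "k < n"
      then show "a \<le> p k \<and> p k \<le> q k \<and> q k \<le> b" using pq[rule_format, of k] ab by linarith
    qed
  qed
qed

text \<open>The constant may be used only at small scales: this covers maps that are Lipschitz near
  the image of \<open>c\<close> without being Lipschitz on a convex set.\<close>

lemma absolutely_continuous_curve_lipschitz_compose:
  fixes c :: "real \<Rightarrow> 'v::real_normed_vector" and g :: "real \<Rightarrow> 'w::real_normed_vector"
  assumes c: "absolutely_continuous_curve a b c" and eta: "\<eta> > 0"
    and lip: "\<And>x y. a \<le> x \<Longrightarrow> x \<le> y \<Longrightarrow> y \<le> b \<Longrightarrow> y - x < \<eta> \<Longrightarrow> norm (g y - g x) \<le> L * norm (c y - c x)"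
  shows "absolutely_continuous_curve a b g"
proof (rule absolutely_continuous_curveI)
  fix \<epsilon> :: real assume "\<epsilon> > 0"
  define L' where "L' = max L 1"
  have e: "\<epsilon> / L' > 0" using \<open>\<epsilon> > 0\<close> by (simp add: L'_def)
  show "\<exists>\<delta>>0. \<forall>(n::nat) p q.
       (\<forall>k<n. a \<le> p k \<and> p k \<le> q k \<and> q k \<le> b) \<longrightarrow>
       disjoint_family_on (\<lambda>k. {p k<..<q k}) {..<n} \<longrightarrow>
       (\<Sum>k<n. q k - p k) < \<delta> \<longrightarrow>
       (\<Sum>k<n. norm (g (q k) - g (p k))) < \<epsilon>"
  proof (rule absolutely_continuous_curveE[OF c e])
    fix \<delta> :: real assume d: "\<delta> > 0" and *: "\<And>(n::nat) p q. (\<And>k. k < n \<Longrightarrow> a \<le> p k \<and> p k \<le> q k \<and> q k \<le> b) \<Longrightarrow>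
       disjoint_family_on (\<lambda>k. {p k<..<q k}) {..<n} \<Longrightarrow>
       (\<Sum>k<n. q k - p k) < \<delta> \<Longrightarrow>
       (\<Sum>k<n. norm (c (q k) - c (p k))) < \<epsilon> / L'"
    show ?thesis
  proof (intro exI[of _ "min \<delta> \<eta>"] conjI allI impI)
    fix n :: nat and p q :: "nat \<Rightarrow> real"
    assume pq: "\<forall>k<n. a \<le> p k \<and> p k \<le> q k \<and> q k \<le> b"
      and dis: "disjoint_family_on (\<lambda>k. {p k<..<q k}) {..<n}"
      and s: "(\<Sum>k<n. q k - p k) < min \<delta> \<eta>"
    have le: "norm (g (q k) - g (p k)) \<le> L' * norm (c (q k) - c (p k))" if "k < n" for k
    proof -
      have "q k - p k \<le> (\<Sum>k<n. q k - p k)" using pq that by (intro member_le_sum) auto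
      then have "norm (g (q k) - g (p k)) \<le> L * norm (c (q k) - c (p k))"
        using lip[of "p k" "q k"] pq[rule_format, OF that] s by simp
      also have "\<dots> \<le> L' * norm (c (q k) - c (p k))" by (simp add: L'_def mult_right_mono)
      finally show ?thesis .
    qed
    have "(\<Sum>k<n. norm (g (q k) - g (p k))) \<le> (\<Sum>k<n. L' * norm (c (q k) - c (p k)))"
      using le by (intro sum_mono) auto
    also have "\<dots> = L' * (\<Sum>k<n. norm (c (q k) - c (p k)))" by (simp add: sum_distrib_left)
    also have "\<dots> < L' * (\<epsilon> / L')"
    proof (rule mult_strict_left_mono)
      show "(\<Sum>k<n. norm (c (q k) - c (p k))) < \<epsilon> / L'"
        by (rule *[OF _ dis]) (use pq s in auto)
    qed (simp add: L'_def)
    also have "\<dots> = \<epsilon>" by (simp add: L'_def)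
    finally show "(\<Sum>k<n. norm (g (q k) - g (p k))) < \<epsilon>" .
    qed (use d eta in simp)
  qed
qed

lemma absolutely_continuous_curve_lipschitz:
  fixes g :: "real \<Rightarrow> 'w::real_normed_vector"
  assumes "\<And>x y. a \<le> x \<Longrightarrow> x \<le> y \<Longrightarrow> y \<le> b \<Longrightarrow> norm (g y - g x) \<le> L * (y - x)"
  shows "absolutely_continuous_curve a b g"
proof (rule absolutely_continuous_curve_lipschitz_compose[where c = "\<lambda>x. x" and \<eta> = 1])
  show "absolutely_continuous_curve a b (\<lambda>x. x)"
  proof (rule absolutely_continuous_curveI)
    fix \<epsilon> :: real assume "\<epsilon> > 0"
    then show "\<exists>\<delta>>0. \<forall>(n::nat) p q.
       (\<forall>k<n. a \<le> p k \<and> p k \<le> q k \<and> q k \<le> b) \<longrightarrow>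
       disjoint_family_on (\<lambda>k. {p k<..<q k}) {..<n} \<longrightarrow>
       (\<Sum>k<n. q k - p k) < \<delta> \<longrightarrow>
       (\<Sum>k<n. norm (q k - p k)) < \<epsilon>"
      by (intro exI[of _ \<epsilon>]) auto
  qed
qed (use assms in auto)

lemma absolutely_continuous_curve_C1:
  fixes g :: "real \<Rightarrow> 'w::real_normed_vector"
  assumes d: "\<And>x. x \<in> {a..b} \<Longrightarrow> (g has_vector_derivative g' x) (at x within {a..b})"
    and c: "continuous_on {a..b} g'"
  shows "absolutely_continuous_curve a b g"
proof -
  have "bounded (g' ` {a..b})" using c by (simp add: compact_continuous_image compact_imp_bounded)
  then obtain B where B: "\<And>x. x \<in> {a..b} \<Longrightarrow> norm (g' x) \<le> B"
    unfolding bounded_iff by blast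
  show ?thesis
  proof (rule absolutely_continuous_curve_lipschitz)
    fix x y assume xy: "a \<le> x" "x \<le> y" "y \<le> b"
    have "norm (g y - g x) \<le> B * norm (y - x)"
    proof (rule differentiable_bound[of "{a..b}" g "\<lambda>x h. h *\<^sub>R g' x"])
      fix z assume z: "z \<in> {a..b}"
      show "(g has_derivative (\<lambda>h. h *\<^sub>R g' z)) (at z within {a..b})"
        using d[OF z] by (simp add: has_vector_derivative_def)
      show "onorm (\<lambda>h. h *\<^sub>R g' z) \<le> B"
        using B[OF z] by (intro onorm_le) (simp add: mult.commute[of B] mult_left_mono)
    qed (use xy in auto)
    then show "norm (g y - g x) \<le> B * (y - x)" using xy by simp
  qed
qed

section \<open>Vitali coverings and almost everywhere differentiability\<close>

lemma sum_division_telescope: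
  fixes f :: "real \<Rightarrow> real"
  assumes D: "D division_of {a..b}" and ab: "a \<le> b"
  shows "(\<Sum>K\<in>D. f (Sup K) - f (Inf K)) = f b - f a"
proof -
  note K = division_real_D[OF D]
  have fin: "finite D" using D by (rule division_of_finite)
  let ?p = "(\<lambda>K. (Inf K, K)) ` D"
  have inj: "inj_on (\<lambda>K. (Inf K, K)) D" by (auto simp: inj_on_def)
  have "?p tagged_division_of {a..b}"
  proof (rule tagged_division_ofI)
    fix x J assume "(x, J) \<in> ?p"
    then have J: "J \<in> D" "x = Inf J" by auto
    show "x \<in> J" using K(1,2)[OF J(1)] J(2) by (metis atLeastAtMost_iff order_refl)
    show "J \<subseteq> {a..b}" using K(4)[OF J(1)] .
    show "\<exists>a b. J = cbox a b" using K(1)[OF J(1)] by (metis cbox_interval)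
    fix x' J' assume "(x', J') \<in> ?p" "(x, J) \<noteq> (x', J')"
    then show "interior J \<inter> interior J' = {}" using division_ofD(5)[OF D J(1), of J'] J by auto
  next
    show "finite ?p" using fin by simp
    have "{J. \<exists>x. (x, J) \<in> ?p} = D" by auto
    then show "\<Union>{J. \<exists>x. (x, J) \<in> ?p} = {a..b}" using division_ofD(6)[OF D] by simp
  qed
  from additive_tagged_division_1[OF ab this, of f] show ?thesis
    by (simp add: sum.reindex[OF inj] o_def)
qed

lemma measure_division_real:
  fixes D :: "real set set"
  assumes "D division_of S"
  shows "measure lebesgue S = (\<Sum>K\<in>D. Sup K - Inf K)" "S \<in> lmeasurable"
proof -
  note K = division_real_D[OF assms]
  have len: "measure lebesgue K = Sup K - Inf K" if "K \<in> D" for K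
    using arg_cong[where f = "measure lebesgue", OF K(1)[OF that]] K(2)[OF that] by simp
  have fin: "finite D" using assms by (rule division_of_finite)
  note m = K(7)
  have "pairwise (\<lambda>S T. negligible (S \<inter> T)) D"
    unfolding pairwise_def
  proof (intro ballI impI)
    fix I J assume IJ: "I \<in> D" "J \<in> D" "I \<noteq> J"
    have "convex (I \<inter> J)" using K(8)[OF IJ(1)] K(8)[OF IJ(2)] by (rule convex_Int)
    moreover have "interior (I \<inter> J) = {}" using division_ofD(5)[OF assms IJ] by simp
    ultimately show "negligible (I \<inter> J)" by (simp add: negligible_convex_interior)
  qed
  from measure_negligible_finite_Union[OF fin m this]
  have "measure lebesgue S = (\<Sum>K\<in>D. measure lebesgue K)" using division_ofD(6)[OF assms] by simp
  also have "\<dots> = (\<Sum>K\<in>D. Sup K - Inf K)" by (intro sum.cong refl) (rule len)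
  finally show "measure lebesgue S = (\<Sum>K\<in>D. Sup K - Inf K)" .
  show "S \<in> lmeasurable" using fmeasurable.finite_Union[OF fin, of lebesgue] m division_ofD(6)[OF assms] by auto
qed

definition steep :: "(real \<Rightarrow> real) \<Rightarrow> real \<Rightarrow> real \<Rightarrow> real \<Rightarrow> real set" where
  "steep f a b q = {x \<in> {a<..<b}. \<forall>n::nat. \<exists>h. h \<noteq> 0 \<and> \<bar>h\<bar> < inverse (Suc n) \<and> x + h \<in> {a<..<b} \<and>
     q < (f (x + h) - f x) / h}"

text \<open>For a fixed increment \<open>h\<close> the condition on \<open>x\<close> is open, so
  uncountably many \<open>h\<close> may be united; only the scale \<open>n\<close> enters through a
  countable intersection.\<close>

lemma steep_measurable:
  assumes f: "continuous_on {a<..<b} f"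
  shows "steep f a b q \<in> sets lebesgue"
proof -
  let ?O = "\<lambda>h. ({a<..<b} \<inter> (\<lambda>x. x + h) -` {a<..<b}) \<inter> (\<lambda>x. (f (x + h) - f x) / h) -` {q<..}"
  have o: "open (?O h)" if "h \<noteq> 0" for h
  proof (rule continuous_open_preimage)
    show "continuous_on ({a<..<b} \<inter> (\<lambda>x. x + h) -` {a<..<b}) (\<lambda>x. (f (x + h) - f x) / h)"
      using that by (intro continuous_intros continuous_on_compose2[OF f] continuous_on_subset[OF f]) auto
    show "open ({a<..<b} \<inter> (\<lambda>x. x + h) -` {a<..<b})"
      by (intro open_Int open_greaterThanLessThan open_vimage continuous_intros)
  qed simp
  define X where "X n = (\<Union>h\<in>{h. h \<noteq> 0 \<and> \<bar>h\<bar> < inverse (real (Suc n))}. ?O h)" for n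
  have "X n \<in> sets borel" for n
    unfolding X_def by (rule borel_open, rule open_UN, rule ballI, rule o) simp
  then have "(\<Inter>n. X n) \<in> sets borel" by blast
  moreover have "steep f a b q = (\<Inter>n. X n)"
    unfolding steep_def X_def by auto
  ultimately show ?thesis by simp
qed

text \<open>Every point of \<open>E\<close> is an endpoint of arbitrarily short intervals in
  \<open>X\<close> on which \<open>f\<close> rises by at least \<open>q\<close> times the length.
  They form a Vitali covering, of which finitely many disjoint members exhaust \<open>E\<close> up
  to measure \<open>e\<close>.\<close>

lemma steep_cover:
  assumes E: "E \<subseteq> steep f a b q" "E \<in> sets lebesgue" and X: "open X" "E \<subseteq> X" and e: "e > 0"
  obtains D where "D division_of \<Union>D" "\<Union>D \<subseteq> X" "\<Union>D \<subseteq> {a<..<b}" "pairwise disjnt D"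
    "\<And>K. K \<in> D \<Longrightarrow> q * (Sup K - Inf K) \<le> f (Sup K) - f (Inf K)"
    "measure lebesgue (E - \<Union>D) < e"
proof -
  let ?K = "{(c, r). r > 0 \<and> {c - r..c + r} \<subseteq> X \<inter> {a<..<b} \<and> q * (2 * r) \<le> f (c + r) - f (c - r)}"
  have "\<exists>i. i \<in> ?K \<and> x \<in> cball (fst i) (snd i) \<and> snd i < d" if x: "x \<in> E" and d: "0 < d" for x d
  proof -
    obtain \<rho> where \<rho>: "\<rho> > 0" "ball x \<rho> \<subseteq> X" using X x by (meson openE subsetD)
    have "min d \<rho> > 0" using d \<rho> by simp
    then obtain n where n: "inverse (real (Suc n)) < min d \<rho>" using reals_Archimedean by blast
    obtain h where h: "h \<noteq> 0" "\<bar>h\<bar> < inverse (Suc n)" "x + h \<in> {a<..<b}" "q < (f (x + h) - f x) / h"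
      using subsetD[OF E(1) x] unfolding steep_def by blast
    have xab: "x \<in> {a<..<b}" using subsetD[OF E(1) x] unfolding steep_def by blast
    \<comment> \<open>The covering theorem asks for balls: this one is the closed interval between
      \<open>x\<close> and \<open>x + h\<close>, whichever sign \<open>h\<close> has.\<close>
    let ?c = "x + h / 2" and ?r = "\<bar>h\<bar> / 2"
    have sub: "{?c - ?r..?c + ?r} \<subseteq> X"
    proof
      fix y assume "y \<in> {?c - ?r..?c + ?r}"
      then have "\<bar>y - x\<bar> \<le> \<bar>h\<bar>" by (auto simp: abs_if split: if_splits)
      then show "y \<in> X" using \<rho>(2) h(2) n by (auto simp: dist_real_def abs_minus_commute)
    qed
    have sub2: "{?c - ?r..?c + ?r} \<subseteq> {a<..<b}" using xab h(3) by (auto simp: abs_if split: if_splits)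
    have "q * (2 * ?r) \<le> f (?c + ?r) - f (?c - ?r)"
    proof (cases "h > 0")
      case True
      then have e: "?c + ?r = x + h" "?c - ?r = x" "2 * ?r = h" by auto
      have "q * h < f (x + h) - f x" using h(4) True by (simp add: pos_less_divide_eq)
      then show ?thesis unfolding e by simp
    next
      case False
      then have "h < 0" using h(1) by simp
      then have e: "?c + ?r = x" "?c - ?r = x + h" "2 * ?r = - h" by auto
      have "f (x + h) - f x < q * h" using h(4) \<open>h < 0\<close> by (simp add: neg_less_divide_eq)
      then show ?thesis unfolding e by simp
    qed
    then have "(?c, ?r) \<in> ?K" using sub sub2 h(1) by simp
    moreover have "x \<in> cball ?c ?r" by (simp add: dist_real_def)
    moreover have "?r < d" using h(2) n abs_ge_zero[of h] by linarith
    ultimately show ?thesis by (intro exI[of _ "(?c, ?r)"]) simp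
  qed
  then have ex: "\<exists>i. i \<in> ?K \<and> x \<in> cball (fst i) (snd i) \<and> snd i < d" if "x \<in> E" "0 < d" for x d
    using that by simp
  obtain C where C: "countable C" "C \<subseteq> ?K"
     "pairwise (\<lambda>i j. disjnt (cball (fst i) (snd i)) (cball (fst j) (snd j))) C"
     "negligible (E - (\<Union>i \<in> C. cball (fst i) (snd i)))"
  proof (rule Vitali_covering_theorem_cballs[of ?K snd E fst])
    show "0 < snd i" if "i \<in> ?K" for i using that by (simp add: case_prod_beta)
  qed (use ex in simp_all)
  define D0 where "D0 = (\<lambda>i. cball (fst i) (snd i)) ` C"
  have D0: "\<exists>c r. K = {c - r..c + r} \<and> r > 0 \<and> {c - r..c + r} \<subseteq> X \<inter> {a<..<b} \<and> q * (2 * r) \<le> f (c + r) - f (c - r)"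
    if "K \<in> D0" for K
  proof -
    obtain i where i: "i \<in> C" "K = cball (fst i) (snd i)" using \<open>K \<in> D0\<close> unfolding D0_def by blast
    have "i \<in> ?K" using i(1) C(2) by (rule subsetD[rotated])
    then show ?thesis using i(2)
      by (intro exI[of _ "fst i"] exI[of _ "snd i"]) (simp add: case_prod_beta cball_eq_atLeastAtMost)
  qed
  have D0sub: "\<Union>D0 \<subseteq> X \<inter> {a<..<b}"
  proof (rule Union_least)
    fix K assume "K \<in> D0"
    then show "K \<subseteq> X \<inter> {a<..<b}" using D0[of K] by auto
  qed
  have D0m: "K \<in> lmeasurable" if "K \<in> D0" for K using that by (auto simp: D0_def)
  have cnt: "countable D0" using C(1) by (simp add: D0_def)
  have D0s: "\<Union>D0 \<in> sets lebesgue" using cnt D0m by (intro sets.countable_Union) auto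
  have ab: "{a<..<b} \<in> lmeasurable" using lmeasurable_box[of a b] by simp
  then have D0M: "\<Union>D0 \<in> lmeasurable" using D0sub D0s by (intro fmeasurableI2[OF ab]) auto
  obtain D where D: "D \<subseteq> D0" "finite D" "measure lebesgue (\<Union>D0) - e < measure lebesgue (\<Union>D)"
  proof (rule measure_countable_Union_approachable[OF cnt e D0m])
    show "measure lebesgue (\<Union>D') \<le> measure lebesgue (\<Union>D0)" if "D' \<subseteq> D0" "finite D'" for D'
      using that D0m D0M by (intro measure_mono_fmeasurable sets.finite_Union) auto
  qed
  have dis: "pairwise disjnt D"
    unfolding pairwise_def
  proof (intro ballI impI)
    fix I J assume "I \<in> D" "J \<in> D" "I \<noteq> J"
    then obtain i j where "i \<in> C" "j \<in> C" "I = cball (fst i) (snd i)" "J = cball (fst j) (snd j)"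
      using D(1) unfolding D0_def by blast
    then show "disjnt I J" using pairwiseD[OF C(3), of i j] \<open>I \<noteq> J\<close> by blast
  qed
  show thesis
  proof (rule that[OF _ _ _ dis])
    show "D division_of \<Union>D"
    proof (rule division_ofI)
      fix K assume K: "K \<in> D"
      then obtain c r where cr: "K = {c - r..c + r}" "r > 0" using D0[of K] D(1) by auto
      show "K \<noteq> {}" using cr by simp
      show "\<exists>a b. K = cbox a b" unfolding cr(1) by (metis cbox_interval)
      fix J assume J: "J \<in> D" "K \<noteq> J"
      then have "K \<inter> J = {}" using dis K by (simp add: pairwise_def disjnt_def)
      then show "interior K \<inter> interior J = {}" using interior_subset by blast
    qed (use D(2) in auto)
    show "\<Union>D \<subseteq> X" "\<Union>D \<subseteq> {a<..<b}" using D0sub Union_mono[OF D(1)] by (meson Int_lower1 Int_lower2 order_trans)+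
    fix K assume "K \<in> D"
    then obtain c r where cr: "K = {c - r..c + r}" "r > 0" "q * (2 * r) \<le> f (c + r) - f (c - r)"
      using D0[of K] D(1) by auto
    then show "q * (Sup K - Inf K) \<le> f (Sup K) - f (Inf K)" by simp
  next
    have DM: "\<Union>D \<in> lmeasurable" using D(1,2) D0m by (intro fmeasurable.finite_Union) auto
    have Es: "E - \<Union>D0 \<in> null_sets lebesgue" using C(4) by (simp add: D0_def negligible_iff_null_sets)
    have s1: "\<Union>D0 - \<Union>D \<in> lmeasurable" using D0M DM by (simp add: fmeasurable.Diff)
    have "measure lebesgue (E - \<Union>D) \<le> measure lebesgue ((\<Union>D0 - \<Union>D) \<union> (E - \<Union>D0))"
    proof (rule measure_mono_fmeasurable)
      show "(\<Union>D0 - \<Union>D) \<union> (E - \<Union>D0) \<in> lmeasurable"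
        using s1 Es by (intro fmeasurable.Un) (auto simp: fmeasurable_def null_sets_def)
      show "E - \<Union>D \<in> sets lebesgue" using E(2) DM by auto
    qed auto
    also have "\<dots> = measure lebesgue (\<Union>D0 - \<Union>D)"
      using s1 Es by (intro measure_Un_null_set) auto
    also have "\<dots> = measure lebesgue (\<Union>D0) - measure lebesgue (\<Union>D)"
      using D0M DM D(1) by (intro measurable_measure_Diff) auto
    also have "\<dots> < e" using D(3) by simp
    finally show "measure lebesgue (E - \<Union>D) < e" .
  qed
qed

text \<open>The parts of the intervals of \<open>D1\<close> that \<open>D2\<close> leaves uncovered form a system of intervals
  of small total length, to which absolute continuity applies.\<close>

lemma absolutely_continuous_curve_gaps:
  fixes f :: "real \<Rightarrow> real"
  assumes ac: "\<And>D. D division_of \<Union>D \<Longrightarrow> \<Union>D \<subseteq> {a..b} \<Longrightarrow> (\<Sum>K\<in>D. Sup K - Inf K) < \<delta> \<Longrightarrow>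
       (\<Sum>K\<in>D. norm (f (Sup K) - f (Inf K))) < \<epsilon>"
    and D1: "D1 division_of \<Union>D1" "\<Union>D1 \<subseteq> {a..b}" "pairwise disjnt D1"
    and D2: "D2 division_of \<Union>D2" "\<And>K. K \<in> D2 \<Longrightarrow> \<exists>I\<in>D1. K \<subseteq> I"
    and len: "(\<Sum>K\<in>D1. Sup K - Inf K) - (\<Sum>K\<in>D2. Sup K - Inf K) < \<delta>"
  shows "\<bar>(\<Sum>K\<in>D1. f (Sup K) - f (Inf K)) - (\<Sum>K\<in>D2. f (Sup K) - f (Inf K))\<bar> < \<epsilon>"
proof -
  note K1 = division_real_D[OF D1(1)] and K2 = division_real_D[OF D2(1)]
  have fin: "finite D1" "finite D2" using D1 D2 by (auto intro: division_of_finite)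
  define P where "P I = {K \<in> D2. K \<subseteq> I}" for I
  have "\<exists>q. P I \<subseteq> q \<and> q division_of I" if "I \<in> D1" for I
  proof -
    have "P I division_of \<Union>(P I)" using division_of_subset[OF D2(1), of "P I"] by (auto simp: P_def)
    moreover have "\<Union>(P I) \<subseteq> cbox (Inf I) (Sup I)" using K1(1)[OF that] by (auto simp: P_def)
    ultimately obtain q where "P I \<subseteq> q" "q division_of cbox (Inf I) (Sup I)"
      by (rule partial_division_extend_interval)
    then show ?thesis using K1(1)[OF that] by auto
  qed
  then obtain Q where Q: "\<And>I. I \<in> D1 \<Longrightarrow> P I \<subseteq> Q I" "\<And>I. I \<in> D1 \<Longrightarrow> Q I division_of I" by metis
  have finQ: "finite (Q I)" if "I \<in> D1" for I using Q(2)[OF that] by (rule division_of_finite)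
  have finP: "finite (P I)" for I using fin by (simp add: P_def)
  define G where "G = (\<Union>I\<in>D1. Q I - P I)"
  have sep: "K \<notin> Q J" if "I \<in> D1" "J \<in> D1" "I \<noteq> J" "K \<in> Q I" for I J K
  proof
    assume "K \<in> Q J"
    then have "K \<subseteq> J" using division_ofD(2)[OF Q(2)[OF that(2)]] by simp
    moreover have "K \<subseteq> I" using division_ofD(2)[OF Q(2)[OF that(1)] that(4)] .
    moreover have "K \<noteq> {}" using division_ofD(3)[OF Q(2)[OF that(1)] that(4)] .
    moreover have "I \<inter> J = {}" using D1(3) that(1-3) by (simp add: pairwise_def disjnt_def)
    ultimately show False by (metis Int_greatest subset_empty)
  qed
  have UD2: "D2 = (\<Union>I\<in>D1. P I)" using D2(2) by (auto simp: P_def)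
  have sums: "(\<Sum>K\<in>D1. g (Sup K) - g (Inf K)) - (\<Sum>K\<in>D2. g (Sup K) - g (Inf K)) = (\<Sum>K\<in>G. g (Sup K) - g (Inf K))"
    for g :: "real \<Rightarrow> real"
  proof -
    let ?g = "\<lambda>K. g (Sup K) - g (Inf K)"
    have "(\<Sum>K\<in>D1. ?g K) = (\<Sum>I\<in>D1. \<Sum>K\<in>Q I. ?g K)"
    proof (rule sum.cong[OF refl])
      fix I assume I: "I \<in> D1"
      have "Q I division_of {Inf I..Sup I}" using Q(2)[OF I] K1(1)[OF I] by simp
      from sum_division_telescope[OF this K1(2)[OF I]] show "?g I = (\<Sum>K\<in>Q I. ?g K)" by simp
    qed
    also have "\<dots> = (\<Sum>I\<in>D1. (\<Sum>K\<in>Q I - P I. ?g K) + (\<Sum>K\<in>P I. ?g K))"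
      using Q(1) finQ by (intro sum.cong refl sum.subset_diff) auto
    also have "\<dots> = (\<Sum>I\<in>D1. \<Sum>K\<in>Q I - P I. ?g K) + (\<Sum>I\<in>D1. \<Sum>K\<in>P I. ?g K)"
      by (rule sum.distrib)
    also have "(\<Sum>I\<in>D1. \<Sum>K\<in>Q I - P I. ?g K) = (\<Sum>K\<in>G. ?g K)"
      unfolding G_def
    proof (rule sum.UNION_disjoint[symmetric])
      show "\<forall>I\<in>D1. \<forall>J\<in>D1. I \<noteq> J \<longrightarrow> (Q I - P I) \<inter> (Q J - P J) = {}"
        using sep by (auto simp: disjoint_iff)
    qed (use finQ fin in auto)
    also have "(\<Sum>I\<in>D1. \<Sum>K\<in>P I. ?g K) = (\<Sum>K\<in>\<Union>(P ` D1). ?g K)"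
    proof (rule sum.UNION_disjoint[symmetric])
      show "\<forall>I\<in>D1. \<forall>J\<in>D1. I \<noteq> J \<longrightarrow> P I \<inter> P J = {}"
      proof (intro ballI impI)
        fix I J assume IJ: "I \<in> D1" "J \<in> D1" "I \<noteq> J"
        show "P I \<inter> P J = {}" using sep[OF IJ] Q(1)[OF IJ(1)] Q(1)[OF IJ(2)] by auto
      qed
    qed (use finP fin in auto)
    also have "\<Union>(P ` D1) = D2" using UD2 by simp
    finally show ?thesis by simp
  qed
  have G: "G division_of \<Union>G"
  proof (rule division_ofI)
    show "finite G" using finQ fin by (auto simp: G_def)
    fix K assume K: "K \<in> G"
    then obtain I where I: "I \<in> D1" "K \<in> Q I" by (auto simp: G_def)
    show "K \<noteq> {}" "\<exists>a b. K = cbox a b" using division_ofD(3,4)[OF Q(2)[OF I(1)] I(2)] .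
    fix J assume J: "J \<in> G" "K \<noteq> J"
    then obtain I' where I': "I' \<in> D1" "J \<in> Q I'" by (auto simp: G_def)
    show "interior K \<inter> interior J = {}"
    proof (cases "I = I'")
      case True
      then show ?thesis using division_ofD(5)[OF Q(2)[OF I(1)] I(2), of J] I' J by simp
    next
      case False
      have "K \<subseteq> I" "J \<subseteq> I'" using division_ofD(2)[OF Q(2)[OF I(1)] I(2)] division_ofD(2)[OF Q(2)[OF I'(1)] I'(2)] .
      moreover have "I \<inter> I' = {}" using D1(3) False I(1) I'(1) by (simp add: pairwise_def disjnt_def)
      ultimately show ?thesis using interior_subset by blast
    qed
  qed auto
  moreover have "\<Union>G \<subseteq> {a..b}"
  proof -
    have "K \<subseteq> I" if "I \<in> D1" "K \<in> Q I" for I K using division_ofD(2)[OF Q(2)[OF that(1)] that(2)] .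
    then show ?thesis using D1(2) unfolding G_def by blast
  qed
  moreover have "(\<Sum>K\<in>G. Sup K - Inf K) < \<delta>" using sums[of "\<lambda>x. x"] len by simp
  ultimately have "(\<Sum>K\<in>G. norm (f (Sup K) - f (Inf K))) < \<epsilon>" by (rule ac)
  moreover have "\<bar>\<Sum>K\<in>G. f (Sup K) - f (Inf K)\<bar> \<le> (\<Sum>K\<in>G. norm (f (Sup K) - f (Inf K)))"
    unfolding real_norm_def by (rule sum_abs)
  ultimately show ?thesis unfolding sums[of f] by linarith
qed

lemma measure_le_Diff_add:
  assumes "A \<in> lmeasurable" "B \<in> lmeasurable"
  shows "measure lebesgue A \<le> measure lebesgue (A - B) + measure lebesgue B"
proof -
  have "measure lebesgue A \<le> measure lebesgue ((A - B) \<union> B)"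
    using assms by (intro measure_mono_fmeasurable) auto
  also have "\<dots> \<le> measure lebesgue (A - B) + measure lebesgue B"
    using assms by (intro measure_Un_le) auto
  finally show ?thesis .
qed

lemma steep_subset: "steep f a b q \<subseteq> {a<..<b}"
  by (auto simp: steep_def)

lemma steep_lmeasurable:
  assumes f: "continuous_on {a<..<b} f"
  shows "steep f a b q \<in> lmeasurable"
proof -
  have "{a<..<b} \<in> lmeasurable" using lmeasurable_box[of a b] by simp
  then show ?thesis using steep_subset steep_measurable[OF f] by (rule fmeasurableI2)
qed

text \<open>Suppose the set has measure \<mu> > 0. Cover it by intervals \<open>D1\<close> on which
  \<open>f\<close> rises by at most \<open>p\<close> times the length, and cover its part in their
  interiors by intervals \<open>D2\<close> on which \<open>f\<close> rises by at least
  \<open>q\<close> times the length. Both systems have total length close to \<mu>, so by absolute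
  continuity their total increments nearly agree; yet one is at most about \<open>p * \<mu>\<close>
  and the other at least about \<open>q * \<mu>\<close>.\<close>

lemma negligible_steep_both:
  fixes f :: "real \<Rightarrow> real"
  assumes ac: "absolutely_continuous_curve a b f" and pq: "p < q"
  shows "negligible (steep f a b q \<inter> steep (\<lambda>x. - f x) a b (- p))" (is "negligible ?E")
proof (rule ccontr)
  assume nn: "\<not> negligible ?E"
  have cf: "continuous_on {a<..<b} f"
    using absolutely_continuous_curve_continuous[OF ac] by (rule continuous_on_subset) auto
  have cf': "continuous_on {a<..<b} (\<lambda>x. - f x)" using cf by (rule continuous_on_minus)
  have Em: "?E \<in> lmeasurable"
    by (intro fmeasurable.Int steep_lmeasurable cf cf')
  define \<mu> where "\<mu> = measure lebesgue ?E"
  have mu: "\<mu> > 0"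
    using nn Em by (metis \<mu>_def measure_nonneg negligible_iff_measure order_le_less)
  define \<epsilon> where "\<epsilon> = (q - p) * \<mu> / 8"
  have e: "\<epsilon> > 0" using mu pq by (simp add: \<epsilon>_def)
  obtain \<delta> where d: "\<delta> > 0" and AC: "\<And>D. D division_of \<Union>D \<Longrightarrow> \<Union>D \<subseteq> {a..b} \<Longrightarrow> (\<Sum>K\<in>D. Sup K - Inf K) < \<delta> \<Longrightarrow>
       (\<Sum>K\<in>D. norm (f (Sup K) - f (Inf K))) < \<epsilon>"
    using absolutely_continuous_curve_division[OF ac e] by blast
  \<comment> \<open>\<open>\<delta> / 4\<close> keeps the length difference of the two systems, at
    most \<open>3 * \<eta>\<close>, below \<delta>; \<open>\<mu> / 4\<close> keeps the shorter
    length at least \<open>\<mu> / 2\<close>; the third bound limits the error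
    \<open>3 * \<bar>p\<bar> * \<eta>\<close>. Together with \<epsilon> the losses are (1/8 + 3/16)
    (q - p) \<mu>, less than the available (q - p) \<mu> / 2.\<close>
  define \<eta> where "\<eta> = min (\<delta> / 4) (min (\<mu> / 4) ((q - p) * \<mu> / (16 * (\<bar>p\<bar> + 1))))"
  have eta: "\<eta> > 0" "\<eta> \<le> \<delta> / 4" "\<eta> \<le> \<mu> / 4" "\<eta> \<le> (q - p) * \<mu> / (16 * (\<bar>p\<bar> + 1))"
  proof -
    have "0 < (q - p) * \<mu> / (16 * (\<bar>p\<bar> + 1))" using mu pq by (intro divide_pos_pos mult_pos_pos) auto
    then show "\<eta> > 0" unfolding \<eta>_def using d mu by (simp only: min_less_iff_conj) simp
  qed (simp_all only: \<eta>_def min.cobounded1 min.coboundedI2 min.cobounded2)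
  have "\<bar>p\<bar> * \<eta> \<le> (\<bar>p\<bar> + 1) * \<eta>" using eta(1) by (simp add: algebra_simps)
  also have "\<dots> \<le> (\<bar>p\<bar> + 1) * ((q - p) * \<mu> / (16 * (\<bar>p\<bar> + 1)))"
    by (rule mult_left_mono[OF eta(4)]) simp
  also have "\<dots> = (q - p) * \<mu> / 16" by (simp add: field_simps)
  finally have eta5: "\<bar>p\<bar> * \<eta> \<le> (q - p) * \<mu> / 16" .
  obtain X0 where X0: "open X0" "?E \<subseteq> X0" "X0 - ?E \<in> lmeasurable" "emeasure lebesgue (X0 - ?E) < ennreal \<eta>"
    by (rule sets_lebesgue_outer_open[of ?E \<eta>]) (use Em eta in auto)
  have X0m: "measure lebesgue (X0 - ?E) < \<eta>"
    using X0(3,4) eta by (simp add: emeasure_eq_measure2 ennreal_less_iff)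
  have "X0 = (X0 - ?E) \<union> ?E" using X0(2) by blast
  then have X0M: "X0 \<in> lmeasurable" using X0(3) Em by (metis fmeasurable.Un)
  have X0mu: "measure lebesgue X0 \<le> \<mu> + \<eta>"
    using measure_le_Diff_add[OF X0M Em] X0m by (simp add: \<mu>_def)
  obtain D1 where D1: "D1 division_of \<Union>D1" "\<Union>D1 \<subseteq> X0" "\<Union>D1 \<subseteq> {a<..<b}" "pairwise disjnt D1"
    "\<And>K. K \<in> D1 \<Longrightarrow> - p * (Sup K - Inf K) \<le> - f (Sup K) - - f (Inf K)"
    "measure lebesgue (?E - \<Union>D1) < \<eta>"
    by (rule steep_cover[of ?E "\<lambda>x. - f x" a b "- p" X0 \<eta>]) (use Em X0 eta in auto)
  note K1 = division_real_D[OF D1(1)]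
  have fin1: "finite D1" using D1(1) by (rule division_of_finite)
  \<comment> \<open>The second covering takes place in an open set, so the intervals are replaced by
    their interiors; only finitely many endpoints are lost.\<close>
  define X where "X = (\<Union>K\<in>D1. interior K)"
  have int: "interior K = {Inf K<..<Sup K}" if "K \<in> D1" for K
    using arg_cong[where f = interior, OF K1(1)[OF that]] unfolding interior_atLeastAtMost_real .
  have Xo: "open X" unfolding X_def by auto
  define E2 where "E2 = ?E \<inter> X"
  have XD1: "X \<subseteq> \<Union>D1" unfolding X_def using interior_subset by blast
  have D1M: "\<Union>D1 \<in> lmeasurable" using measure_division_real(2)[OF D1(1)] .
  have XM: "X \<in> lmeasurable" using D1M XD1 Xo by (intro fmeasurableI2[OF D1M]) auto
  have E2M: "E2 \<in> lmeasurable" unfolding E2_def using Em XM by (rule fmeasurable.Int)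
  have "finite (Inf ` D1 \<union> Sup ` D1)" using fin1 by simp
  moreover have "\<Union>D1 - X \<subseteq> Inf ` D1 \<union> Sup ` D1"
  proof
    fix x assume x: "x \<in> \<Union>D1 - X"
    then obtain K where K: "K \<in> D1" "x \<in> K" by blast
    have "x \<in> {Inf K..Sup K}" using K K1(1) by blast
    moreover have "x \<notin> {Inf K<..<Sup K}" using x K(1) int unfolding X_def by blast
    ultimately show "x \<in> Inf ` D1 \<union> Sup ` D1" using K(1) by force
  qed
  ultimately have negDX: "\<Union>D1 - X \<in> null_sets lebesgue"
    by (metis finite_subset negligible_finite negligible_iff_null_sets)
  have "measure lebesgue (?E - X) \<le> measure lebesgue ((?E - \<Union>D1) \<union> (\<Union>D1 - X))"
    using Em D1M XM by (intro measure_mono_fmeasurable) auto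
  also have "\<dots> = measure lebesgue (?E - \<Union>D1)"
    using negDX Em D1M by (intro measure_Un_null_set) auto
  finally have EX: "measure lebesgue (?E - X) < \<eta>" using D1(6) by simp
  have muE2: "\<mu> \<le> measure lebesgue E2 + \<eta>"
  proof -
    have "?E - E2 = ?E - X" by (auto simp: E2_def)
    then show ?thesis using measure_le_Diff_add[OF Em E2M] EX by (simp add: \<mu>_def)
  qed
  obtain D2 where D2: "D2 division_of \<Union>D2" "\<Union>D2 \<subseteq> X" "\<Union>D2 \<subseteq> {a<..<b}" "pairwise disjnt D2"
    "\<And>K. K \<in> D2 \<Longrightarrow> q * (Sup K - Inf K) \<le> f (Sup K) - f (Inf K)"
    "measure lebesgue (E2 - \<Union>D2) < \<eta>"
    by (rule steep_cover[of E2 f a b q X \<eta>]) (use E2M Xo eta in \<open>auto simp: E2_def\<close>)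
  have D2M: "\<Union>D2 \<in> lmeasurable" using measure_division_real(2)[OF D2(1)] .
  note K2 = division_real_D[OF D2(1)]
  define L1 where "L1 = (\<Sum>K\<in>D1. Sup K - Inf K)"
  define L2 where "L2 = (\<Sum>K\<in>D2. Sup K - Inf K)"
  have L1: "L1 = measure lebesgue (\<Union>D1)" using measure_division_real(1)[OF D1(1)] by (simp add: L1_def)
  have L2: "L2 = measure lebesgue (\<Union>D2)" using measure_division_real(1)[OF D2(1)] by (simp add: L2_def)
  have "L1 \<le> measure lebesgue X0" unfolding L1 using D1(2) D1M X0M by (intro measure_mono_fmeasurable) auto
  then have L1le: "L1 \<le> \<mu> + \<eta>" using X0mu by simp
  have L2ge: "\<mu> - 2 * \<eta> \<le> L2" unfolding L2 using measure_le_Diff_add[OF E2M D2M] D2(6) muE2 by simp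
  have L21: "L2 \<le> L1" unfolding L1 L2 using D2(2) XD1 D1M D2M by (intro measure_mono_fmeasurable) auto
  \<comment> \<open>A connected interval inside a union of pairwise disjoint open interiors lies in
    one of them.\<close>
  have sub: "\<exists>I\<in>D1. K \<subseteq> I" if K: "K \<in> D2" for K
  proof -
    have ne: "Inf K \<in> K" using K2(1,2)[OF K] by (metis atLeastAtMost_iff order_refl)
    have KX: "K \<subseteq> X" using D2(2) K by blast
    then obtain I where I: "I \<in> D1" "Inf K \<in> interior I" using ne unfolding X_def by blast
    let ?V = "\<Union>J\<in>D1 - {I}. interior J"
    have "interior I \<inter> ?V \<inter> K = {}"
    proof -
      have "interior I \<inter> interior J = {}" if "J \<in> D1 - {I}" for J
        using division_ofD(5)[OF D1(1) I(1), of J] that by auto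
      then show ?thesis by blast
    qed
    moreover have "K \<subseteq> interior I \<union> ?V" using KX unfolding X_def by blast
    moreover have "connected K" using K2(8)[OF K] by (rule convex_connected)
    moreover have "open (interior I)" "open ?V" by auto
    ultimately have "interior I \<inter> K = {} \<or> ?V \<inter> K = {}" using connectedD by metis
    then have "?V \<inter> K = {}" using I(2) ne by blast
    then have "K \<subseteq> interior I" using \<open>K \<subseteq> interior I \<union> ?V\<close> by blast
    then show ?thesis using I(1) interior_subset by (metis order_trans)
  qed
  have "\<bar>(\<Sum>K\<in>D1. f (Sup K) - f (Inf K)) - (\<Sum>K\<in>D2. f (Sup K) - f (Inf K))\<bar> < \<epsilon>"
  proof (rule absolutely_continuous_curve_gaps[OF AC D1(1) _ D1(4) D2(1) sub])
    show "\<Union>D1 \<subseteq> {a..b}" using D1(3) by fastforce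
    show "(\<Sum>K\<in>D1. Sup K - Inf K) - (\<Sum>K\<in>D2. Sup K - Inf K) < \<delta>"
      using L1le L2ge eta unfolding L1_def[symmetric] L2_def[symmetric] by linarith
  qed
  moreover have "(\<Sum>K\<in>D1. f (Sup K) - f (Inf K)) \<le> p * L1"
    unfolding L1_def sum_distrib_left using D1(5) by (intro sum_mono) (force simp: algebra_simps)
  moreover have "q * L2 \<le> (\<Sum>K\<in>D2. f (Sup K) - f (Inf K))"
    unfolding L2_def sum_distrib_left using D2(5) by (intro sum_mono) auto
  ultimately have 1: "q * L2 < \<epsilon> + p * L1" by linarith
  have 2: "p * L1 \<le> p * L2 + \<bar>p\<bar> * (3 * \<eta>)"
  proof -
    have "p * (L1 - L2) \<le> \<bar>p\<bar> * (L1 - L2)" using L21 by (intro mult_right_mono) auto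
    also have "\<dots> \<le> \<bar>p\<bar> * (3 * \<eta>)" using L1le L2ge by (intro mult_left_mono) auto
    finally show ?thesis by (simp add: algebra_simps)
  qed
  have "(q - p) * (\<mu> / 2) \<le> (q - p) * L2" using L2ge eta pq by (intro mult_left_mono) auto
  moreover have "(q - p) * L2 = q * L2 - p * L2" by (rule left_diff_distrib)
  moreover have "\<bar>p\<bar> * (3 * \<eta>) = 3 * (\<bar>p\<bar> * \<eta>)" by simp
  moreover have "(q - p) * (\<mu> / 2) = (q - p) * \<mu> / 2" by simp
  ultimately have "(q - p) * \<mu> / 2 < \<epsilon> + 3 * ((q - p) * \<mu> / 16)" using 1 2 eta5 by linarith
  then have "(q - p) * \<mu> < 0" unfolding \<epsilon>_def by linarith
  then show False using mu pq by (simp add: mult_less_0_iff)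
qed

text \<open>Intervals of total length below \<delta> have total increment below 1, so those of slope
  at least \<open>n\<close> have total length at most 1/n. Hence the part of the set in an interval
  shorter than \<delta> has arbitrarily small measure, and negligibility is a local
  property.\<close>

lemma negligible_steep_all:
  fixes f :: "real \<Rightarrow> real"
  assumes ac: "absolutely_continuous_curve a b f"
  shows "negligible (\<Inter>n::nat. steep f a b (real n))" (is "negligible ?N")
proof -
  have cf: "continuous_on {a<..<b} f"
    using absolutely_continuous_curve_continuous[OF ac] by (rule continuous_on_subset) auto
  obtain \<delta> where d: "\<delta> > 0" and AC: "\<And>D. D division_of \<Union>D \<Longrightarrow> \<Union>D \<subseteq> {a..b} \<Longrightarrow> (\<Sum>K\<in>D. Sup K - Inf K) < \<delta> \<Longrightarrow>
       (\<Sum>K\<in>D. norm (f (Sup K) - f (Inf K))) < 1"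
    using absolutely_continuous_curve_division[OF ac zero_less_one] by blast
  have Ns: "?N \<in> sets lebesgue" using steep_measurable[OF cf] by (intro sets.countable_INT) auto
  have loc: "negligible (?N \<inter> {u<..<v})" if uv: "u < v" "v - u < \<delta>" for u v
  proof -
    let ?E = "?N \<inter> {u<..<v}"
    have uvm: "{u<..<v} \<in> lmeasurable" using lmeasurable_box[of u v] by simp
    have Em: "?E \<in> lmeasurable" using Ns by (intro fmeasurableI2[OF uvm]) auto
    have le: "measure lebesgue ?E \<le> 2 / real (Suc n)" for n
    proof -
      have 0: "1 / real (Suc n) > 0" by simp
      obtain D where D: "D division_of \<Union>D" "\<Union>D \<subseteq> {u<..<v}" "\<Union>D \<subseteq> {a<..<b}" "pairwise disjnt D"
        "\<And>K. K \<in> D \<Longrightarrow> real (Suc n) * (Sup K - Inf K) \<le> f (Sup K) - f (Inf K)"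
        "measure lebesgue (?E - \<Union>D) < 1 / real (Suc n)"
      proof (rule steep_cover[of ?E f a b "real (Suc n)" "{u<..<v}" "1 / real (Suc n)"])
        show "?E \<subseteq> steep f a b (real (Suc n))" by blast
      qed (use Em 0 in \<open>simp_all del: of_nat_Suc\<close>)
      note DM = measure_division_real[OF D(1)]
      have "measure lebesgue (\<Union>D) \<le> measure lebesgue {u<..<v}"
        using D(2) DM(2) uvm by (intro measure_mono_fmeasurable) auto
      also have "\<dots> = v - u" using uv by simp
      finally have "measure lebesgue (\<Union>D) < \<delta>" using uv by simp
      then have "(\<Sum>K\<in>D. norm (f (Sup K) - f (Inf K))) < 1"
        using D(3) DM(1) by (intro AC[OF D(1)]) fastforce+
      moreover have "real (Suc n) * measure lebesgue (\<Union>D) \<le> (\<Sum>K\<in>D. norm (f (Sup K) - f (Inf K)))"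
        unfolding DM(1) sum_distrib_left
      proof (rule sum_mono)
        fix K assume "K \<in> D"
        from D(5)[OF this] show "real (Suc n) * (Sup K - Inf K) \<le> norm (f (Sup K) - f (Inf K))"
          unfolding real_norm_def by linarith
      qed
      ultimately have "real (Suc n) * measure lebesgue (\<Union>D) \<le> 1" by linarith
      then have "measure lebesgue (\<Union>D) \<le> 1 / real (Suc n)" by (simp add: field_simps)
      moreover have "2 / real (Suc n) = 1 / real (Suc n) + 1 / real (Suc n)" by simp
      ultimately show ?thesis using measure_le_Diff_add[OF Em DM(2)] D(6) by linarith
    qed
    have "measure lebesgue ?E \<le> 0"
    proof (rule LIMSEQ_le_const)
      have "(\<lambda>n. 2 * inverse (real (Suc n))) \<longlonglongrightarrow> 2 * 0"
        by (intro tendsto_mult tendsto_const LIMSEQ_inverse_real_of_nat)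
      then show "(\<lambda>n. 2 / real (Suc n)) \<longlonglongrightarrow> 0" by (simp add: field_simps)
    qed (use le in auto)
    then show ?thesis using Em by (metis measure_le_0_iff negligible_iff_measure)
  qed
  show ?thesis
    unfolding locally_negligible_alt[of ?N]
  proof (intro ballI exI conjI)
    fix x assume x: "x \<in> ?N"
    show "openin (top_of_set ?N) (?N \<inter> {x - \<delta> / 3<..<x + \<delta> / 3})" by (rule openin_open_Int) simp
    show "x \<in> ?N \<inter> {x - \<delta> / 3<..<x + \<delta> / 3}" using x d by simp
    show "negligible (?N \<inter> {x - \<delta> / 3<..<x + \<delta> / 3})" by (rule loc) (use d in auto)
  qed
qed

lemma not_steepD:
  assumes "x \<in> {a<..<b}" "x \<notin> steep f a b q"
  shows "\<forall>\<^sub>F h in at 0. (f (x + h) - f x) / h \<le> q"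
proof -
  obtain n :: nat where n: "\<And>h. h \<noteq> 0 \<Longrightarrow> \<bar>h\<bar> < inverse (Suc n) \<Longrightarrow> x + h \<in> {a<..<b} \<Longrightarrow> (f (x + h) - f x) / h \<le> q"
  proof -
    have "\<not> (\<forall>n::nat. \<exists>h. h \<noteq> 0 \<and> \<bar>h\<bar> < inverse (Suc n) \<and> x + h \<in> {a<..<b} \<and> q < (f (x + h) - f x) / h)"
      using assms unfolding steep_def by blast
    then show ?thesis using that by (meson not_less)
  qed
  define d where "d = min (inverse (Suc n)) (min (x - a) (b - x))"
  have d0: "d > 0" using assms(1) by (simp add: d_def)
  have "(f (x + h) - f x) / h \<le> q" if "h \<noteq> 0" "dist h 0 < d" for h
  proof (rule n[OF that(1)])
    have "\<bar>h\<bar> < d" using that(2) by (simp add: dist_real_def)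
    then show "\<bar>h\<bar> < inverse (Suc n)" "x + h \<in> {a<..<b}" by (auto simp: d_def abs_less_iff)
  qed
  then show ?thesis unfolding eventually_at using d0 by auto
qed

text \<open>The derivative is the supremum of the \<open>q\<close> with
  \<open>x \<in> steep f a b q\<close>, that is, the upper derivate. The first condition says that
  no rational gap separates it from the lower derivate, the other two that both derivates are
  finite.\<close>

lemma differentiable_if_not_steep:
  fixes f :: "real \<Rightarrow> real"
  assumes x: "x \<in> {a<..<b}"
    and 1: "\<And>p q. p \<in> \<rat> \<Longrightarrow> q \<in> \<rat> \<Longrightarrow> p < q \<Longrightarrow> x \<notin> steep f a b q \<inter> steep (\<lambda>x. - f x) a b (- p)"
    and 2: "x \<notin> (\<Inter>n::nat. steep f a b (real n))"
    and 3: "x \<notin> (\<Inter>n::nat. steep (\<lambda>x. - f x) a b (real n))"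
  shows "f differentiable (at x)"
proof -
  let ?Q = "\<lambda>h. (f (x + h) - f x) / h"
  obtain n :: nat where n: "x \<notin> steep f a b (real n)" using 2 by blast
  obtain k :: nat where k: "x \<notin> steep (\<lambda>x. - f x) a b (real k)" using 3 by blast
  have neg: "\<forall>\<^sub>F h in at 0. p \<le> ?Q h" if "x \<notin> steep (\<lambda>x. - f x) a b (- p)" for p
  proof (rule eventually_mono[OF not_steepD[OF x that]])
    fix h assume "(- f (x + h) - - f x) / h \<le> - p"
    moreover have "(- f (x + h) - - f x) / h = - ?Q h" by (simp add: diff_divide_distrib)
    ultimately show "p \<le> ?Q h" by linarith
  qed
  define S where "S = {q. x \<in> steep f a b q}"
  have up: "\<forall>\<^sub>F h in at 0. ?Q h \<le> q" if "q \<notin> S" for q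
    using not_steepD[OF x] that by (simp add: S_def)
  have down: "q' \<in> S" if "q \<in> S" "q' < q" for q q'
    using that unfolding S_def steep_def by (auto intro: less_trans) (meson less_trans)
  have bdd: "bdd_above S"
    using n down unfolding bdd_above_def S_def by (metis mem_Collect_eq not_le)
  have "- real k - 1 \<in> S"
  proof (rule ccontr)
    assume "- real k - 1 \<notin> S"
    from up[OF this] neg[of "- real k"] k
    have "\<forall>\<^sub>F h in at 0. ?Q h \<le> - real k - 1 \<and> - real k \<le> ?Q h" by (simp add: eventually_conj)
    then have "\<forall>\<^sub>F h in at (0::real). False" by (rule eventually_mono) linarith
    then show False by simp
  qed
  then have ne: "S \<noteq> {}" by blast
  define L where "L = Sup S"
  have "(?Q \<longlongrightarrow> L) (at 0)"
  proof (rule order_tendstoI)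
    fix y assume "y < L"
    then obtain q where q: "q \<in> S" "y < q" using less_cSup_iff[OF ne bdd] unfolding L_def by blast
    \<comment> \<open>Two rationals are needed: \<open>q'\<close> lies in \<open>S\<close> because
      it is below \<open>q\<close>, and for \<open>p' < q'\<close> the first condition then bounds
      the quotients from below.\<close>
    obtain p' q' where pq: "p' \<in> \<rat>" "q' \<in> \<rat>" "y < p'" "p' < q'" "q' < q"
      using Rats_dense_in_real[OF q(2)] Rats_dense_in_real by metis
    have "q' \<in> S" using down[OF q(1) pq(5)] .
    then have "x \<notin> steep (\<lambda>x. - f x) a b (- p')" using 1[OF pq(1,2,4)] by (simp add: S_def)
    then show "\<forall>\<^sub>F h in at 0. y < ?Q h"
      by (rule eventually_mono[OF neg]) (use pq(3) in linarith)
  next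
    fix y assume y: "L < y"
    define z where "z = (L + y) / 2"
    have zy: "z < y" using y by (simp add: z_def)
    have "z \<notin> S" using cSup_upper[OF _ bdd, of z] y unfolding L_def z_def by force
    from up[OF this] show "\<forall>\<^sub>F h in at 0. ?Q h < y"
      by (rule eventually_mono) (use zy in linarith)
  qed
  then have "(f has_real_derivative L) (at x)" by (simp add: DERIV_def)
  then show ?thesis by (meson field_differentiable_def field_differentiable_imp_differentiable)
qed

theorem absolutely_continuous_curve_differentiable_real:
  fixes f :: "real \<Rightarrow> real"
  assumes ac: "absolutely_continuous_curve a b f"
  shows "negligible {x \<in> {a<..<b}. \<not> f differentiable (at x)}"
proof -
  have ac': "absolutely_continuous_curve a b (\<lambda>x. - f x)"
    by (rule absolutely_continuous_curve_lipschitz_compose[OF ac zero_less_one, where L = 1]) simp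
  let ?A = "\<lambda>(p, q). if p < q then steep f a b q \<inter> steep (\<lambda>x. - f x) a b (- p) else {}"
  let ?N = "(\<Union>r\<in>\<rat> \<times> \<rat>. ?A r) \<union> (\<Inter>n::nat. steep f a b (real n)) \<union> (\<Inter>n::nat. steep (\<lambda>x. - f x) a b (real n))"
  have "negligible (\<Union>(?A ` (\<rat> \<times> \<rat>)))"
  proof (rule negligible_countable_Union)
    show "countable (?A ` (\<rat> \<times> \<rat>))" by (intro countable_image countable_SIGMA countable_rat)
    show "negligible B" if "B \<in> ?A ` (\<rat> \<times> \<rat>)" for B
      using that negligible_steep_both[OF ac] by (auto split: if_splits)
  qed
  then have "negligible ?N"
    using negligible_steep_all[OF ac] negligible_steep_all[OF ac'] by (intro negligible_Un)
  then show ?thesis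
  proof (rule negligible_subset)
    show "{x \<in> {a<..<b}. \<not> f differentiable (at x)} \<subseteq> ?N"
    proof (rule subsetI, rule ccontr)
      fix x assume x: "x \<in> {x \<in> {a<..<b}. \<not> f differentiable (at x)}" and "x \<notin> ?N"
      then have 0: "x \<notin> ?A (p, q)" if "p \<in> \<rat>" "q \<in> \<rat>" for p q using that by blast
      have "f differentiable (at x)"
      proof (rule differentiable_if_not_steep[of x a b])
        show "x \<notin> steep f a b q \<inter> steep (\<lambda>x. - f x) a b (- p)" if "p \<in> \<rat>" "q \<in> \<rat>" "p < q" for p q
          using 0[OF that(1,2)] that(3) by simp
      qed (use x \<open>x \<notin> ?N\<close> in auto)
      then show False using x by simp
    qed
  qed
qed

theorem absolutely_continuous_curve_differentiable:
  fixes f :: "real \<Rightarrow> 'v::euclidean_space"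
  assumes ac: "absolutely_continuous_curve a b f"
  shows "negligible {x \<in> {a<..<b}. \<not> f differentiable (at x)}"
proof -
  have "negligible (\<Union>i\<in>Basis. {x \<in> {a<..<b}. \<not> (\<lambda>x. f x \<bullet> i) differentiable (at x)})"
  proof (intro negligible_Union ballI finite_imageI)
    fix S assume "S \<in> (\<lambda>i. {x \<in> {a<..<b}. \<not> (\<lambda>x. f x \<bullet> i) differentiable (at x)}) ` Basis"
    then obtain i :: 'v where i: "i \<in> Basis" "S = {x \<in> {a<..<b}. \<not> (\<lambda>x. f x \<bullet> i) differentiable (at x)}" by blast
    have "absolutely_continuous_curve a b (\<lambda>x. f x \<bullet> i)"
      by (rule absolutely_continuous_curve_lipschitz_compose[OF ac zero_less_one, where L = 1])
        (use i Basis_le_norm in \<open>simp add: inner_diff_left[symmetric]\<close>)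
    then show "negligible S" unfolding i(2) by (rule absolutely_continuous_curve_differentiable_real)
  qed simp
  then show ?thesis
    by (rule negligible_subset) (auto simp: differentiable_componentwise_within[of f])
qed

text \<open>Straddle lemma at points of differentiability; on the remaining null set the gauge is
  chosen inside an open set of small measure.\<close>

lemma absolutely_continuous_curve_has_integral:
  fixes g D :: "real \<Rightarrow> real"
  assumes ac: "absolutely_continuous_curve a b g" and ab: "a \<le> b"
    and N: "negligible N" "N \<subseteq> {a..b}"
    and D: "\<And>x. x \<in> {a..b} - N \<Longrightarrow> (g has_vector_derivative D x) (at x)"
    and D0: "\<And>x. x \<in> N \<Longrightarrow> D x = 0"
  shows "(D has_integral (g b - g a)) {a..b}"
  unfolding has_integral_real
proof (intro allI impI)
  fix e :: real assume e: "e > 0"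
  define e' where "e' = e / (2 * (b - a + 1))"
  have e': "e' > 0" using e ab by (simp add: e'_def)
  have e'2: "e' * (b - a) < e / 2" using e ab by (simp add: e'_def field_simps)
  have "e / 2 > 0" using e by simp
  from absolutely_continuous_curve_division[OF ac this]
  obtain \<delta> where d: "\<delta> > 0" and AC: "\<And>D. D division_of \<Union>D \<Longrightarrow> \<Union>D \<subseteq> {a..b} \<Longrightarrow> (\<Sum>K\<in>D. Sup K - Inf K) < \<delta> \<Longrightarrow>
       (\<Sum>K\<in>D. norm (g (Sup K) - g (Inf K))) < e / 2" by blast
  have Nnull: "N \<in> null_sets lebesgue" using N(1) by (simp add: negligible_iff_null_sets)
  obtain T where T: "open T" "N \<subseteq> T" "T - N \<in> lmeasurable" "emeasure lebesgue (T - N) < ennreal \<delta>"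
    by (rule sets_lebesgue_outer_open[of N \<delta>]) (use Nnull d in auto)
  have TM: "T \<in> lmeasurable"
  proof -
    have "T = (T - N) \<union> N" using T(2) by blast
    moreover have "N \<in> lmeasurable" using Nnull by (simp add: negligible_iff_null_sets negligible_imp_measurable)
    ultimately show ?thesis using T(3) by (metis fmeasurable.Un)
  qed
  have Tm: "measure lebesgue T < \<delta>"
  proof -
    have "measure lebesgue (T - N) = measure lebesgue T"
      using TM Nnull by (intro measure_Diff_null_set) auto
    then show ?thesis using T(3,4) d by (simp add: emeasure_eq_measure2 ennreal_less_iff)
  qed
  have "\<exists>r>0. (x \<in> N \<longrightarrow> ball x r \<subseteq> T) \<and>
     (x \<in> {a..b} - N \<longrightarrow> (\<forall>y. \<bar>y - x\<bar> < r \<longrightarrow> \<bar>g y - g x - (y - x) * D x\<bar> \<le> e' * \<bar>y - x\<bar>))" for x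
  proof (cases "x \<in> N")
    case True
    then obtain r where "r > 0" "ball x r \<subseteq> T" using T(1,2) by (meson openE subsetD)
    then show ?thesis using True by blast
  next
    case False
    show ?thesis
    proof (cases "x \<in> {a..b}")
      case True
      have "(g has_derivative (\<lambda>h. h *\<^sub>R D x)) (at x)"
        using D False True by (simp add: has_vector_derivative_def)
      then obtain r where "r > 0" "\<And>y. norm (y - x) < r \<Longrightarrow> norm (g y - g x - (y - x) *\<^sub>R D x) \<le> e' * norm (y - x)"
        using e' unfolding has_derivative_at_alt by blast
      then show ?thesis using False by (intro exI[of _ r]) simp
    qed (use False in \<open>auto intro: exI[of _ 1]\<close>)
  qed
  then obtain r where r: "\<And>x. r x > 0" "\<And>x. x \<in> N \<Longrightarrow> ball x (r x) \<subseteq> T"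
    "\<And>x y. x \<in> {a..b} - N \<Longrightarrow> \<bar>y - x\<bar> < r x \<Longrightarrow> \<bar>g y - g x - (y - x) * D x\<bar> \<le> e' * \<bar>y - x\<bar>"
    by metis
  show "\<exists>\<gamma>. gauge \<gamma> \<and> (\<forall>\<D>. \<D> tagged_division_of {a..b} \<and> \<gamma> fine \<D> \<longrightarrow>
         norm ((\<Sum>(x, k)\<in>\<D>. measure lborel k *\<^sub>R D x) - (g b - g a)) < e)"
  proof (intro exI conjI allI impI)
    show "gauge (\<lambda>x. ball x (r x))" using r(1) by (intro gauge_ball_dependent) blast
    fix p assume "p tagged_division_of {a..b} \<and> (\<lambda>x. ball x (r x)) fine p"
    then have p: "p tagged_division_of {a..b}" and fine: "\<And>x K. (x, K) \<in> p \<Longrightarrow> K \<subseteq> ball x (r x)"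
      by (auto simp: fine_def)
    have fin: "finite p" using p by (rule tagged_division_of_finite)
    note div = division_real_D[OF division_of_tagged_division[OF p]]
    have K: "K = {Inf K..Sup K}" "Inf K \<le> Sup K" "measure lborel K = Sup K - Inf K" "x \<in> K" "K \<subseteq> {a..b}"
      if "(x, K) \<in> p" for x K
    proof -
      have "K \<in> snd ` p" using that by force
      from div(1-4)[OF this] tagged_division_ofD(2)[OF p that]
      show "K = {Inf K..Sup K}" "Inf K \<le> Sup K" "measure lborel K = Sup K - Inf K" "x \<in> K" "K \<subseteq> {a..b}" by blast+
    qed
    let ?d = "\<lambda>K. g (Sup K) - g (Inf K)"
    \<comment> \<open>For a tag in \<open>N\<close> the Riemann sum contributes nothing and there is
      no derivative to compare with. These intervals lie in \<open>T\<close>, whose measure is below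
      \<delta>, so absolute continuity bounds the increments of \<open>g\<close> over them.\<close>
    define pN where "pN = {z \<in> p. fst z \<in> N}"
    have subp: "pN \<subseteq> p" by (auto simp: pN_def)
    have "(\<Sum>(x, K)\<in>p. measure lborel K *\<^sub>R D x) - (g b - g a) = (\<Sum>(x, K)\<in>p. measure lborel K *\<^sub>R D x - ?d K)"
      using additive_tagged_division_1[OF ab p, of g] by (simp add: sum_subtractf case_prod_beta)
    also have "\<dots> = (\<Sum>(x, K)\<in>p - pN. measure lborel K *\<^sub>R D x - ?d K) + (\<Sum>(x, K)\<in>pN. measure lborel K *\<^sub>R D x - ?d K)"
      by (rule sum.subset_diff[OF subp fin])
    finally have eq: "(\<Sum>(x, K)\<in>p. measure lborel K *\<^sub>R D x) - (g b - g a) = \<dots>" .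
    have "\<bar>\<Sum>(x, K)\<in>p - pN. measure lborel K *\<^sub>R D x - ?d K\<bar> \<le> (\<Sum>(x, K)\<in>p - pN. e' * measure lborel K)"
    proof (rule order_trans[OF sum_abs sum_mono])
      fix z assume z: "z \<in> p - pN"
      obtain x K where xK: "z = (x, K)" by (cases z)
      then have zp: "(x, K) \<in> p" "x \<notin> N" using z by (auto simp: pN_def)
      note k = K[OF zp(1)]
      have xab: "x \<in> {a..b} - N" using k(4,5) zp(2) by blast
      have sub: "{Inf K..Sup K} \<subseteq> ball x (r x)" using fine[OF zp(1)] k(1) by simp
      have xK': "Inf K \<le> x" "x \<le> Sup K" using k(1,4) by auto
      have "Inf K \<in> ball x (r x)" "Sup K \<in> ball x (r x)" using sub k(2) by auto
      then have "\<bar>Inf K - x\<bar> < r x" "\<bar>Sup K - x\<bar> < r x" by (auto simp: dist_real_def abs_minus_commute)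
      then have "\<bar>g (Inf K) - g x - (Inf K - x) * D x\<bar> \<le> e' * (x - Inf K)"
        "\<bar>g (Sup K) - g x - (Sup K - x) * D x\<bar> \<le> e' * (Sup K - x)"
        using r(3)[OF xab, of "Inf K"] r(3)[OF xab, of "Sup K"] xK' by simp_all
      moreover have "measure lborel K *\<^sub>R D x - ?d K =
          (g (Inf K) - g x - (Inf K - x) * D x) - (g (Sup K) - g x - (Sup K - x) * D x)"
        unfolding k(3) by (simp add: algebra_simps)
      moreover have "e' * measure lborel K = e' * (x - Inf K) + e' * (Sup K - x)"
        unfolding k(3) by (simp add: algebra_simps)
      ultimately have "\<bar>measure lborel K *\<^sub>R D x - ?d K\<bar> \<le> e' * measure lborel K" by linarith
      then show "\<bar>case z of (x, K) \<Rightarrow> measure lborel K *\<^sub>R D x - ?d K\<bar> \<le> (case z of (x, K) \<Rightarrow> e' * measure lborel K)"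
        by (simp add: xK)
    qed
    also have "\<dots> \<le> (\<Sum>(x, K)\<in>p. e' * measure lborel K)"
      using fin e' by (intro sum_mono2) auto
    also have "\<dots> = e' * (b - a)"
      using additive_content_tagged_division[of p a b] p ab by (simp add: case_prod_beta sum_distrib_left[symmetric])
    finally have A: "\<bar>\<Sum>(x, K)\<in>p - pN. measure lborel K *\<^sub>R D x - ?d K\<bar> < e / 2" using e'2 by simp
    have tp: "p tagged_partial_division_of {a..b}" using p by (simp add: tagged_division_of_def)
    note tpN = tagged_partial_division_subset[OF tp subp]
    note dN = partial_division_of_tagged_division[OF tpN]
    \<comment> \<open>Passing from tagged pairs to intervals requires a summand that vanishes on
      every box with empty interior, the empty one included, where \<open>Sup\<close> and
      \<open>Inf\<close> carry no information.\<close>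
    let ?d' = "\<lambda>K. if K = {} then 0 else norm (?d K)"
    have ne: "K \<noteq> {}" if "(x, K) \<in> pN" for x K using K(4)[of x K] that subp by auto
    have "(\<Sum>(x, K)\<in>pN. norm (?d K)) = (\<Sum>(x, K)\<in>pN. ?d' K)"
      using ne by (intro sum.cong) auto
    also have "\<dots> = (\<Sum>K\<in>snd ` pN. ?d' K)"
    proof (rule sum.over_tagged_division_lemma[OF tagged_partial_division_of_Union_self[OF tpN]])
      fix u v :: real assume "box u v = {}"
      then have "cbox u v = {} \<or> u = v" by auto
      then show "?d' (cbox u v) = 0" by auto
    qed
    also have "\<dots> = (\<Sum>K\<in>snd ` pN. norm (?d K))"
      using ne by (intro sum.cong) auto
    also have "\<dots> < e / 2"
    proof (rule AC[OF dN])
      show "\<Union>(snd ` pN) \<subseteq> {a..b}" using K(5) subp by fastforce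
      have "(\<Sum>K\<in>snd ` pN. Sup K - Inf K) = measure lebesgue (\<Union>(snd ` pN))"
        using measure_division_real(1)[OF dN] by simp
      also have "\<dots> \<le> measure lebesgue T"
      proof (rule measure_mono_fmeasurable[OF _ _ TM])
        show "\<Union>(snd ` pN) \<subseteq> T" using fine r(2) by (fastforce simp: pN_def)
        show "\<Union>(snd ` pN) \<in> sets lebesgue" using measure_division_real(2)[OF dN] by auto
      qed
      finally show "(\<Sum>K\<in>snd ` pN. Sup K - Inf K) < \<delta>" using Tm by simp
    qed
    finally have B1: "(\<Sum>(x, K)\<in>pN. norm (?d K)) < e / 2" .
    have "\<bar>\<Sum>(x, K)\<in>pN. measure lborel K *\<^sub>R D x - ?d K\<bar> \<le> (\<Sum>(x, K)\<in>pN. norm (?d K))"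
      by (rule order_trans[OF sum_abs sum_mono]) (auto simp: pN_def D0)
    with A B1 eq show "norm ((\<Sum>(x, K)\<in>p. measure lborel K *\<^sub>R D x) - (g b - g a)) < e"
      unfolding real_norm_def by linarith
  qed
qed

text \<open>No measurability of \<open>F\<close> is needed: for such functions \<open>nn_integral\<close> is the lower integral.\<close>

theorem absolutely_continuous_curve_increment_le:
  fixes g :: "real \<Rightarrow> real" and F :: "real \<Rightarrow> ennreal"
  assumes ac: "absolutely_continuous_curve a b g" and ab: "a \<le> b" and N: "negligible N"
    and F: "\<And>x d. x \<in> {a<..<b} \<Longrightarrow> x \<notin> N \<Longrightarrow> (g has_vector_derivative d) (at x) \<Longrightarrow> ennreal d \<le> F x"
  shows "ennreal (g b - g a) \<le> (\<integral>\<^sup>+x\<in>{a..b}. F x \<partial>lborel)"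
proof -
  define M where "M = {a, b} \<union> {x \<in> {a<..<b}. \<not> g differentiable (at x)}"
  have M: "negligible M" "M \<subseteq> {a..b}"
    using absolutely_continuous_curve_differentiable_real[OF ac] ab by (auto simp: M_def)
  define D where "D x = (if x \<in> M then 0 else vector_derivative g (at x))" for x
  have Dd: "(g has_vector_derivative D x) (at x)" if "x \<in> {a..b} - M" for x
  proof -
    have "x \<notin> M" "x \<noteq> a" "x \<noteq> b" "a \<le> x" "x \<le> b" using that by (auto simp: M_def)
    then have "g differentiable (at x)" by (auto simp: M_def)
    then show ?thesis using \<open>x \<notin> M\<close> by (simp add: D_def vector_derivative_works)
  qed
  have int: "(D has_integral (g b - g a)) {a..b}"
    by (rule absolutely_continuous_curve_has_integral[OF ac ab M Dd]) (auto simp: D_def)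
  \<comment> \<open>The positive part of the derivative, since \<open>ennreal\<close> cuts off
    negative values as well; its integral still dominates the increment.\<close>
  let ?D = "\<lambda>x. indicator {a..b} x * max 0 (D x)"
  have "(\<lambda>x. indicator {a..b} x *\<^sub>R D x) \<in> borel_measurable lebesgue"
    using int by (rule has_integral_implies_lebesgue_measurable)
  then have "(\<lambda>x. max 0 (indicator {a..b} x *\<^sub>R D x)) \<in> borel_measurable lebesgue" by measurable
  moreover have "(\<lambda>x. max 0 (indicator {a..b} x *\<^sub>R D x)) = ?D" by (auto simp: indicator_def)
  ultimately have meas: "?D \<in> borel_measurable lebesgue" by simp
  have le: "(\<integral>\<^sup>+x. ennreal (?D x) \<partial>lebesgue) \<le> (\<integral>\<^sup>+x\<in>{a..b}. F x \<partial>lebesgue)"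
  proof (rule nn_integral_mono_AE)
    have "M \<union> N \<in> null_sets lebesgue" using M N by (simp add: negligible_iff_null_sets[symmetric])
    from AE_not_in[OF this] show "AE x in lebesgue. ennreal (?D x) \<le> F x * indicator {a..b} x"
    proof (rule AE_mp, intro AE_I2 impI)
      fix x assume x: "x \<notin> M \<union> N"
      show "ennreal (?D x) \<le> F x * indicator {a..b} x"
      proof (cases "x \<in> {a..b}")
        case True
        then have "x \<noteq> a" "x \<noteq> b" using x by (auto simp: M_def)
        then have "ennreal (D x) \<le> F x" using F[OF _ _ Dd] x True by auto
        then show ?thesis using True by (simp add: max_def ennreal_neg)
      qed simp
    qed
  qed
  show ?thesis
  proof (cases "(\<integral>\<^sup>+x\<in>{a..b}. F x \<partial>lebesgue) = \<infinity>")
    case True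
    then show ?thesis by (simp add: nn_integral_completion)
  next
    case False
    have fin: "(\<integral>\<^sup>+x. ennreal (?D x) \<partial>lebesgue) < \<infinity>" using le False by (simp add: less_top order_le_less_trans)
    have nn: "AE x in lebesgue. 0 \<le> ?D x" by simp
    have i: "integrable lebesgue ?D" using meas fin nn by (intro integrableI_nonneg)
    have i1: "(?D has_integral (integral\<^sup>L lebesgue ?D)) UNIV" using i by (rule has_integral_integral_lebesgue)
    have i2: "((\<lambda>x. if x \<in> {a..b} then D x else 0) has_integral (g b - g a)) UNIV"
      using int has_integral_restrict_UNIV[of "{a..b}" D] by simp
    have "g b - g a \<le> integral\<^sup>L lebesgue ?D"
      by (rule has_integral_le[OF i2 i1]) (simp add: indicator_def)
    then have "ennreal (g b - g a) \<le> ennreal (integral\<^sup>L lebesgue ?D)" by (rule ennreal_leI)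
    also have "\<dots> = (\<integral>\<^sup>+x. ennreal (?D x) \<partial>lebesgue)" using nn_integral_eq_integral[OF i nn] by simp
    also have "\<dots> \<le> (\<integral>\<^sup>+x\<in>{a..b}. F x \<partial>lebesgue)" by (rule le)
    finally show ?thesis by (simp add: nn_integral_completion)
  qed
qed

section \<open>Lower integrals of functions not assumed measurable\<close>

lemma nn_integral_leI:
  assumes "\<And>g. g \<in> borel_measurable M \<Longrightarrow> (\<And>x. g x \<le> F x) \<Longrightarrow> (\<integral>\<^sup>+x. g x \<partial>M) \<le> B"
  shows "(\<integral>\<^sup>+x. F x \<partial>M) \<le> B"
  unfolding nn_integral_def
proof (rule SUP_least)
  fix s assume "s \<in> {g. simple_function M g \<and> g \<le> F}"
  then have s: "simple_function M s" "\<And>x. s x \<le> F x" by (auto simp: le_fun_def)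
  then have "(\<integral>\<^sup>+x. s x \<partial>M) \<le> B" using assms borel_measurable_simple_function by blast
  then show "integral\<^sup>S M s \<le> B" using nn_integral_eq_simple_integral[OF s(1)] by simp
qed

text \<open>A measurable minorant on the union splits along the measurable sets \<open>A\<close> and
  \<open>B\<close>, so \<open>F\<close> itself may be arbitrary.\<close>

lemma nn_integral_subadditive:
  assumes A: "A \<in> sets M" "B \<in> sets M"
  shows "(\<integral>\<^sup>+x\<in>A \<union> B. F x \<partial>M) \<le> (\<integral>\<^sup>+x\<in>A. F x \<partial>M) + (\<integral>\<^sup>+x\<in>B. F x \<partial>M)"
proof (rule nn_integral_leI)
  fix g assume g: "g \<in> borel_measurable M" "\<And>x. g x \<le> F x * indicator (A \<union> B) x"
  have "(\<integral>\<^sup>+x. g x \<partial>M) \<le> (\<integral>\<^sup>+x. g x * indicator A x + g x * indicator B x \<partial>M)"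
  proof (rule nn_integral_mono)
    fix x show "g x \<le> g x * indicator A x + g x * indicator B x"
      using g(2)[of x] by (auto simp: indicator_def split: if_splits)
  qed
  also have "\<dots> = (\<integral>\<^sup>+x. g x * indicator A x \<partial>M) + (\<integral>\<^sup>+x. g x * indicator B x \<partial>M)"
    using g(1) A by (intro nn_integral_add) auto
  also have "\<dots> \<le> (\<integral>\<^sup>+x\<in>A. F x \<partial>M) + (\<integral>\<^sup>+x\<in>B. F x \<partial>M)"
  proof (intro add_mono nn_integral_mono)
    fix x
    show "g x * indicator A x \<le> F x * indicator A x" "g x * indicator B x \<le> F x * indicator B x"
      using g(2)[of x] by (auto simp: indicator_def split: if_splits)
  qed
  finally show "(\<integral>\<^sup>+x. g x \<partial>M) \<le> \<dots>" .
qed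

text \<open>Sums of minorants are minorants of the sum, so the supremum over minorants is
  superadditive. With \<open>nn_integral_subadditive\<close> this makes the action additive in the
  time interval.\<close>

lemma nn_integral_add_le:
  assumes "\<And>x. F x + G x \<le> H x"
  shows "(\<integral>\<^sup>+x. F x \<partial>M) + (\<integral>\<^sup>+x. G x \<partial>M) \<le> (\<integral>\<^sup>+x. H x \<partial>M)"
proof -
  have 1: "(\<integral>\<^sup>+x. F x \<partial>M) + c \<le> B" if "\<And>f. simple_function M f \<Longrightarrow> f \<le> F \<Longrightarrow> integral\<^sup>S M f + c \<le> B" for F c B
  proof -
    have "(\<integral>\<^sup>+x. F x \<partial>M) + c = (SUP f\<in>{g. simple_function M g \<and> g \<le> F}. integral\<^sup>S M f + c)"
      unfolding nn_integral_def
      by (rule ennreal_SUP_add_left[symmetric]) (auto intro!: exI[of _ "\<lambda>_. 0"] simp: le_fun_def)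
    also have "\<dots> \<le> B" using that by (intro SUP_least) auto
    finally show ?thesis .
  qed
  show ?thesis
  proof (rule 1)
    fix f assume f: "simple_function M f" "f \<le> F"
    have "(\<integral>\<^sup>+x. G x \<partial>M) + integral\<^sup>S M f \<le> (\<integral>\<^sup>+x. H x \<partial>M)"
    proof (rule 1)
      fix g assume g: "simple_function M g" "g \<le> G"
      have "integral\<^sup>S M g + integral\<^sup>S M f = (\<integral>\<^sup>+x. g x + f x \<partial>M)"
        using f g by (simp add: nn_integral_add nn_integral_eq_simple_integral borel_measurable_simple_function)
      also have "\<dots> \<le> (\<integral>\<^sup>+x. H x \<partial>M)"
        using f(2) g(2) assms by (intro nn_integral_mono) (metis add.commute add_mono le_fun_def order_trans)
      finally show "integral\<^sup>S M g + integral\<^sup>S M f \<le> (\<integral>\<^sup>+x. H x \<partial>M)" .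
    qed
    then show "integral\<^sup>S M f + (\<integral>\<^sup>+x. G x \<partial>M) \<le> (\<integral>\<^sup>+x. H x \<partial>M)" by (simp add: add.commute)
  qed
qed

text \<open>The substitution is carried out on measurable minorants. The comparison is assumed
  almost everywhere for \<open>lebesgue\<close> because the exceptional sets of curves are only
  known to be negligible; completing the measure does not change \<open>nn_integral\<close>.\<close>

lemma nn_integral_affine_le:
  fixes F G :: "real \<Rightarrow> ennreal" and \<sigma> t :: real
  assumes s: "\<bar>\<sigma>\<bar> = 1" and le: "AE x in lebesgue. F x \<le> G (t + \<sigma> * x)"
  shows "(\<integral>\<^sup>+x. F x \<partial>lborel) \<le> (\<integral>\<^sup>+x. G x \<partial>lborel)"
proof -
  have ss: "\<sigma> * \<sigma> = 1" using s by (metis abs_mult_self_eq mult_1)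
  have "(\<integral>\<^sup>+x. F x \<partial>lborel) = (\<integral>\<^sup>+x. F x \<partial>lebesgue)" by (simp add: nn_integral_completion)
  also have "\<dots> \<le> (\<integral>\<^sup>+x. G (t + \<sigma> * x) \<partial>lebesgue)" by (rule nn_integral_mono_AE[OF le])
  also have "\<dots> = (\<integral>\<^sup>+x. G (t + \<sigma> * x) \<partial>lborel)" by (simp add: nn_integral_completion)
  also have "\<dots> \<le> (\<integral>\<^sup>+x. G x \<partial>lborel)"
  proof (rule nn_integral_leI)
    fix g assume g: "g \<in> borel_measurable lborel" "\<And>x. g x \<le> G (t + \<sigma> * x)"
    have "(\<integral>\<^sup>+x. g x \<partial>lborel) = ennreal \<bar>\<sigma>\<bar> * (\<integral>\<^sup>+x. g (- \<sigma> * t + \<sigma> * x) \<partial>lborel)"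
      using g(1) s by (intro nn_integral_real_affine) auto
    also have "\<dots> \<le> (\<integral>\<^sup>+x. G x \<partial>lborel)"
      unfolding s ennreal_1 mult_1
    proof (rule nn_integral_mono)
      fix x
      have "t + \<sigma> * (- \<sigma> * t + \<sigma> * x) = t - (\<sigma> * \<sigma>) * t + (\<sigma> * \<sigma>) * x" by (simp add: algebra_simps)
      then have "t + \<sigma> * (- \<sigma> * t + \<sigma> * x) = x" unfolding ss by simp
      then show "g (- \<sigma> * t + \<sigma> * x) \<le> G x" using g(2)[of "- \<sigma> * t + \<sigma> * x"] by simp
    qed
    finally show "(\<integral>\<^sup>+x. g x \<partial>lborel) \<le> (\<integral>\<^sup>+x. G x \<partial>lborel)" .
  qed
  finally show ?thesis .
qed

section \<open>Action and Jacobi--Maupertuis distance\<close>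

text \<open>The two cases are a time shift, needed to concatenate curves, and a time reversal,
  needed for the symmetry of the distance.\<close>

lemma absolutely_continuous_curve_affine:
  fixes c :: "real \<Rightarrow> 'v::real_normed_vector"
  assumes ac: "absolutely_continuous_curve a b c"
    and s: "(\<sigma> = 1 \<and> a' = a - \<tau> \<and> b' = b - \<tau>) \<or> (\<sigma> = -1 \<and> a' = \<tau> - b \<and> b' = \<tau> - a)"
  shows "absolutely_continuous_curve a' b' (\<lambda>t. c (\<tau> + \<sigma> * t))"
proof (rule absolutely_continuous_curveI)
  fix \<epsilon> :: real assume e: "\<epsilon> > 0"
  show "\<exists>\<delta>>0. \<forall>(n::nat) p q.
       (\<forall>k<n. a' \<le> p k \<and> p k \<le> q k \<and> q k \<le> b') \<longrightarrow>
       disjoint_family_on (\<lambda>k. {p k<..<q k}) {..<n} \<longrightarrow>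
       (\<Sum>k<n. q k - p k) < \<delta> \<longrightarrow>
       (\<Sum>k<n. norm (c (\<tau> + \<sigma> * q k) - c (\<tau> + \<sigma> * p k))) < \<epsilon>"
  proof (rule absolutely_continuous_curveE[OF ac e], intro exI conjI allI impI)
    fix \<delta> :: real and n :: nat and p q :: "nat \<Rightarrow> real"
    assume *: "\<And>(n::nat) p q. (\<And>k. k < n \<Longrightarrow> a \<le> p k \<and> p k \<le> q k \<and> q k \<le> b) \<Longrightarrow>
       disjoint_family_on (\<lambda>k. {p k<..<q k}) {..<n} \<Longrightarrow>
       (\<Sum>k<n. q k - p k) < \<delta> \<Longrightarrow>
       (\<Sum>k<n. norm (c (q k) - c (p k))) < \<epsilon>"
      and pq: "\<forall>k<n. a' \<le> p k \<and> p k \<le> q k \<and> q k \<le> b'"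
      and dis: "disjoint_family_on (\<lambda>k. {p k<..<q k}) {..<n}" and len: "(\<Sum>k<n. q k - p k) < \<delta>"
    show "(\<Sum>k<n. norm (c (\<tau> + \<sigma> * q k) - c (\<tau> + \<sigma> * p k))) < \<epsilon>"
    proof (cases "\<sigma> = 1")
      case True
      have "(\<Sum>k<n. norm (c (\<tau> + q k) - c (\<tau> + p k))) < \<epsilon>"
      proof (rule *)
        show "a \<le> \<tau> + p k \<and> \<tau> + p k \<le> \<tau> + q k \<and> \<tau> + q k \<le> b" if "k < n" for k
          using pq[rule_format, OF that] s True by auto
        show "disjoint_family_on (\<lambda>k. {\<tau> + p k<..<\<tau> + q k}) {..<n}"
          unfolding disjoint_family_on_def
        proof (intro ballI impI)
          fix i j assume ij: "i \<in> {..<n}" "j \<in> {..<n}" "i \<noteq> j"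
          have "x - \<tau> \<in> {p i<..<q i} \<inter> {p j<..<q j}" if "x \<in> {\<tau> + p i<..<\<tau> + q i} \<inter> {\<tau> + p j<..<\<tau> + q j}" for x
            using that by auto
          then show "{\<tau> + p i<..<\<tau> + q i} \<inter> {\<tau> + p j<..<\<tau> + q j} = {}"
            using disjoint_family_onD[OF dis ij] by blast
        qed
      qed (use len in simp)
      then show ?thesis using True by simp
    next
      case False
      then have s': "\<sigma> = -1" "a' = \<tau> - b" "b' = \<tau> - a" using s by auto
      have "(\<Sum>k<n. norm (c (\<tau> - p k) - c (\<tau> - q k))) < \<epsilon>"
      proof (rule *)
        show "a \<le> \<tau> - q k \<and> \<tau> - q k \<le> \<tau> - p k \<and> \<tau> - p k \<le> b" if "k < n" for k
          using pq[rule_format, OF that] s' by auto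
        show "disjoint_family_on (\<lambda>k. {\<tau> - q k<..<\<tau> - p k}) {..<n}"
          unfolding disjoint_family_on_def
        proof (intro ballI impI)
          fix i j assume ij: "i \<in> {..<n}" "j \<in> {..<n}" "i \<noteq> j"
          have "\<tau> - x \<in> {p i<..<q i} \<inter> {p j<..<q j}" if "x \<in> {\<tau> - q i<..<\<tau> - p i} \<inter> {\<tau> - q j<..<\<tau> - p j}" for x
            using that by auto
          then show "{\<tau> - q i<..<\<tau> - p i} \<inter> {\<tau> - q j<..<\<tau> - p j} = {}"
            using disjoint_family_onD[OF dis ij] by blast
        qed
      qed (use len in simp)
      then show ?thesis using s' by (simp add: norm_minus_commute)
    qed
  qed
qed

text \<open>Truncating every interval at \<open>m\<close> by \<open>min\<close> and
  \<open>max\<close> gives one system on each side of \<open>m\<close>; each increment is the sum of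
  its two truncated parts.\<close>

lemma absolutely_continuous_curve_join:
  fixes c :: "real \<Rightarrow> 'v::real_normed_vector"
  assumes ac1: "absolutely_continuous_curve a m c" and ac2: "absolutely_continuous_curve m b c"
    and ab: "a \<le> m" "m \<le> b"
  shows "absolutely_continuous_curve a b c"
proof (rule absolutely_continuous_curveI)
  fix \<epsilon> :: real assume e: "\<epsilon> > 0"
  then have e2: "\<epsilon> / 2 > 0" by simp
  show "\<exists>\<delta>>0. \<forall>(n::nat) p q.
       (\<forall>k<n. a \<le> p k \<and> p k \<le> q k \<and> q k \<le> b) \<longrightarrow>
       disjoint_family_on (\<lambda>k. {p k<..<q k}) {..<n} \<longrightarrow>
       (\<Sum>k<n. q k - p k) < \<delta> \<longrightarrow>
       (\<Sum>k<n. norm (c (q k) - c (p k))) < \<epsilon>"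
  proof (rule absolutely_continuous_curveE[OF ac1 e2], rule absolutely_continuous_curveE[OF ac2 e2])
    fix \<delta>1 \<delta>2 :: real
    assume d: "\<delta>1 > 0" "\<delta>2 > 0"
      and 1: "\<And>(n::nat) p q. (\<And>k. k < n \<Longrightarrow> a \<le> p k \<and> p k \<le> q k \<and> q k \<le> m) \<Longrightarrow>
       disjoint_family_on (\<lambda>k. {p k<..<q k}) {..<n} \<Longrightarrow>
       (\<Sum>k<n. q k - p k) < \<delta>1 \<Longrightarrow>
       (\<Sum>k<n. norm (c (q k) - c (p k))) < \<epsilon> / 2"
      and 2: "\<And>(n::nat) p q. (\<And>k. k < n \<Longrightarrow> m \<le> p k \<and> p k \<le> q k \<and> q k \<le> b) \<Longrightarrow>
       disjoint_family_on (\<lambda>k. {p k<..<q k}) {..<n} \<Longrightarrow>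
       (\<Sum>k<n. q k - p k) < \<delta>2 \<Longrightarrow>
       (\<Sum>k<n. norm (c (q k) - c (p k))) < \<epsilon> / 2"
    show ?thesis
    proof (intro exI[of _ "min \<delta>1 \<delta>2"] conjI allI impI)
      fix n :: nat and p q :: "nat \<Rightarrow> real"
      assume pq: "\<forall>k<n. a \<le> p k \<and> p k \<le> q k \<and> q k \<le> b"
        and dis: "disjoint_family_on (\<lambda>k. {p k<..<q k}) {..<n}" and len: "(\<Sum>k<n. q k - p k) < min \<delta>1 \<delta>2"
      have A: "(\<Sum>k<n. norm (c (min m (q k)) - c (min m (p k)))) < \<epsilon> / 2"
      proof (rule 1)
        show "a \<le> min m (p k) \<and> min m (p k) \<le> min m (q k) \<and> min m (q k) \<le> m" if "k < n" for k
          using pq[rule_format, OF that] ab by auto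
        show "disjoint_family_on (\<lambda>k. {min m (p k)<..<min m (q k)}) {..<n}"
          using dis unfolding disjoint_family_on_def by fastforce
        have "(\<Sum>k<n. min m (q k) - min m (p k)) \<le> (\<Sum>k<n. q k - p k)"
          using pq by (intro sum_mono) (auto simp: min_def)
        then show "(\<Sum>k<n. min m (q k) - min m (p k)) < \<delta>1" using len by linarith
      qed
      have B: "(\<Sum>k<n. norm (c (max m (q k)) - c (max m (p k)))) < \<epsilon> / 2"
      proof (rule 2)
        show "m \<le> max m (p k) \<and> max m (p k) \<le> max m (q k) \<and> max m (q k) \<le> b" if "k < n" for k
          using pq[rule_format, OF that] ab by auto
        show "disjoint_family_on (\<lambda>k. {max m (p k)<..<max m (q k)}) {..<n}"
          using dis unfolding disjoint_family_on_def by fastforce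
        have "(\<Sum>k<n. max m (q k) - max m (p k)) \<le> (\<Sum>k<n. q k - p k)"
          using pq by (intro sum_mono) (auto simp: max_def)
        then show "(\<Sum>k<n. max m (q k) - max m (p k)) < \<delta>2" using len by linarith
      qed
      have "(\<Sum>k<n. norm (c (q k) - c (p k))) \<le>
          (\<Sum>k<n. norm (c (min m (q k)) - c (min m (p k))) + norm (c (max m (q k)) - c (max m (p k))))"
      proof (rule sum_mono)
        fix k
        have "c (q k) - c (p k) = (c (min m (q k)) - c (min m (p k))) + (c (max m (q k)) - c (max m (p k)))"
          by (auto simp: min_def max_def)
        then show "norm (c (q k) - c (p k)) \<le> norm (c (min m (q k)) - c (min m (p k))) + norm (c (max m (q k)) - c (max m (p k)))"
          by (metis norm_triangle_ineq)
      qed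
      also have "\<dots> < \<epsilon>" using A B by (simp add: sum.distrib)
      finally show "(\<Sum>k<n. norm (c (q k) - c (p k))) < \<epsilon>" .
    qed (use d in simp)
  qed
qed

lemma absolutely_continuous_curve_cong:
  assumes "absolutely_continuous_curve a b c" "\<And>t. t \<in> {a..b} \<Longrightarrow> c' t = c t"
  shows "absolutely_continuous_curve a b c'"
  by (rule absolutely_continuous_curve_lipschitz_compose[OF assms(1) zero_less_one, where L = 1])
    (simp add: assms(2))

section \<open>Coordinates in which the mass norm is Euclidean\<close>

definition mass_scale :: "('n::finite \<Rightarrow> real) \<Rightarrow> ('e::euclidean_space, 'n) vec \<Rightarrow> ('e, 'n) vec" where
  "mass_scale m x = (\<chi> i. sqrt (m i) *\<^sub>R x $ i)"

lemma linear_mass_scale: "linear (mass_scale m)"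
  by (rule linearI) (simp_all add: mass_scale_def vec_eq_iff scaleR_add_right)

lemma bounded_linear_mass_scale: "bounded_linear (mass_scale m)"
  using linear_mass_scale by (rule linear_conv_bounded_linear[THEN iffD1])

lemmas mass_scale_simps = linear_add[OF linear_mass_scale] linear_diff[OF linear_mass_scale]
  linear_cmul[OF linear_mass_scale] linear_0[OF linear_mass_scale] linear_neg[OF linear_mass_scale]

lemma mass_inner_scale:
  assumes "\<forall>i. 0 < m i"
  shows "mass_inner m x y = mass_scale m x \<bullet> mass_scale m y"
  unfolding mass_inner_def mass_scale_def inner_vec_def
  using assms by (intro sum.cong refl) (simp add: less_imp_le)

lemma mass_norm_scale:
  assumes "\<forall>i. 0 < m i"
  shows "mass_norm m x = norm (mass_scale m x)"
  unfolding mass_norm_def mass_inner_scale[OF assms] norm_eq_sqrt_inner ..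

lemma mass_scale_inverse:
  assumes "\<forall>i. 0 < m i"
  shows "mass_scale (\<lambda>i. inverse (m i)) (mass_scale m x) = x" "mass_scale m (mass_scale (\<lambda>i. inverse (m i)) x) = x"
  using assms by (simp_all add: mass_scale_def vec_eq_iff real_sqrt_inverse less_imp_neq[OF spec[OF assms], symmetric])

lemma potential_real_nonneg:
  assumes "\<forall>i. 0 < m i"
  shows "potential_real m (x :: ('e::euclidean_space, 'n::{finite,linorder}) vec) \<ge> 0"
  unfolding potential_real_def
proof (rule sum_nonneg, clarify)
  fix i j :: 'n assume "i < j"
  have "0 \<le> m i * m j" using assms by (simp add: less_imp_le)
  then show "0 \<le> m i * m j / norm (x $ i - x $ j)" by simp
qed

text \<open>The integrand of \<open>action\<close> with the two-sided derivative, which agrees with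
  the original inside the interval. Being independent of the interval, it allows the action to be
  split at an intermediate time.\<close>

definition lagrangian ::
  "('n::{finite,linorder} \<Rightarrow> real) \<Rightarrow> real \<Rightarrow> (real \<Rightarrow> ('e::euclidean_space, 'n) vec) \<Rightarrow> real \<Rightarrow> ennreal" where
  "lagrangian m h c t =
     ennreal (1/2 * (mass_norm m (vector_derivative c (at t)))\<^sup>2) + potential m (c t) + ennreal h"

section \<open>Splitting, bounding and reparametrizing the action\<close>

lemma AE_lebesgue_notin_finite:
  fixes S :: "real set"
  assumes "finite S"
  shows "AE x in lebesgue. x \<notin> S"
  using assms by (intro AE_not_in) (simp add: negligible_finite negligible_iff_null_sets[symmetric])

lemma action_lagrangian: "action m h s0 s1 c = (\<integral>\<^sup>+t\<in>{s0<..<s1}. lagrangian m h c t \<partial>lborel)"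
proof -
  have "action m h s0 s1 c = (\<integral>\<^sup>+t\<in>{s0..s1}.
       (ennreal (1/2 * (mass_norm m (vector_derivative c (at t within {s0..s1})))\<^sup>2)
        + potential m (c t) + ennreal h) \<partial>lebesgue)"
    unfolding action_def by (simp only: nn_integral_completion)
  also have "\<dots> = (\<integral>\<^sup>+t\<in>{s0<..<s1}. lagrangian m h c t \<partial>lebesgue)"
  proof (rule nn_integral_cong_AE, rule AE_mp[OF AE_lebesgue_notin_finite[of "{s0, s1}"]], simp, intro AE_I2 impI)
    fix t assume "t \<notin> {s0, s1}"
    then show "(ennreal (1/2 * (mass_norm m (vector_derivative c (at t within {s0..s1})))\<^sup>2)
        + potential m (c t) + ennreal h) * indicator {s0..s1} t = lagrangian m h c t * indicator {s0<..<s1} t"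
      by (cases "t \<in> {s0<..<s1}") (auto simp: lagrangian_def at_within_Icc_at indicator_def)
  qed
  also have "\<dots> = (\<integral>\<^sup>+t\<in>{s0<..<s1}. lagrangian m h c t \<partial>lborel)" by (simp only: nn_integral_completion)
  finally show ?thesis .
qed

text \<open>For a general \<open>c\<close> nothing is known about measurability of the integrand;
  one inequality is subadditivity and the other superadditivity of the lower integral.\<close>

lemma action_split:
  assumes s: "s0 \<le> s1" "s1 \<le> s2"
  shows "action m h s0 s2 c = action m h s0 s1 c + action m h s1 s2 c"
proof (rule antisym)
  let ?F = "lagrangian m h c"
  have "action m h s0 s2 c = (\<integral>\<^sup>+t\<in>{s0<..<s2}. ?F t \<partial>lebesgue)" 
    by (simp only: action_lagrangian nn_integral_completion)
  also have "\<dots> = (\<integral>\<^sup>+t\<in>{s0<..<s1} \<union> {s1<..<s2}. ?F t \<partial>lebesgue)"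
  proof (rule nn_integral_cong_AE, rule AE_mp[OF AE_lebesgue_notin_finite[of "{s1}"]], simp, intro AE_I2 impI)
    fix t assume "t \<notin> {s1}"
    then show "?F t * indicator {s0<..<s2} t = ?F t * indicator ({s0<..<s1} \<union> {s1<..<s2}) t"
      using s by (auto simp: indicator_def)
  qed
  also have "\<dots> \<le> (\<integral>\<^sup>+t\<in>{s0<..<s1}. ?F t \<partial>lebesgue) + (\<integral>\<^sup>+t\<in>{s1<..<s2}. ?F t \<partial>lebesgue)"
    by (rule nn_integral_subadditive) auto
  also have "\<dots> = action m h s0 s1 c + action m h s1 s2 c"
    by (simp only: action_lagrangian nn_integral_completion)
  finally show "action m h s0 s2 c \<le> action m h s0 s1 c + action m h s1 s2 c" .
  show "action m h s0 s1 c + action m h s1 s2 c \<le> action m h s0 s2 c"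
    unfolding action_lagrangian using s by (intro nn_integral_add_le) (auto simp: indicator_def)
qed

text \<open>Here \<open>g\<close> is meant to be a subsolution evaluated along \<open>c\<close>. At
  collisions the potential is infinite, so the differential inequality is asked for only at
  collision-free points.\<close>

lemma action_ge:
  fixes c :: "real \<Rightarrow> ('e::euclidean_space, 'n::{finite,linorder}) vec"
  assumes m: "\<forall>i. 0 < m i" and h: "h \<ge> 0" and s: "s0 \<le> s1"
    and c: "absolutely_continuous_curve s0 s1 c" and g: "absolutely_continuous_curve s0 s1 g"
    and le: "\<And>t v d. t \<in> {s0<..<s1} \<Longrightarrow> (c has_vector_derivative v) (at t) \<Longrightarrow>
      (g has_vector_derivative d) (at t) \<Longrightarrow> c t \<in> collision_free \<Longrightarrow>
      d \<le> 1/2 * (mass_norm m v)\<^sup>2 + potential_real m (c t) + h"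
  shows "ennreal (g s1 - g s0) \<le> action m h s0 s1 c"
  unfolding action_def
proof (rule absolutely_continuous_curve_increment_le[OF g s absolutely_continuous_curve_differentiable[OF c]])
  fix t d assume t: "t \<in> {s0<..<s1}" "t \<notin> {x \<in> {s0<..<s1}. \<not> c differentiable at x}"
    and d: "(g has_vector_derivative d) (at t)"
  define v where "v = vector_derivative c (at t)"
  have v: "(c has_vector_derivative v) (at t)" using t unfolding v_def by (simp add: vector_derivative_works)
  have w: "vector_derivative c (at t within {s0..s1}) = v"
    using t(1) by (simp add: at_within_Icc_at v_def)
  show "ennreal d \<le> ennreal (1/2 * (mass_norm m (vector_derivative c (at t within {s0..s1})))\<^sup>2)
        + potential m (c t) + ennreal h"
  proof (cases "c t \<in> collision_free")
    case True
    have "ennreal (1/2 * (mass_norm m v)\<^sup>2) + potential m (c t) + ennreal h =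
        ennreal (1/2 * (mass_norm m v)\<^sup>2 + potential_real m (c t) + h)"
      using True h potential_real_nonneg[OF m, of "c t"] by (simp add: potential_def ennreal_plus)
    then show ?thesis unfolding w using le[OF t(1) v d True] by (simp add: ennreal_leI)
  qed (simp add: potential_def)
qed

text \<open>\<open>Q\<close> is differentiated only inside the interval and is merely continuous up
  to its ends, so that curves starting at a collision with unbounded Lagrangian are covered.\<close>

lemma action_le:
  fixes c :: "real \<Rightarrow> ('e::euclidean_space, 'n::{finite,linorder}) vec"
  assumes m: "\<forall>i. 0 < m i" and h: "h \<ge> 0" and s: "s0 \<le> s1"
    and c: "\<And>t. t \<in> {s0<..<s1} \<Longrightarrow> (c has_vector_derivative v t) (at t)"
    and free: "\<And>t. t \<in> {s0<..<s1} \<Longrightarrow> c t \<in> collision_free"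
    and Q: "continuous_on {s0..s1} Q" "\<And>t. t \<in> {s0<..<s1} \<Longrightarrow> (Q has_vector_derivative Q' t) (at t)"
    and le: "\<And>t. t \<in> {s0<..<s1} \<Longrightarrow> 1/2 * (mass_norm m (v t))\<^sup>2 + potential_real m (c t) + h \<le> Q' t"
  shows "action m h s0 s1 c \<le> ennreal (Q s1 - Q s0)"
proof -
  have Q'0: "0 \<le> Q' t" if "t \<in> {s0<..<s1}" for t
  proof -
    have "0 \<le> 1/2 * (mass_norm m (v t))\<^sup>2" by simp
    then show ?thesis using le[OF that] h potential_real_nonneg[OF m, of "c t"] by linarith
  qed
  have "(Q' has_integral (Q s1 - Q s0)) {s0..s1}"
    by (rule fundamental_theorem_of_calculus_interior[OF s Q])
  then have I: "(Q' has_integral (Q s1 - Q s0)) {s0<..<s1}" by (simp add: has_integral_Icc_iff_Ioo)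
  have "action m h s0 s1 c \<le> (\<integral>\<^sup>+t. ennreal (indicator {s0<..<s1} t * Q' t) \<partial>lborel)"
    unfolding action_lagrangian
  proof (rule nn_integral_mono)
    fix t
    show "lagrangian m h c t * indicator {s0<..<s1} t \<le> ennreal (indicator {s0<..<s1} t * Q' t)"
    proof (cases "t \<in> {s0<..<s1}")
      case True
      have "lagrangian m h c t = ennreal (1/2 * (mass_norm m (v t))\<^sup>2 + potential_real m (c t) + h)"
        using free[OF True] h potential_real_nonneg[OF m, of "c t"]
        by (simp add: lagrangian_def vector_derivative_at[OF c[OF True]] potential_def ennreal_plus)
      then show ?thesis using True ennreal_leI[OF le[OF True]] by simp
    qed simp
  qed
  also have "\<dots> = ennreal (Q s1 - Q s0)"
    using nn_integral_has_integral_lebesgue[OF Q'0 I] by simp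
  finally show ?thesis .
qed

text \<open>Absolute continuity provides derivatives almost everywhere; at other times
  \<open>vector_derivative\<close> is unspecified and the two integrands need not correspond.
  Reversal is harmless because the Lagrangian is even in the velocity.\<close>

lemma action_affine:
  fixes c :: "real \<Rightarrow> ('e::euclidean_space, 'n::{finite,linorder}) vec"
  assumes m: "\<forall>i. 0 < m i" and ac: "absolutely_continuous_curve s0 s1 c"
    and s: "(\<sigma> = 1 \<and> s0' = s0 - \<tau> \<and> s1' = s1 - \<tau>) \<or> (\<sigma> = -1 \<and> s0' = \<tau> - s1 \<and> s1' = \<tau> - s0)"
  shows "action m h s0' s1' (\<lambda>t. c (\<tau> + \<sigma> * t)) \<le> action m h s0 s1 c"
  unfolding action_lagrangian
proof (rule nn_integral_affine_le)
  let ?c = "\<lambda>t. c (\<tau> + \<sigma> * t)"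
  show abs: "\<bar>\<sigma>\<bar> = 1" using s by auto
  have ac': "absolutely_continuous_curve s0' s1' ?c" by (rule absolutely_continuous_curve_affine[OF ac s])
  have "{x \<in> {s0'<..<s1'}. \<not> ?c differentiable at x} \<in> null_sets lebesgue"
    using absolutely_continuous_curve_differentiable[OF ac'] by (simp add: negligible_iff_null_sets)
  from AE_not_in[OF this]
  show "AE t in lebesgue. lagrangian m h ?c t * indicator {s0'<..<s1'} t
     \<le> lagrangian m h c (\<tau> + \<sigma> * t) * indicator {s0<..<s1} (\<tau> + \<sigma> * t)"
  proof (rule AE_mp, intro AE_I2 impI)
    fix t assume t: "t \<notin> {x \<in> {s0'<..<s1'}. \<not> ?c differentiable at x}"
    show "lagrangian m h ?c t * indicator {s0'<..<s1'} t
       \<le> lagrangian m h c (\<tau> + \<sigma> * t) * indicator {s0<..<s1} (\<tau> + \<sigma> * t)"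
    proof (cases "t \<in> {s0'<..<s1'}")
      case True
      define w where "w = vector_derivative ?c (at t)"
      have w: "(?c has_vector_derivative w) (at t)" using t True by (simp add: w_def vector_derivative_works)
      have ss: "\<sigma> * \<sigma> = 1" using s by auto
      have k: "((\<lambda>u. \<sigma> * (u - \<tau>)) has_vector_derivative \<sigma>) (at (\<tau> + \<sigma> * t))"
        by (auto intro!: derivative_eq_intros)
      have "\<sigma> * ((\<tau> + \<sigma> * t) - \<tau>) = t" using ss by (simp add: mult.assoc[symmetric])
      then have "((?c \<circ> (\<lambda>u. \<sigma> * (u - \<tau>))) has_vector_derivative \<sigma> *\<^sub>R w) (at (\<tau> + \<sigma> * t))"
        using vector_diff_chain_at[OF k, of ?c w] w by (simp only:)
      moreover have "?c \<circ> (\<lambda>u. \<sigma> * (u - \<tau>)) = c"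
      proof
        fix u
        have "\<tau> + \<sigma> * (\<sigma> * (u - \<tau>)) = u" using ss by (simp add: mult.assoc[symmetric])
        then show "(?c \<circ> (\<lambda>u. \<sigma> * (u - \<tau>))) u = c u" by simp
      qed
      ultimately have "vector_derivative c (at (\<tau> + \<sigma> * t)) = \<sigma> *\<^sub>R w" by (simp add: vector_derivative_at)
      then have "mass_norm m (vector_derivative c (at (\<tau> + \<sigma> * t))) = mass_norm m w"
        using abs by (simp add: mass_norm_scale[OF m] mass_scale_simps)
      moreover have "\<tau> + \<sigma> * t \<in> {s0<..<s1}" using True s by auto
      ultimately show ?thesis using True by (simp add: lagrangian_def w_def)
    qed simp
  qed
qed

section \<open>The Jacobi-Maupertuis distance as an infimum\<close>

lemma jm_dist_le_action:
  "s0 < s1 \<Longrightarrow> absolutely_continuous_curve s0 s1 c \<Longrightarrow> c s0 = x \<Longrightarrow> c s1 = y \<Longrightarrow>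
    jm_dist m h x y \<le> action m h s0 s1 c"
  unfolding jm_dist_def by (rule Inf_lower) blast

lemma jm_dist_greatest:
  assumes "\<And>s0 s1 c. s0 < s1 \<Longrightarrow> absolutely_continuous_curve s0 s1 c \<Longrightarrow> c s0 = x \<Longrightarrow> c s1 = y \<Longrightarrow>
    B \<le> action m h s0 s1 c"
  shows "B \<le> jm_dist m h x y"
  unfolding jm_dist_def by (rule Inf_greatest) (use assms in blast)

lemma jm_dist_sym:
  assumes m: "\<forall>i. 0 < m i"
  shows "jm_dist m h x y = jm_dist m h y (x :: ('e::euclidean_space, 'n::{finite,linorder}) vec)"
proof -
  have "jm_dist m h x y \<le> jm_dist m h y x" for x y :: "('e, 'n) vec"
  proof (rule jm_dist_greatest)
    fix s0 s1 c assume s: "s0 < s1" "absolutely_continuous_curve s0 s1 c" "c s0 = y" "c s1 = x"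
    have "jm_dist m h x y \<le> action m h (0 - s1) (0 - s0) (\<lambda>t. c (0 + (-1) * t))"
      by (rule jm_dist_le_action[OF _ absolutely_continuous_curve_affine[OF s(2)]]) (use s in auto)
    also have "\<dots> \<le> action m h s0 s1 c" by (rule action_affine[OF m s(2)]) auto
    finally show "jm_dist m h x y \<le> action m h s0 s1 c" .
  qed
  then show ?thesis by (simp add: antisym)
qed

text \<open>The second curve is shifted in time so as to start when the first one ends, and the two
  are concatenated.\<close>

lemma jm_dist_triangle:
  assumes m: "\<forall>i. 0 < m i"
  shows "jm_dist m h x z \<le> jm_dist m h x y + jm_dist m h y z"
proof -
  have 1: "jm_dist m h x z \<le> action m h s0 s1 c + action m h r0 r1 d"
    if c: "s0 < s1" "absolutely_continuous_curve s0 s1 c" "c s0 = x" "c s1 = y"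
      and d: "r0 < r1" "absolutely_continuous_curve r0 r1 d" "d r0 = y" "d r1 = z" for s0 s1 r0 r1 c d
  proof -
    let ?d = "\<lambda>t. d ((r0 - s1) + 1 * t)"
    define s2 where "s2 = r1 - (r0 - s1)"
    define e where "e t = (if t \<le> s1 then c t else ?d t)" for t
    have s12: "s1 < s2" using d(1) by (simp add: s2_def)
    have acd: "absolutely_continuous_curve s1 s2 ?d"
      by (rule absolutely_continuous_curve_affine[OF d(2)]) (simp add: s2_def)
    have e: "absolutely_continuous_curve s0 s1 e" "absolutely_continuous_curve s1 s2 e"
      by (rule absolutely_continuous_curve_cong[OF c(2)], simp add: e_def)
        (rule absolutely_continuous_curve_cong[OF acd], use c d in \<open>auto simp: e_def\<close>)
    have "jm_dist m h x z \<le> action m h s0 s2 e"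
      by (rule jm_dist_le_action[OF _ absolutely_continuous_curve_join[OF e]])
        (use c d s12 in \<open>auto simp: e_def s2_def\<close>)
    also have "\<dots> = action m h s0 s1 e + action m h s1 s2 e" using c(1) s12 by (intro action_split) auto
    also have "action m h s0 s1 e = action m h s0 s1 c"
      unfolding action_lagrangian
    proof (rule nn_integral_cong)
      fix t
      show "lagrangian m h e t * indicator {s0<..<s1} t = lagrangian m h c t * indicator {s0<..<s1} t"
      proof (cases "t \<in> {s0<..<s1}")
        case True
        have "vector_derivative e (at t) = vector_derivative c (at t)"
        proof (rule vector_derivative_cong_eq)
          show "\<forall>\<^sub>F x in nhds t. x \<in> UNIV \<longrightarrow> e x = c x"
            using True by (intro eventually_nhds[THEN iffD2] exI[of _ "{..<s1}"]) (auto simp: e_def)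
        qed auto
        then show ?thesis using True by (simp add: lagrangian_def e_def)
      qed simp
    qed
    also have "action m h s1 s2 e = action m h s1 s2 ?d"
      unfolding action_lagrangian
    proof (rule nn_integral_cong)
      fix t
      show "lagrangian m h e t * indicator {s1<..<s2} t = lagrangian m h ?d t * indicator {s1<..<s2} t"
      proof (cases "t \<in> {s1<..<s2}")
        case True
        have "vector_derivative e (at t) = vector_derivative ?d (at t)"
        proof (rule vector_derivative_cong_eq)
          show "\<forall>\<^sub>F x in nhds t. x \<in> UNIV \<longrightarrow> e x = ?d x"
            using True by (intro eventually_nhds[THEN iffD2] exI[of _ "{s1<..}"]) (auto simp: e_def)
        qed auto
        then show ?thesis using True by (simp add: lagrangian_def e_def)
      qed simp
    qed
    also have "action m h s1 s2 ?d \<le> action m h r0 r1 d"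
      by (rule action_affine[OF m d(2)]) (simp add: s2_def)
    finally show ?thesis by (simp add: add_left_mono)
  qed
  show ?thesis
  proof (cases "jm_dist m h x y = top \<or> jm_dist m h y z = top")
    case False
    \<comment> \<open>The infimum is taken over one curve at a time; moving the other term across an
      inequality in \<open>ennreal\<close> requires it to be finite.\<close>
    have "jm_dist m h x z - jm_dist m h x y \<le> jm_dist m h y z"
    proof (rule jm_dist_greatest)
      fix r0 r1 d assume d: "r0 < r1" "absolutely_continuous_curve r0 r1 d" "d r0 = y" "d r1 = z"
      show "jm_dist m h x z - jm_dist m h x y \<le> action m h r0 r1 d"
      proof (cases "action m h r0 r1 d = top")
        case fin: False
        have "jm_dist m h x z - action m h r0 r1 d \<le> jm_dist m h x y"
        proof (rule jm_dist_greatest)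
          fix s0 s1 c assume "s0 < s1" "absolutely_continuous_curve s0 s1 c" "c s0 = x" "c s1 = y"
          from 1[OF this d] show "jm_dist m h x z - action m h r0 r1 d \<le> action m h s0 s1 c"
            using fin by (simp add: ennreal_minus_le_iff add.commute)
        qed
        then show ?thesis
          using False fin by (simp add: ennreal_minus_le_iff add.commute)
      qed simp
    qed
    then show ?thesis using False by (simp add: ennreal_minus_le_iff)
  qed auto
qed

section \<open>Calibration near an escaping solution\<close>

text \<open>Differentiability is obtained in this form twice: for the potential from its Taylor
  estimate, and for the Busemann function from an upper and a lower bound that agree to first
  order.\<close>

lemma has_derivative_quadratic_remainder:
  fixes f :: "'v::real_normed_vector \<Rightarrow> real"
  assumes "bounded_linear g" "\<delta> > 0"
    and le: "\<And>\<xi>. norm \<xi> \<le> \<delta> \<Longrightarrow> \<bar>f (x + \<xi>) - f x - g \<xi>\<bar> \<le> C * (norm \<xi>)\<^sup>2"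
  shows "(f has_derivative g) (at x)"
  unfolding has_derivative_at_alt
proof (intro conjI allI impI)
  show "bounded_linear g" by fact
  fix e :: real assume e: "e > 0"
  define d where "d = min \<delta> (e / (\<bar>C\<bar> + 1))"
  have "d > 0" using assms(2) e by (simp add: d_def)
  moreover have "norm (f y - f x - g (y - x)) \<le> e * norm (y - x)" if y: "norm (y - x) < d" for y
  proof -
    have "norm (y - x) \<le> \<delta>" using y by (simp add: d_def)
    from le[OF this] have "norm (f y - f x - g (y - x)) \<le> C * (norm (y - x))\<^sup>2" by simp
    also have "\<dots> \<le> (\<bar>C\<bar> + 1) * (norm (y - x))\<^sup>2" by (intro mult_right_mono) auto
    also have "\<dots> = ((\<bar>C\<bar> + 1) * norm (y - x)) * norm (y - x)" by (simp add: power2_eq_square)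
    also have "\<dots> \<le> e * norm (y - x)"
    proof (rule mult_right_mono)
      have "norm (y - x) \<le> e / (\<bar>C\<bar> + 1)" using y by (simp add: d_def)
      then show "(\<bar>C\<bar> + 1) * norm (y - x) \<le> e" by (simp add: field_simps)
    qed simp
    finally show ?thesis .
  qed
  ultimately show "\<exists>d>0. \<forall>y. norm (y - x) < d \<longrightarrow> norm (f y - f x - g (y - x)) \<le> e * norm (y - x)"
    by blast
qed

text \<open>Decay rates such as \<open>K / s\<^sup>2\<close> and \<open>K / s\<close> are integrated
  by comparison with an explicit antiderivative \<phi>.\<close>

lemma increment_le_of_derivative_le:
  fixes f :: "real \<Rightarrow> 'v::real_normed_vector" and \<phi> :: "real \<Rightarrow> real"
  assumes "s \<le> t"
    and "\<And>u. u \<in> {s..t} \<Longrightarrow> (f has_vector_derivative f' u) (at u)"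
    and "\<And>u. u \<in> {s..t} \<Longrightarrow> (\<phi> has_real_derivative \<phi>' u) (at u)"
    and "\<And>u. u \<in> {s..t} \<Longrightarrow> norm (f' u) \<le> \<phi>' u"
  shows "norm (f t - f s) \<le> \<phi> t - \<phi> s"
proof (cases "s = t")
  case False
  then have "s < t" using assms(1) by simp
  then show ?thesis
  proof (rule differentiable_bound_general)
    show "continuous_on {s..t} f"
      using assms(2) by (meson continuous_at_imp_continuous_on has_vector_derivative_continuous)
    show "continuous_on {s..t} \<phi>"
      using assms(3) by (meson continuous_at_imp_continuous_on DERIV_isCont)
    fix x assume "s < x" "x < t"
    then show "(f has_vector_derivative f' x) (at x)" "(\<phi> has_vector_derivative \<phi>' x) (at x)" "norm (f' x) \<le> \<phi>' x"
      using assms(2-4)[of x] by (auto simp: has_real_derivative_iff_has_vector_derivative)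
  qed
qed simp

lemma increment_le_of_derivative_le_real:
  fixes f \<phi> :: "real \<Rightarrow> real"
  assumes "s \<le> t"
    and "\<And>u. u \<in> {s..t} \<Longrightarrow> (f has_real_derivative f' u) (at u)"
    and "\<And>u. u \<in> {s..t} \<Longrightarrow> (\<phi> has_real_derivative \<phi>' u) (at u)"
    and "\<And>u. u \<in> {s..t} \<Longrightarrow> f' u \<le> \<phi>' u"
  shows "f t - f s \<le> \<phi> t - \<phi> s"
proof -
  have "(\<phi> s - f s) \<le> (\<phi> t - f t)"
  proof (rule DERIV_nonneg_imp_nondecreasing[OF assms(1)])
    fix u assume "s \<le> u" "u \<le> t"
    then have "((\<lambda>u. \<phi> u - f u) has_real_derivative (\<phi>' u - f' u)) (at u)" "0 \<le> \<phi>' u - f' u"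
      using assms(2-4)[of u] by (auto intro!: derivative_eq_intros)
    then show "\<exists>y. ((\<lambda>u. \<phi> u - f u) has_real_derivative y) (at u) \<and> 0 \<le> y" by blast
  qed
  then show ?thesis by simp
qed

lemma has_vector_derivative_gradient_compose:
  fixes c :: "real \<Rightarrow> 'v::real_inner" and S :: "'v \<Rightarrow> real"
  assumes "(c has_vector_derivative v) (at t)" "(S has_derivative (\<lambda>v. N \<bullet> v)) (at (c t))"
  shows "((\<lambda>t. S (c t)) has_vector_derivative (N \<bullet> v)) (at t)"
proof -
  have "((\<lambda>t. S (c t)) has_derivative (\<lambda>h. N \<bullet> (h *\<^sub>R v))) (at t)"
    using has_derivative_compose[OF assms(1)[unfolded has_vector_derivative_def] assms(2)] .
  then show ?thesis by (simp add: has_vector_derivative_def)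
qed

text \<open>\<open>U\<close> is the potential and \<open>G\<close> its gradient, in coordinates in which the mass norm is the
  Euclidean norm; the bounds are those of a function that is homogeneous of degree \<open>-1\<close> in a
  cone around the ray through \<open>a\<close>.\<close>

locale conical_potential =
  fixes U :: "'v::euclidean_space \<Rightarrow> real" and G :: "'v \<Rightarrow> 'v" and a :: 'v and \<epsilon>0 K k :: real
  assumes U_nonneg: "0 \<le> U x"
    and a_nonzero: "a \<noteq> 0" and \<epsilon>0_pos: "\<epsilon>0 > 0" and K_pos: "K > 0" and k_pos: "k > 0"
    and G_le: "\<tau> > 0 \<Longrightarrow> norm (x - \<tau> *\<^sub>R a) \<le> \<epsilon>0 * \<tau> \<Longrightarrow> norm (G x) \<le> K / \<tau>\<^sup>2"
    and U_le: "\<tau> > 0 \<Longrightarrow> norm (x - \<tau> *\<^sub>R a) \<le> \<epsilon>0 * \<tau> \<Longrightarrow> U x \<le> K / \<tau>"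
    and U_ge: "\<tau> > 0 \<Longrightarrow> norm (x - \<tau> *\<^sub>R a) \<le> \<epsilon>0 * \<tau> \<Longrightarrow> k / \<tau> \<le> U x"
    and U_quadratic: "\<tau> > 0 \<Longrightarrow> norm (x - \<tau> *\<^sub>R a) \<le> \<epsilon>0 * \<tau> \<Longrightarrow> norm \<xi> \<le> \<epsilon>0 * \<tau> \<Longrightarrow>
      \<bar>U (x + \<xi>) - U x - G x \<bullet> \<xi>\<bar> \<le> K * (norm \<xi>)\<^sup>2 / \<tau> ^ 3"
begin

lemma U_has_derivative:
  assumes "\<tau> > 0" "norm (x - \<tau> *\<^sub>R a) \<le> \<epsilon>0 * \<tau>"
  shows "(U has_derivative (\<lambda>v. G x \<bullet> v)) (at x)"
proof (rule has_derivative_quadratic_remainder[OF bounded_linear_inner_right, of "\<epsilon>0 * \<tau>" _ _ _ "K / \<tau> ^ 3"])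
  show "\<epsilon>0 * \<tau> > 0" using assms(1) \<epsilon>0_pos by simp
  fix \<xi> :: 'v assume "norm \<xi> \<le> \<epsilon>0 * \<tau>"
  from U_quadratic[OF assms this]
  show "\<bar>U (x + \<xi>) - U x - G x \<bullet> \<xi>\<bar> \<le> K / \<tau> ^ 3 * (norm \<xi>)\<^sup>2" by simp
qed

end

section \<open>Asymptotics of velocity, position and energy\<close>

locale escaping_solution = conical_potential U G a \<epsilon>0 K k
  for U :: "'v::euclidean_space \<Rightarrow> real" and G a \<epsilon>0 K k +
  fixes \<gamma> p :: "real \<Rightarrow> 'v" and T0 :: real
  assumes T0_pos: "T0 > 0"
    and \<gamma>_deriv: "t \<ge> T0 \<Longrightarrow> (\<gamma> has_vector_derivative p t) (at t)"
    and p_deriv: "t \<ge> T0 \<Longrightarrow> (p has_vector_derivative G (\<gamma> t)) (at t)"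
    and asymptotic: "e > 0 \<Longrightarrow> \<forall>\<^sub>F t in at_top. norm (\<gamma> t - t *\<^sub>R a) \<le> e * t"
begin

text \<open>The asymptotic condition concerns positions only. The force is at most
  \<open>K / s\<^sup>2\<close>, so after time \<open>t\<close> the velocity varies by at most
  \<open>K / t\<close>, and \<open>\<gamma> u\<close> differs from
  \<open>\<gamma> t + (u - t) *\<^sub>R p t\<close> by at most \<open>(u - t) * (K / t)\<close>.
  Dividing by \<open>u\<close> and letting it tend to infinity brings in \<open>a\<close>.\<close>

lemma velocity_limit: "\<forall>\<^sub>F t in at_top. norm (p t - a) \<le> K / t"
proof -
  obtain T1 where T1: "\<And>t. t \<ge> T1 \<Longrightarrow> norm (\<gamma> t - t *\<^sub>R a) \<le> \<epsilon>0 * t"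
    using asymptotic[OF \<epsilon>0_pos] unfolding eventually_at_top_linorder by blast
  define T where "T = max T0 T1"
  have Tpos: "T > 0" using T0_pos by (simp add: T_def)
  have "norm (p t - a) \<le> K / t" if t: "t \<ge> T" for t
  proof -
    have t0: "t > 0" using t Tpos by simp
    have pdiff: "norm (p u - p t) \<le> K / t" if u: "u \<ge> t" for u
    proof -
      have "norm (p u - p t) \<le> - K / u - - K / t"
      proof (rule increment_le_of_derivative_le[OF u])
        fix s assume s: "s \<in> {t..u}"
        then have s0: "s > 0" "s \<ge> T0" "s \<ge> T1" using t t0 by (auto simp: T_def)
        show "(p has_vector_derivative G (\<gamma> s)) (at s)" by (rule p_deriv[OF s0(2)])
        show "((\<lambda>x. - K / x) has_real_derivative K / s\<^sup>2) (at s)"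
          using s0 by (auto intro!: derivative_eq_intros simp: power2_eq_square)
        show "norm (G (\<gamma> s)) \<le> K / s\<^sup>2" by (rule G_le[OF s0(1) T1[OF s0(3)]])
      qed
      also have "\<dots> \<le> K / t"
      proof -
        have "0 \<le> K / u" using u t0 K_pos by (intro divide_nonneg_nonneg) auto
        then show ?thesis by linarith
      qed
      finally show ?thesis .
    qed
    have \<gamma>diff: "norm (\<gamma> u - \<gamma> t - (u - t) *\<^sub>R p t) \<le> (u - t) * (K / t)" if u: "u \<ge> t" for u
    proof -
      have "norm ((\<gamma> u - u *\<^sub>R p t) - (\<gamma> t - t *\<^sub>R p t)) \<le> (K / t) * u - (K / t) * t"
      proof (rule increment_le_of_derivative_le[OF u])
        fix s assume s: "s \<in> {t..u}"
        then have s0: "s \<ge> T0" using t by (auto simp: T_def)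
        show "((\<lambda>s. \<gamma> s - s *\<^sub>R p t) has_vector_derivative (p s - p t)) (at s)"
          using \<gamma>_deriv[OF s0] by (auto intro!: derivative_eq_intros)
        show "((\<lambda>x. K / t * x) has_real_derivative K / t) (at s)"
          using t0 by (auto intro!: derivative_eq_intros)
        show "norm (p s - p t) \<le> K / t" using pdiff s by auto
      qed
      moreover have "(\<gamma> u - u *\<^sub>R p t) - (\<gamma> t - t *\<^sub>R p t) = \<gamma> u - \<gamma> t - (u - t) *\<^sub>R p t"
        by (simp add: algebra_simps)
      moreover have "(K / t) * u - (K / t) * t = (u - t) * (K / t)" by (metis left_diff_distrib mult.commute)
      ultimately show ?thesis by (simp only:)
    qed
    let ?q = "\<lambda>u. inverse u *\<^sub>R (\<gamma> u - \<gamma> t - (u - t) *\<^sub>R p t)"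
    have "norm (a - p t) \<le> K / t"
    proof (rule Lim_norm_ubound[of at_top ?q])
      have inv0: "((\<lambda>u. inverse u) \<longlongrightarrow> (0::real)) at_top" by (rule tendsto_inverse_0_at_top) (rule filterlim_ident)
      have "((\<lambda>u. inverse u *\<^sub>R (\<gamma> u - u *\<^sub>R a)) \<longlongrightarrow> 0) at_top"
      proof (rule tendstoI)
        fix e :: real assume e: "e > 0"
        have "\<forall>\<^sub>F u in at_top. norm (\<gamma> u - u *\<^sub>R a) \<le> e / 2 * u" using asymptotic[of "e / 2"] e by simp
        then show "\<forall>\<^sub>F u in at_top. dist (inverse u *\<^sub>R (\<gamma> u - u *\<^sub>R a)) 0 < e"
          using eventually_gt_at_top[of 0]
        proof eventually_elim
          case (elim u)
          have "inverse u * norm (\<gamma> u - u *\<^sub>R a) \<le> inverse u * (e / 2 * u)"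
            using elim by (intro mult_left_mono) auto
          also have "inverse u * (e / 2 * u) = e / 2" using elim by simp
          finally have "norm (inverse u *\<^sub>R (\<gamma> u - u *\<^sub>R a)) \<le> e / 2" using elim by simp
          then show ?case using e by (simp only: dist_0_norm dist_norm diff_zero)
        qed
      qed
      moreover have "((\<lambda>u. inverse u *\<^sub>R (t *\<^sub>R p t - \<gamma> t)) \<longlongrightarrow> 0 *\<^sub>R (t *\<^sub>R p t - \<gamma> t)) at_top"
        by (intro tendsto_scaleR inv0 tendsto_const)
      ultimately have "((\<lambda>u. inverse u *\<^sub>R (\<gamma> u - u *\<^sub>R a) + inverse u *\<^sub>R (t *\<^sub>R p t - \<gamma> t) + (a - p t)) \<longlongrightarrow>
          0 + 0 *\<^sub>R (t *\<^sub>R p t - \<gamma> t) + (a - p t)) at_top"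
        by (intro tendsto_add tendsto_const)
      moreover have "\<forall>\<^sub>F u in at_top. inverse u *\<^sub>R (\<gamma> u - u *\<^sub>R a) + inverse u *\<^sub>R (t *\<^sub>R p t - \<gamma> t) + (a - p t) = ?q u"
        using eventually_gt_at_top[of 0]
      proof eventually_elim
        case (elim u)
        have "?q u = inverse u *\<^sub>R (\<gamma> u - u *\<^sub>R a) + inverse u *\<^sub>R (t *\<^sub>R p t - \<gamma> t) + (inverse u * u) *\<^sub>R (a - p t)"
          by (simp add: algebra_simps)
        then show ?case using elim by simp
      qed
      ultimately show "(?q \<longlongrightarrow> a - p t) at_top" using Lim_transform_eventually by fastforce
      show "\<forall>\<^sub>F u in at_top. norm (?q u) \<le> K / t"
        using eventually_ge_at_top[of t]
      proof eventually_elim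
        case (elim u)
        have u0: "u > 0" using elim t0 by simp
        have "norm (?q u) = inverse u * norm (\<gamma> u - \<gamma> t - (u - t) *\<^sub>R p t)" using u0 by simp
        also have "\<dots> \<le> inverse u * ((u - t) * (K / t))"
          using \<gamma>diff[OF elim] u0 by (intro mult_left_mono) auto
        also have "\<dots> \<le> inverse u * (u * (K / t))"
          using u0 t0 K_pos by (intro mult_left_mono mult_right_mono) auto
        also have "\<dots> = K / t" using u0 by simp
        finally show ?case .
      qed
    qed simp
    then show ?thesis by (simp add: norm_minus_commute)
  qed
  then show ?thesis unfolding eventually_at_top_linorder by blast
qed

lemma logarithmic_deviation: "\<exists>C. \<forall>\<^sub>F t in at_top. norm (\<gamma> t - t *\<^sub>R a) \<le> C + K * ln t"
proof -
  obtain T1 where T1: "\<And>t. t \<ge> T1 \<Longrightarrow> norm (p t - a) \<le> K / t"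
    using velocity_limit unfolding eventually_at_top_linorder by blast
  define T where "T = max T0 T1"
  have Tpos: "T > 0" using T0_pos by (simp add: T_def)
  have "norm (\<gamma> t - t *\<^sub>R a) \<le> (norm (\<gamma> T - T *\<^sub>R a) - K * ln T) + K * ln t" if t: "t \<ge> T" for t
  proof -
    have "norm ((\<gamma> t - t *\<^sub>R a) - (\<gamma> T - T *\<^sub>R a)) \<le> K * ln t - K * ln T"
    proof (rule increment_le_of_derivative_le[OF t])
      fix s assume s: "s \<in> {T..t}"
      then have s0: "s > 0" "s \<ge> T0" "s \<ge> T1" using Tpos by (auto simp: T_def)
      show "((\<lambda>s. \<gamma> s - s *\<^sub>R a) has_vector_derivative (p s - a)) (at s)"
        using \<gamma>_deriv[OF s0(2)] by (auto intro!: derivative_eq_intros)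
      show "((\<lambda>x. K * ln x) has_real_derivative K / s) (at s)"
        using s0 by (auto intro!: derivative_eq_intros)
      show "norm (p s - a) \<le> K / s" by (rule T1[OF s0(3)])
    qed
    then show ?thesis using norm_triangle_sub[of "\<gamma> t - t *\<^sub>R a" "\<gamma> T - T *\<^sub>R a"] by simp
  qed
  then show ?thesis unfolding eventually_at_top_linorder by blast
qed

lemma velocity_tendsto: "(p \<longlongrightarrow> a) at_top"
proof -
  have "((\<lambda>t. p t - a) \<longlongrightarrow> 0) at_top"
  proof (rule Lim_null_comparison[OF velocity_limit])
    have "((\<lambda>t. K * inverse t) \<longlongrightarrow> K * 0) at_top"
      by (intro tendsto_mult tendsto_const tendsto_inverse_0_at_top filterlim_ident)
    then show "((\<lambda>t. K / t) \<longlongrightarrow> 0) at_top" by (simp add: divide_inverse)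
  qed
  then show ?thesis by (simp add: LIM_zero_iff)
qed

text \<open>The energy is constant, and its value is read off at infinity, where the velocity tends
  to \<open>a\<close> and the potential to 0.\<close>

lemma energy_eventually: "\<forall>\<^sub>F t in at_top. (norm (p t))\<^sup>2 = (norm a)\<^sup>2 + 2 * U (\<gamma> t)"
proof -
  obtain T1 where T1: "\<And>t. t \<ge> T1 \<Longrightarrow> norm (\<gamma> t - t *\<^sub>R a) \<le> \<epsilon>0 * t"
    using asymptotic[OF \<epsilon>0_pos] unfolding eventually_at_top_linorder by blast
  define T where "T = max T0 T1"
  have Tpos: "T > 0" using T0_pos by (simp add: T_def)
  let ?E = "\<lambda>t. p t \<bullet> p t - 2 * U (\<gamma> t)"
  have const: "?E t = ?E T" if t: "t \<ge> T" for t
  proof -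
    have "norm (?E t - ?E T) \<le> 0 - 0"
    proof (rule increment_le_of_derivative_le[OF t, where f' = "\<lambda>_. 0" and \<phi> = "\<lambda>_. 0" and \<phi>' = "\<lambda>_. 0"])
      fix s assume s: "s \<in> {T..t}"
      then have s0: "s > 0" "s \<ge> T0" "s \<ge> T1" using Tpos by (auto simp: T_def)
      have "((\<lambda>s. U (\<gamma> s)) has_vector_derivative (G (\<gamma> s) \<bullet> p s)) (at s)"
        by (rule has_vector_derivative_gradient_compose[OF \<gamma>_deriv[OF s0(2)] U_has_derivative[OF s0(1) T1[OF s0(3)]]])
      moreover have "((\<lambda>s. p s \<bullet> p s) has_vector_derivative (p s \<bullet> G (\<gamma> s) + G (\<gamma> s) \<bullet> p s)) (at s)"
        using bounded_bilinear.has_vector_derivative[OF bounded_bilinear_inner p_deriv[OF s0(2)] p_deriv[OF s0(2)]] .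
      ultimately have "(?E has_vector_derivative ((p s \<bullet> G (\<gamma> s) + G (\<gamma> s) \<bullet> p s) - 2 * (G (\<gamma> s) \<bullet> p s))) (at s)"
        by (intro has_vector_derivative_diff has_vector_derivative_mult_right)
      then show "(?E has_vector_derivative 0) (at s)" by (simp add: inner_commute)
    qed auto
    then show ?thesis by simp
  qed
  have "(?E \<longlongrightarrow> a \<bullet> a - 2 * 0) at_top"
  proof (intro tendsto_intros velocity_tendsto)
    show "((\<lambda>t. U (\<gamma> t)) \<longlongrightarrow> 0) at_top"
    proof (rule Lim_null_comparison)
      show "\<forall>\<^sub>F t in at_top. norm (U (\<gamma> t)) \<le> K * inverse t"
        using eventually_ge_at_top[of T]
      proof eventually_elim
        case (elim t)
        then have "t > 0" "t \<ge> T1" using Tpos by (auto simp: T_def)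
        then show ?case using U_le[OF _ T1] U_nonneg[of "\<gamma> t"] by (simp add: divide_inverse)
      qed
      have "((\<lambda>t. K * inverse t) \<longlongrightarrow> K * 0) at_top"
        by (intro tendsto_mult tendsto_const tendsto_inverse_0_at_top filterlim_ident)
      then show "((\<lambda>t. K * inverse t) \<longlongrightarrow> 0) at_top" by simp
    qed
  qed
  moreover have "(?E \<longlongrightarrow> ?E T) at_top"
  proof (rule tendsto_eventually)
    show "\<forall>\<^sub>F t in at_top. ?E t = ?E T" unfolding eventually_at_top_linorder using const by blast
  qed
  ultimately have ET: "?E T = a \<bullet> a" using tendsto_unique[OF trivial_limit_at_top_linorder] by fastforce
  have "(norm (p t))\<^sup>2 = (norm a)\<^sup>2 + 2 * U (\<gamma> t)" if "t \<ge> T" for t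
    using const[OF that] ET by (simp add: power2_norm_eq_inner)
  then show ?thesis unfolding eventually_at_top_linorder by blast
qed

end

text \<open>\<open>\<epsilon>\<close> is the opening of the cone on which the calibrating function lives, \<open>T\<close> the time after
  which \<open>\<gamma>\<close> is close to its asymptotic direction, and \<open>\<sigma>\<close> the action along \<open>\<gamma>\<close>.\<close>

locale calibrated_solution = conical_potential U G a \<epsilon>0 K k
  for U :: "'v::euclidean_space \<Rightarrow> real" and G a \<epsilon>0 K k +
  fixes \<gamma> p :: "real \<Rightarrow> 'v" and \<sigma> :: "real \<Rightarrow> real" and T \<epsilon> :: real
  assumes T_pos: "T > 0"
    and \<gamma>_deriv: "t \<ge> T \<Longrightarrow> (\<gamma> has_vector_derivative p t) (at t)"
    and p_deriv: "t \<ge> T \<Longrightarrow> (p has_vector_derivative G (\<gamma> t)) (at t)"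
    and \<sigma>_deriv: "t \<ge> T \<Longrightarrow> (\<sigma> has_real_derivative (norm (p t))\<^sup>2) (at t)"
    and p_near: "t \<ge> T \<Longrightarrow> norm (p t - a) \<le> K / t"
    and energy: "t \<ge> T \<Longrightarrow> (norm (p t))\<^sup>2 = (norm a)\<^sup>2 + 2 * U (\<gamma> t)"
    and \<gamma>_near: "t \<ge> T \<Longrightarrow> norm (\<gamma> t - t *\<^sub>R a) \<le> \<epsilon> / 10 * t"
    and \<epsilon>: "\<epsilon> > 0" "\<epsilon> \<le> \<epsilon>0 / 2" "\<epsilon> \<le> norm a / 2"
    and T_large: "2 * K / T \<le> norm a / 16" "2 * K / T \<le> 1 / 8" "40 * norm a * K / \<epsilon>\<^sup>2 \<le> T"
begin

text \<open>Each largeness condition absorbs one error: the first keeps the velocity close to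
  \<open>a\<close>, the second makes the Taylor remainder of \<open>U\<close> small in the eikonal
  inequality, and the third one of \<open>T_large\<close> limits the growth of
  \<open>\<sigma> t - height t\<close> on the lateral boundary of the cone.\<close>

lemma T_large': "t \<ge> T \<Longrightarrow> 2 * K / t \<le> norm a / 16" "t \<ge> T \<Longrightarrow> 2 * K / t \<le> 1 / 8"
proof -
  assume t: "t \<ge> T"
  have "2 * K / t \<le> 2 * K / T" using t T_pos K_pos by (intro divide_left_mono) auto
  then show "2 * K / t \<le> norm a / 16" "2 * K / t \<le> 1 / 8" using T_large by linarith+
qed

lemma cone_\<gamma>: assumes "t \<ge> T" shows "norm (\<gamma> t - t *\<^sub>R a) \<le> \<epsilon>0 * t"
proof -
  have "\<epsilon> / 10 * t \<le> \<epsilon>0 * t" using \<epsilon> assms T_pos by (intro mult_right_mono) auto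
  then show ?thesis using \<gamma>_near[OF assms] by linarith
qed

lemma cone_near:
  assumes "t \<ge> T" "norm \<xi> \<le> \<epsilon> * t"
  shows "norm (\<gamma> t + \<xi> - t *\<^sub>R a) \<le> \<epsilon>0 * t" "norm \<xi> \<le> \<epsilon>0 * t"
proof -
  have "t > 0" using assms T_pos by simp
  then have "\<epsilon> * t \<le> \<epsilon>0 / 2 * t" "\<epsilon> / 10 * t \<le> \<epsilon>0 / 2 * t" using \<epsilon> by (auto intro!: mult_right_mono)
  moreover have "norm (\<gamma> t + \<xi> - t *\<^sub>R a) \<le> norm (\<gamma> t - t *\<^sub>R a) + norm \<xi>"
    using norm_triangle_ineq[of "\<gamma> t - t *\<^sub>R a" \<xi>] by (simp add: algebra_simps)
  moreover have "\<epsilon>0 * t = \<epsilon>0 / 2 * t + \<epsilon>0 / 2 * t" "0 \<le> \<epsilon>0 / 2 * t" using \<epsilon>0_pos \<open>t > 0\<close> by auto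
  ultimately show "norm (\<gamma> t + \<xi> - t *\<^sub>R a) \<le> \<epsilon>0 * t" "norm \<xi> \<le> \<epsilon>0 * t"
    using \<gamma>_near[OF assms(1)] assms(2) by linarith+
qed

section \<open>Coordinates around the solution and the local subsolution\<close>

definition height :: "real \<Rightarrow> real" where "height t = \<gamma> t \<bullet> a"

lemma height_deriv: "t \<ge> T \<Longrightarrow> (height has_real_derivative p t \<bullet> a) (at t)"
  unfolding height_def has_real_derivative_iff_has_vector_derivative
  using bounded_linear.has_vector_derivative[OF bounded_linear_inner_left \<gamma>_deriv] by blast

lemma speed_ge: assumes "t \<ge> T" shows "p t \<bullet> a \<ge> (norm a)\<^sup>2 / 2"
proof -
  have "\<bar>(p t - a) \<bullet> a\<bar> \<le> norm (p t - a) * norm a" by (rule Cauchy_Schwarz_ineq2)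
  also have "\<dots> \<le> norm a / 32 * norm a"
    using p_near[OF assms] T_large'(1)[OF assms] by (intro mult_right_mono) auto
  finally have "\<bar>(p t - a) \<bullet> a\<bar> \<le> (norm a)\<^sup>2 / 32" by (simp add: power2_eq_square)
  moreover have "(p t - a) \<bullet> a = p t \<bullet> a - (norm a)\<^sup>2"
    by (simp add: inner_diff_left power2_norm_eq_inner)
  ultimately show ?thesis using zero_le_power2[of "norm a"] by linarith
qed

lemma height_increment:
  assumes "T \<le> s" "s \<le> t"
  shows "(norm a)\<^sup>2 / 2 * (t - s) \<le> height t - height s"
proof -
  have "(norm a)\<^sup>2 / 2 * t - (norm a)\<^sup>2 / 2 * s \<le> height t - height s"
  proof (rule increment_le_of_derivative_le_real[OF assms(2)])
    fix u assume "u \<in> {s..t}"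
    then have u: "u \<ge> T" using assms by simp
    show "((\<lambda>t. (norm a)\<^sup>2 / 2 * t) has_real_derivative (norm a)\<^sup>2 / 2) (at u)"
      by (auto intro!: derivative_eq_intros)
    show "(height has_real_derivative p u \<bullet> a) (at u)" by (rule height_deriv[OF u])
    show "(norm a)\<^sup>2 / 2 \<le> p u \<bullet> a" by (rule speed_ge[OF u])
  qed
  then show ?thesis by (simp only: right_diff_distrib)
qed

lemma height_surj:
  assumes "y \<ge> height T"
  shows "\<exists>t\<ge>T. height t = y"
proof -
  define t where "t = T + (y - height T) / ((norm a)\<^sup>2 / 2)"
  have tT: "T \<le> t" using assms by (simp add: t_def)
  have "(norm a)\<^sup>2 / 2 * (t - T) = y - height T" using a_nonzero by (simp add: t_def)
  then have "y \<le> height t" using height_increment[OF order_refl tT] by simp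
  moreover have "continuous_on {T..t} height"
    using height_deriv by (meson DERIV_isCont atLeastAtMost_iff continuous_at_imp_continuous_on)
  ultimately obtain x where "T \<le> x" "x \<le> t" "height x = y"
    using IVT'[of height T y t] assms tT by blast
  then show ?thesis by blast
qed

text \<open>Hyperplanes orthogonal to \<open>a\<close> slice the region around the solution; this is
  the time at which the slice of level \<open>y\<close> is crossed, unique because
  \<open>height\<close> is strictly increasing.\<close>

definition \<theta> :: "real \<Rightarrow> real" where "\<theta> y = (SOME t. t \<ge> T \<and> height t = y)"

lemma \<theta>: assumes "y \<ge> height T" shows "\<theta> y \<ge> T" "height (\<theta> y) = y"
  using someI_ex[OF height_surj[OF assms, unfolded Bex_def], folded \<theta>_def] by (auto simp: \<theta>_def)

lemma \<theta>_lipschitz: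
  assumes "y \<ge> height T" "z \<ge> height T"
  shows "\<bar>\<theta> y - \<theta> z\<bar> \<le> 2 / (norm a)\<^sup>2 * \<bar>y - z\<bar>"
proof -
  have *: "\<theta> y - \<theta> z \<le> 2 / (norm a)\<^sup>2 * \<bar>y - z\<bar>" if "y \<ge> height T" "z \<ge> height T" "\<theta> z \<le> \<theta> y" for y z
  proof -
    have "(norm a)\<^sup>2 / 2 * (\<theta> y - \<theta> z) \<le> \<bar>y - z\<bar>"
      using height_increment[OF \<theta>(1)[OF that(2)] that(3)] \<theta>(2)[OF that(1)] \<theta>(2)[OF that(2)]
        abs_ge_self[of "y - z"] by linarith
    then have "2 / (norm a)\<^sup>2 * ((norm a)\<^sup>2 / 2 * (\<theta> y - \<theta> z)) \<le> 2 / (norm a)\<^sup>2 * \<bar>y - z\<bar>"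
      by (intro mult_left_mono) auto
    then show ?thesis using a_nonzero by simp
  qed
  show ?thesis
    using *[OF assms] *[OF assms(2,1)] by (cases "\<theta> z \<le> \<theta> y") (auto simp: abs_minus_commute)
qed

lemma \<theta>_height: assumes "t \<ge> T" shows "\<theta> (height t) = t"
proof -
  have h: "height t \<ge> height T"
    using height_increment[OF order_refl assms] assms by (smt (verit) mult_nonneg_nonneg zero_le_divide_iff zero_le_power2)
  note th = \<theta>[OF h]
  have pos: "(norm a)\<^sup>2 / 2 > 0" using a_nonzero by simp
  show ?thesis
  proof (cases "t \<le> \<theta> (height t)")
    case True
    from height_increment[OF assms True] th pos have "(norm a)\<^sup>2 / 2 * (\<theta> (height t) - t) \<le> 0" by simp
    then show ?thesis using pos True by (simp add: mult_le_0_iff)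
  next
    case False
    from height_increment[OF th(1), of t] False th pos have "(norm a)\<^sup>2 / 2 * (t - \<theta> (height t)) \<le> 0" by simp
    then show ?thesis using pos False by (simp add: mult_le_0_iff)
  qed
qed

lemma \<theta>_continuous: "continuous_on {height T..} \<theta>"
proof (rule continuous_onI)
  fix y e :: real assume y: "y \<in> {height T..}" and e: "e > 0"
  show "\<exists>d>0. \<forall>x'\<in>{height T..}. dist x' y < d \<longrightarrow> dist (\<theta> x') (\<theta> y) \<le> e"
  proof (intro exI[of _ "e * (norm a)\<^sup>2 / 2"] conjI ballI impI)
    fix x' assume x: "x' \<in> {height T..}" "dist x' y < e * (norm a)\<^sup>2 / 2"
    have "dist (\<theta> x') (\<theta> y) \<le> 2 / (norm a)\<^sup>2 * \<bar>x' - y\<bar>"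
      using \<theta>_lipschitz x y by (simp add: dist_real_def)
    also have "\<dots> \<le> 2 / (norm a)\<^sup>2 * (e * (norm a)\<^sup>2 / 2)"
      using x by (intro mult_left_mono) (auto simp: dist_real_def)
    also have "\<dots> = e" using a_nonzero by simp
    finally show "dist (\<theta> x') (\<theta> y) \<le> e" .
  qed (use e a_nonzero in simp)
qed

lemma \<theta>_deriv:
  assumes "y > height T"
  shows "(\<theta> has_real_derivative inverse (p (\<theta> y) \<bullet> a)) (at y)"
proof (rule DERIV_inverse_function[where f = height and a = "height T" and b = "y + 1"])
  have T': "\<theta> y \<ge> T" using \<theta> assms by simp
  show "(height has_real_derivative p (\<theta> y) \<bullet> a) (at (\<theta> y))" by (rule height_deriv[OF T'])
  show "p (\<theta> y) \<bullet> a \<noteq> 0" using speed_ge[OF T'] a_nonzero by (smt (verit) half_gt_zero zero_less_norm_iff zero_less_power2 norm_eq_zero)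
  show "height (\<theta> z) = z" if "height T < z" for z using \<theta>(2) that by simp
  have "continuous_on {height T<..} \<theta>" by (rule continuous_on_subset[OF \<theta>_continuous]) auto
  then show "isCont \<theta> y" using assms by (simp add: continuous_on_eq_continuous_at)
qed (use assms in auto)

text \<open>The Hessian coefficient \<open>1/(4\<tau>)\<close> is between that of the plane wave (0) and of the
  spherical wave (\<open>1/\<tau>\<close>), which leaves room of order \<open>|\<xi>|\<^sup>2/\<tau>\<^sup>2\<close> in the eikonal inequality
  while keeping the function below the spherical wave away from \<open>\<gamma>\<close>.\<close>

definition profile :: "real \<Rightarrow> 'v \<Rightarrow> real" where
  "profile t \<xi> = \<sigma> t + p t \<bullet> \<xi> + (\<xi> \<bullet> \<xi>) / (8 * t)"

definition param :: "'v \<Rightarrow> real" where "param x = \<theta> (x \<bullet> a)"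

definition offset :: "'v \<Rightarrow> 'v" where "offset x = x - \<gamma> (param x)"

definition S :: "'v \<Rightarrow> real" where "S x = profile (param x) (offset x)"

text \<open>The \<open>t\<close>-derivative of \<open>profile t (x - \<gamma> t)\<close> at fixed
  \<open>x\<close>, divided by the derivative \<open>p t \<bullet> a\<close> of
  \<open>height\<close>. The derivative \<open>(norm (p t))\<^sup>2\<close> of \<sigma> has
  cancelled against the term coming from the motion of the offset.\<close>

definition slope :: "real \<Rightarrow> 'v \<Rightarrow> real" where
  "slope t \<xi> = (G (\<gamma> t) \<bullet> \<xi> - (\<xi> \<bullet> \<xi>) / (8 * t\<^sup>2) - (p t \<bullet> \<xi>) / (4 * t)) / (p t \<bullet> a)"

definition gradS :: "real \<Rightarrow> 'v \<Rightarrow> 'v" where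
  "gradS t \<xi> = p t + (1 / (4 * t)) *\<^sub>R \<xi> + slope t \<xi> *\<^sub>R a"

lemma param:
  assumes "x \<bullet> a \<ge> height T"
  shows "param x \<ge> T" "height (param x) = x \<bullet> a" "offset x \<bullet> a = 0" "x = \<gamma> (param x) + offset x"
  using \<theta>[OF assms] by (auto simp: param_def offset_def height_def inner_diff_left)

lemma param_\<gamma>: "t \<ge> T \<Longrightarrow> param (\<gamma> t) = t" "t \<ge> T \<Longrightarrow> offset (\<gamma> t) = 0" "t \<ge> T \<Longrightarrow> S (\<gamma> t) = \<sigma> t"
  using \<theta>_height by (simp_all add: param_def offset_def S_def profile_def height_def)

text \<open>A variation \<open>v\<close> of the point moves the base time at the rate
  \<open>(v \<bullet> a) / (p t \<bullet> a)\<close>; the terms with this factor are collected in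
  \<open>slope\<close>. The strict inequality keeps the level inside the domain of \<theta>.\<close>

lemma S_has_derivative:
  assumes x: "x \<bullet> a > height T"
  shows "(S has_derivative (\<lambda>v. gradS (param x) (offset x) \<bullet> v)) (at x)"
proof -
  define t where "t = param x"
  define \<xi> where "\<xi> = offset x"
  define f' where "f' = p t \<bullet> a"
  have t: "t \<ge> T" using param x by (simp add: t_def)
  then have t0: "t > 0" using T_pos by simp
  define \<tau>' where "\<tau>' v = (v \<bullet> a) / f'" for v
  have dparam: "(param has_derivative \<tau>') (at x)"
  proof -
    have "(\<theta> has_derivative (\<lambda>h. inverse f' * h)) (at (x \<bullet> a))"
      using \<theta>_deriv[OF x] by (simp add: has_field_derivative_def f'_def t_def param_def)
    then have "((\<lambda>x. \<theta> (x \<bullet> a)) has_derivative (\<lambda>v. inverse f' * (v \<bullet> a))) (at x)"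
      by (rule has_derivative_compose[where f = "\<lambda>x. x \<bullet> a" and g = \<theta>, rotated])
        (auto intro!: derivative_eq_intros)
    then show ?thesis by (simp add: param_def[abs_def] \<tau>'_def[abs_def] divide_inverse mult.commute)
  qed
  have comp: "((\<lambda>x. c (param x)) has_derivative (\<lambda>v. \<tau>' v *\<^sub>R c')) (at x)"
    if "(c has_vector_derivative c') (at t)" for c :: "real \<Rightarrow> 'w::real_normed_vector" and c'
    using has_derivative_compose[OF dparam, of c "\<lambda>h. h *\<^sub>R c'"] that
    by (simp add: has_vector_derivative_def t_def)
  have d\<gamma>: "((\<lambda>x. \<gamma> (param x)) has_derivative (\<lambda>v. \<tau>' v *\<^sub>R p t)) (at x)" by (rule comp[OF \<gamma>_deriv[OF t]])
  have dp: "((\<lambda>x. p (param x)) has_derivative (\<lambda>v. \<tau>' v *\<^sub>R G (\<gamma> t))) (at x)" by (rule comp[OF p_deriv[OF t]])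
  have d\<sigma>: "((\<lambda>x. \<sigma> (param x)) has_derivative (\<lambda>v. \<tau>' v *\<^sub>R (norm (p t))\<^sup>2)) (at x)"
    by (rule comp) (use \<sigma>_deriv[OF t] in \<open>simp add: has_real_derivative_iff_has_vector_derivative\<close>)
  have di: "((\<lambda>x. inverse (8 * param x)) has_derivative (\<lambda>v. \<tau>' v *\<^sub>R (- 1 / (8 * t\<^sup>2)))) (at x)"
  proof (rule comp)
    have "((\<lambda>t. inverse (8 * t)) has_real_derivative (- 1 / (8 * t\<^sup>2))) (at t)"
      using t0 by (auto intro!: derivative_eq_intros simp: power2_eq_square field_simps)
    then show "((\<lambda>t. inverse (8 * t)) has_vector_derivative (- 1 / (8 * t\<^sup>2))) (at t)"
      by (simp add: has_real_derivative_iff_has_vector_derivative)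
  qed
  have doff: "(offset has_derivative (\<lambda>v. v - \<tau>' v *\<^sub>R p t)) (at x)"
    unfolding offset_def[abs_def] by (intro has_derivative_diff has_derivative_ident d\<gamma>)
  have "((\<lambda>x. \<sigma> (param x) + p (param x) \<bullet> offset x + (offset x \<bullet> offset x) * inverse (8 * param x)) has_derivative
    (\<lambda>v. \<tau>' v *\<^sub>R (norm (p t))\<^sup>2 + (p t \<bullet> (v - \<tau>' v *\<^sub>R p t) + (\<tau>' v *\<^sub>R G (\<gamma> t)) \<bullet> \<xi>) +
       ((\<xi> \<bullet> \<xi>) * (\<tau>' v *\<^sub>R (- 1 / (8 * t\<^sup>2))) +
        (\<xi> \<bullet> (v - \<tau>' v *\<^sub>R p t) + (v - \<tau>' v *\<^sub>R p t) \<bullet> \<xi>) * inverse (8 * t)))) (at x)"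
    unfolding t_def \<xi>_def
    by (intro has_derivative_add has_derivative_inner has_derivative_mult d\<sigma>[unfolded t_def] dp[unfolded t_def] di[unfolded t_def] doff[unfolded t_def])
  moreover have "(\<lambda>v. \<tau>' v *\<^sub>R (norm (p t))\<^sup>2 + (p t \<bullet> (v - \<tau>' v *\<^sub>R p t) + (\<tau>' v *\<^sub>R G (\<gamma> t)) \<bullet> \<xi>) +
       ((\<xi> \<bullet> \<xi>) * (\<tau>' v *\<^sub>R (- 1 / (8 * t\<^sup>2))) +
        (\<xi> \<bullet> (v - \<tau>' v *\<^sub>R p t) + (v - \<tau>' v *\<^sub>R p t) \<bullet> \<xi>) * inverse (8 * t))) = (\<lambda>v. gradS t \<xi> \<bullet> v)"
  proof
    fix v
    have "gradS t \<xi> \<bullet> v = p t \<bullet> v + (\<xi> \<bullet> v) / (4 * t) + slope t \<xi> * (v \<bullet> a)"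
      by (simp add: gradS_def inner_add_left inner_commute[of a])
    also have "slope t \<xi> * (v \<bullet> a) = \<tau>' v * (G (\<gamma> t) \<bullet> \<xi> - (\<xi> \<bullet> \<xi>) / (8 * t\<^sup>2) - (p t \<bullet> \<xi>) / (4 * t))"
      by (simp add: slope_def \<tau>'_def f'_def)
    also have "\<dots> = \<tau>' v * (G (\<gamma> t) \<bullet> \<xi>) - \<tau>' v * ((\<xi> \<bullet> \<xi>) / (8 * t\<^sup>2)) - \<tau>' v * ((p t \<bullet> \<xi>) / (4 * t))"
      by (simp only: right_diff_distrib)
    finally have 1: "gradS t \<xi> \<bullet> v = p t \<bullet> v + (\<xi> \<bullet> v) / (4 * t) +
        (\<tau>' v * (G (\<gamma> t) \<bullet> \<xi>) - \<tau>' v * ((\<xi> \<bullet> \<xi>) / (8 * t\<^sup>2)) - \<tau>' v * ((p t \<bullet> \<xi>) / (4 * t)))" .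
    have 2: "\<tau>' v *\<^sub>R (norm (p t))\<^sup>2 + (p t \<bullet> (v - \<tau>' v *\<^sub>R p t) + (\<tau>' v *\<^sub>R G (\<gamma> t)) \<bullet> \<xi>) = p t \<bullet> v + \<tau>' v * (G (\<gamma> t) \<bullet> \<xi>)"
      by (simp add: power2_norm_eq_inner inner_diff_right)
    have 3: "(\<xi> \<bullet> (v - \<tau>' v *\<^sub>R p t) + (v - \<tau>' v *\<^sub>R p t) \<bullet> \<xi>) * inverse (8 * t) = (\<xi> \<bullet> v) / (4 * t) - \<tau>' v * ((p t \<bullet> \<xi>) / (4 * t))"
    proof -
      have eq: "\<xi> \<bullet> (v - \<tau>' v *\<^sub>R p t) + (v - \<tau>' v *\<^sub>R p t) \<bullet> \<xi> = 2 * (\<xi> \<bullet> v - \<tau>' v * (p t \<bullet> \<xi>))"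
        by (simp add: inner_diff_right inner_diff_left inner_commute[of v] inner_commute[of "p t"])
      show ?thesis unfolding eq using t0 by (simp add: field_simps)
    qed
    have 4: "(\<xi> \<bullet> \<xi>) * (\<tau>' v *\<^sub>R (- 1 / (8 * t\<^sup>2))) = - (\<tau>' v * ((\<xi> \<bullet> \<xi>) / (8 * t\<^sup>2)))" by simp
    show "\<tau>' v *\<^sub>R (norm (p t))\<^sup>2 + (p t \<bullet> (v - \<tau>' v *\<^sub>R p t) + (\<tau>' v *\<^sub>R G (\<gamma> t)) \<bullet> \<xi>) +
       ((\<xi> \<bullet> \<xi>) * (\<tau>' v *\<^sub>R (- 1 / (8 * t\<^sup>2))) +
        (\<xi> \<bullet> (v - \<tau>' v *\<^sub>R p t) + (v - \<tau>' v *\<^sub>R p t) \<bullet> \<xi>) * inverse (8 * t)) = gradS t \<xi> \<bullet> v"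
      unfolding 1 2 3 4 by simp
  qed
  moreover have "S = (\<lambda>x. \<sigma> (param x) + p (param x) \<bullet> offset x + (offset x \<bullet> offset x) * inverse (8 * param x))"
    by (rule ext) (simp only: S_def profile_def divide_inverse)
  ultimately show ?thesis unfolding t_def \<xi>_def by (simp only:)
qed

text \<open>The linear terms match the Taylor expansion of \<open>U\<close>, those in
  \<open>p t \<bullet> \<xi>\<close> cancel. A quadratic part with Hessian \<beta>/t contributes
  \<open>(\<beta>\<^sup>2 - \<beta>) * (n / t)\<^sup>2\<close>, where \<open>n\<close> is the norm
  of \<xi>; for \<beta> = 1/4 the factor is -3/16. This reserve pays exactly for the squared slope
  term (1/16) and the Taylor remainder (1/8).\<close>

lemma eikonal:
  assumes t: "t \<ge> T" and \<xi>: "norm \<xi> \<le> \<epsilon> * t" "\<xi> \<bullet> a = 0"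
  shows "(norm (gradS t \<xi>))\<^sup>2 \<le> (norm a)\<^sup>2 + 2 * U (\<gamma> t + \<xi>)"
proof -
  define n where "n = norm \<xi>"
  define A where "A = norm a"
  define f' where "f' = p t \<bullet> a"
  define B where "B = G (\<gamma> t) \<bullet> \<xi> - n\<^sup>2 / (8 * t\<^sup>2) - (p t \<bullet> \<xi>) / (4 * t)"
  have t0: "t > 0" using t T_pos by simp
  have A0: "A > 0" using a_nonzero by (simp add: A_def)
  have n0: "n \<ge> 0" by (simp add: n_def)
  have f': "f' \<ge> A\<^sup>2 / 2" using speed_ge[OF t] by (simp add: f'_def A_def)
  then have f'0: "f' > 0" using A0 by (smt (verit) half_gt_zero zero_less_power)
  have nn: "\<xi> \<bullet> \<xi> = n\<^sup>2" by (simp add: n_def power2_norm_eq_inner)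
  have sl: "slope t \<xi> = B / f'" by (simp add: slope_def B_def f'_def nn)
  have pn: "\<bar>p t \<bullet> \<xi>\<bar> \<le> K / t * n"
  proof -
    have "p t \<bullet> \<xi> = (p t - a) \<bullet> \<xi>" using \<xi>(2) by (simp add: inner_diff_left inner_commute[of a])
    then have "\<bar>p t \<bullet> \<xi>\<bar> \<le> norm (p t - a) * n" using Cauchy_Schwarz_ineq2[of "p t - a" \<xi>] by (simp add: n_def)
    also have "\<dots> \<le> K / t * n" using p_near[OF t] n0 by (intro mult_right_mono)
    finally show ?thesis .
  qed
  have gn: "\<bar>G (\<gamma> t) \<bullet> \<xi>\<bar> \<le> K / t\<^sup>2 * n"
  proof -
    have "\<bar>G (\<gamma> t) \<bullet> \<xi>\<bar> \<le> norm (G (\<gamma> t)) * n" using Cauchy_Schwarz_ineq2[of "G (\<gamma> t)" \<xi>] by (simp add: n_def)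
    also have "\<dots> \<le> K / t\<^sup>2 * n" using G_le[OF t0 cone_\<gamma>[OF t]] n0 by (intro mult_right_mono)
    finally show ?thesis .
  qed
  have "2 * K / t = 2 * (K / t)" by simp
  then have Kt: "K / t \<le> A / 32" using T_large'(1)[OF t] unfolding A_def by linarith
  have nt: "n / t \<le> A / 2" 
  proof -
    have "n / t \<le> \<epsilon>" using \<xi>(1) t0 by (simp add: n_def field_simps)
    then show ?thesis using \<epsilon>(3) unfolding A_def by linarith
  qed
  \<comment> \<open>With \<open>K / t \<le> A / 32\<close> and \<open>n / t \<le> A / 2\<close> the
    factor of \<open>n / t\<close> is at most 5A/128 + A/16, which is below A/8.\<close>
  have Bn: "\<bar>B\<bar> \<le> (n / t) * (A / 8)"
  proof -
    have "\<bar>B\<bar> \<le> \<bar>G (\<gamma> t) \<bullet> \<xi>\<bar> + \<bar>n\<^sup>2 / (8 * t\<^sup>2)\<bar> + \<bar>(p t \<bullet> \<xi>) / (4 * t)\<bar>" unfolding B_def by linarith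
    also have "\<bar>n\<^sup>2 / (8 * t\<^sup>2)\<bar> = (n / t) * (n / t) / 8" by (simp add: power2_eq_square)
    also have "\<bar>(p t \<bullet> \<xi>) / (4 * t)\<bar> \<le> (K / t * n) / (4 * t)"
      using divide_right_mono[OF pn, of "4 * t"] t0 by simp
    also have "(K / t * n) / (4 * t) = (n / t) * (K / t) / 4" using t0 by (simp add: field_simps)
    finally have "\<bar>B\<bar> \<le> K / t\<^sup>2 * n + (n / t) * (n / t) / 8 + (n / t) * (K / t) / 4" using gn by linarith
    also have "K / t\<^sup>2 * n = (n / t) * (K / t)" by (simp add: power2_eq_square)
    also have "(n / t) * (K / t) + (n / t) * (n / t) / 8 + (n / t) * (K / t) / 4 = (n / t) * (5 / 4 * (K / t) + (n / t) / 8)"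
      by (simp add: algebra_simps)
    also have "\<dots> \<le> (n / t) * (A / 8)"
      using Kt nt n0 t0 A0 by (intro mult_left_mono) auto
    finally show ?thesis .
  qed
  have "B\<^sup>2 * A\<^sup>2 / f'\<^sup>2 \<le> (n / t)\<^sup>2 / 16"
  proof -
    have "A\<^sup>2 / f' \<le> 2" using f' f'0 by (simp add: field_simps)
    moreover have "0 \<le> A\<^sup>2 / f'" using f'0 by simp
    ultimately have "(A\<^sup>2 / f')\<^sup>2 \<le> 2\<^sup>2" by (rule power_mono)
    moreover have "B\<^sup>2 \<le> ((n / t) * (A / 8))\<^sup>2" using Bn by (metis abs_ge_zero power2_abs power_mono)
    ultimately have "B\<^sup>2 * (A\<^sup>2 / f')\<^sup>2 \<le> ((n / t) * (A / 8))\<^sup>2 * 2\<^sup>2" by (intro mult_mono) auto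
    then have "(B\<^sup>2 * A\<^sup>2 / f'\<^sup>2) * A\<^sup>2 \<le> ((n / t)\<^sup>2 / 16) * A\<^sup>2" by (simp add: power_mult_distrib power_divide power2_eq_square field_simps)
    then show ?thesis by (rule mult_right_le_imp_le) (use A0 in simp)
  qed
  moreover have "2 * (K * n\<^sup>2 / t ^ 3) \<le> (n / t)\<^sup>2 / 8"
  proof -
    have "2 * (K * n\<^sup>2 / t ^ 3) = (2 * K / t) * (n / t)\<^sup>2" by (simp add: power2_eq_square power3_eq_cube)
    also have "\<dots> \<le> 1 / 8 * (n / t)\<^sup>2" using T_large'(2)[OF t] by (intro mult_right_mono) auto
    finally show ?thesis by simp
  qed
  moreover have "(norm (gradS t \<xi>))\<^sup>2 = (norm (p t))\<^sup>2 + 2 * (G (\<gamma> t) \<bullet> \<xi>) - 3 / 16 * (n / t)\<^sup>2 + B\<^sup>2 * A\<^sup>2 / f'\<^sup>2"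
  proof -
    have "(norm (gradS t \<xi>))\<^sup>2 = p t \<bullet> p t + (1 / (4 * t))\<^sup>2 * (\<xi> \<bullet> \<xi>) + (slope t \<xi>)\<^sup>2 * (a \<bullet> a)
        + 2 * (1 / (4 * t)) * (p t \<bullet> \<xi>) + 2 * slope t \<xi> * (p t \<bullet> a) + 2 * (1 / (4 * t)) * slope t \<xi> * (\<xi> \<bullet> a)"
      unfolding power2_norm_eq_inner gradS_def
      by (simp add: inner_add_left inner_add_right inner_commute power2_eq_square algebra_simps)
    also have "\<xi> \<bullet> a = 0" by fact
    also have "2 * slope t \<xi> * (p t \<bullet> a) = 2 * B" using f'0 by (simp add: sl f'_def[symmetric])
    also have "(slope t \<xi>)\<^sup>2 * (a \<bullet> a) = B\<^sup>2 * A\<^sup>2 / f'\<^sup>2"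
      by (simp add: sl power_divide A_def power2_norm_eq_inner)
    finally have "(norm (gradS t \<xi>))\<^sup>2 = p t \<bullet> p t + (1 / (4 * t))\<^sup>2 * n\<^sup>2 + B\<^sup>2 * A\<^sup>2 / f'\<^sup>2
        + 2 * (1 / (4 * t)) * (p t \<bullet> \<xi>) + 2 * B" unfolding nn by simp
    moreover have "(1 / (4 * t))\<^sup>2 * n\<^sup>2 = (n / t)\<^sup>2 / 16" by (simp add: power_divide power_mult_distrib)
    moreover have "2 * (1 / (4 * t)) * (p t \<bullet> \<xi>) = (p t \<bullet> \<xi>) / (2 * t)" by simp
    moreover have "2 * B = 2 * (G (\<gamma> t) \<bullet> \<xi>) - (n / t)\<^sup>2 / 4 - (p t \<bullet> \<xi>) / (2 * t)"
      unfolding B_def by (simp add: power_divide)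
    ultimately show ?thesis by (simp add: power2_norm_eq_inner)
  qed
  moreover have "U (\<gamma> t + \<xi>) \<ge> U (\<gamma> t) + G (\<gamma> t) \<bullet> \<xi> - K * n\<^sup>2 / t ^ 3"
    using U_quadratic[OF t0 cone_\<gamma>[OF t] cone_near(2)[OF t \<xi>(1)]] by (simp add: n_def abs_le_iff)
  ultimately show ?thesis using energy[OF t] by linarith
qed

end

section \<open>Comparison with the spherical wave on the boundary of the cone\<close>

context calibrated_solution
begin

text \<open>Later than \<open>T\<close>, so that the region \<open>W\<close> starting there lies in
  the open half-space where \<open>S\<close> is differentiable.\<close>

definition T1 :: real where "T1 = T + 1"

text \<open>Chosen for the bottom of the cone: \<open>K * \<epsilon>\<close> and
  \<open>\<epsilon>\<^sup>2 * T1 / 8\<close> bound the linear and the quadratic part of the profile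
  at time \<open>T1\<close>, and the final 1 makes the inequality strict.\<close>

definition C0 :: real where "C0 = \<sigma> T1 - height T1 + K * \<epsilon> + \<epsilon>\<^sup>2 * T1 / 8 + 1"

lemma T1: "T1 > T" "T1 > 0" using T_pos by (auto simp: T1_def)

lemma height_bounds:
  assumes "t \<ge> T" shows "\<bar>height t - (norm a)\<^sup>2 * t\<bar> \<le> (norm a)\<^sup>2 * t / 20"
proof -
  have t0: "t > 0" using assms T_pos by simp
  have "height t - (norm a)\<^sup>2 * t = (\<gamma> t - t *\<^sub>R a) \<bullet> a"
    by (simp add: height_def inner_diff_left power2_norm_eq_inner)
  also have "\<bar>\<dots>\<bar> \<le> norm (\<gamma> t - t *\<^sub>R a) * norm a" by (rule Cauchy_Schwarz_ineq2)
  also have "\<dots> \<le> (\<epsilon> / 10 * t) * norm a" by (intro mult_right_mono \<gamma>_near[OF assms]) simp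
  also have "\<dots> \<le> (norm a / 2 / 10 * t) * norm a"
    using \<epsilon> t0 by (intro mult_right_mono divide_right_mono) auto
  also have "\<dots> = (norm a)\<^sup>2 * t / 20" by (simp add: power2_eq_square)
  finally show ?thesis by simp
qed

text \<open>In the cone \<xi> grows at most like \<open>t\<close>; being orthogonal to
  \<open>a\<close>, it sees only \<open>p t - a\<close>, which decays like
  \<open>1 / t\<close>.\<close>

lemma velocity_perp:
  assumes "t \<ge> T" "norm \<xi> \<le> \<epsilon> * t" "\<xi> \<bullet> a = 0"
  shows "\<bar>p t \<bullet> \<xi>\<bar> \<le> K * \<epsilon>"
proof -
  have t0: "t > 0" using assms(1) T_pos by simp
  have "p t \<bullet> \<xi> = (p t - a) \<bullet> \<xi>" using assms(3) by (simp add: inner_diff_left inner_commute[of a])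
  then have "\<bar>p t \<bullet> \<xi>\<bar> \<le> norm (p t - a) * norm \<xi>" using Cauchy_Schwarz_ineq2[of "p t - a" \<xi>] by simp
  also have "\<dots> \<le> K / t * (\<epsilon> * t)"
    using p_near[OF assms(1)] assms(2) t0 K_pos by (intro mult_mono) auto
  also have "\<dots> = K * \<epsilon>" using t0 by simp
  finally show ?thesis .
qed

lemma bottom_boundary:
  assumes "norm \<xi> \<le> \<epsilon> * T1" "\<xi> \<bullet> a = 0"
  shows "profile T1 \<xi> < norm a * norm (\<gamma> T1 + \<xi>) + C0"
proof -
  have t: "T1 \<ge> T" using T1 by simp
  have "height T1 = (\<gamma> T1 + \<xi>) \<bullet> a" using assms(2) by (simp add: height_def inner_add_left)
  also have "\<dots> \<le> norm (\<gamma> T1 + \<xi>) * norm a" by (rule norm_cauchy_schwarz)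
  finally have 1: "height T1 \<le> norm a * norm (\<gamma> T1 + \<xi>)" by (simp add: mult.commute)
  have "\<xi> \<bullet> \<xi> = (norm \<xi>)\<^sup>2" by (simp add: power2_norm_eq_inner)
  also have "\<dots> \<le> (\<epsilon> * T1)\<^sup>2" using assms(1) by (intro power_mono) auto
  finally have "(\<xi> \<bullet> \<xi>) / (8 * T1) \<le> (\<epsilon> * T1)\<^sup>2 / (8 * T1)" using T1 by (intro divide_right_mono) auto
  also have "\<dots> = \<epsilon>\<^sup>2 * T1 / 8" using T1 by (simp add: power2_eq_square)
  finally show ?thesis
    using 1 velocity_perp[OF t assms] unfolding profile_def C0_def by linarith
qed

text \<open>Splitting x along a gives |a|^2 |x|^2 = height^2 + |a|^2 |y|^2 with |y| at least 0.9
  \<epsilon> t, whence |a||x| exceeds the height by at least 0.19 \<epsilon>^2 t. The quadratic part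
  of the profile is \<epsilon>^2 t / 8, and \<sigma> - height has grown by at most \<epsilon>^2 t /
  20 since \<open>T1\<close>: together 0.175 \<epsilon>^2 t. The remaining terms are covered by
  \<open>C0\<close>.\<close>

lemma lateral_boundary:
  assumes t: "t \<ge> T1" and \<xi>: "norm \<xi> = \<epsilon> * t" "\<xi> \<bullet> a = 0"
  shows "profile t \<xi> < norm a * norm (\<gamma> t + \<xi>) + C0"
proof -
  define A where "A = norm a"
  have tT: "t \<ge> T" and t0: "t > 0" using t T1 T_pos by auto
  have A0: "A > 0" using a_nonzero by (simp add: A_def)
  have e2: "\<epsilon>\<^sup>2 \<le> A\<^sup>2 / 4"
  proof -
    have "\<epsilon>\<^sup>2 \<le> (A / 2)\<^sup>2" using \<epsilon> by (intro power_mono) (auto simp: A_def)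
    then show ?thesis by (simp add: power_divide)
  qed
  let ?f = "height t"
  have f: "?f \<le> 21 / 20 * (A\<^sup>2 * t)" "?f \<ge> 19 / 20 * (A\<^sup>2 * t)"
    using height_bounds[OF tT] unfolding A_def by linarith+
  define x where "x = \<gamma> t + \<xi>"
  define y where "y = x - (?f / A\<^sup>2) *\<^sub>R a"
  have aa: "a \<bullet> a = A\<^sup>2" by (simp add: A_def power2_norm_eq_inner)
  have ya: "y \<bullet> a = 0"
  proof -
    have "x \<bullet> a = ?f" using \<xi>(2) by (simp add: x_def height_def inner_add_left)
    then show ?thesis using A0 by (simp add: y_def inner_diff_left aa)
  qed
  have pyth: "A\<^sup>2 * (norm x)\<^sup>2 = ?f\<^sup>2 + A\<^sup>2 * (norm y)\<^sup>2"
  proof -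
    have "orthogonal y ((?f / A\<^sup>2) *\<^sub>R a)" using ya by (simp add: orthogonal_def)
    from norm_add_Pythagorean[OF this]
    have "(norm x)\<^sup>2 = (norm y)\<^sup>2 + (norm ((?f / A\<^sup>2) *\<^sub>R a))\<^sup>2" by (simp add: y_def)
    also have "(norm ((?f / A\<^sup>2) *\<^sub>R a))\<^sup>2 = (?f / A\<^sup>2)\<^sup>2 * A\<^sup>2"
      by (simp only: norm_scaleR power_mult_distrib power2_abs A_def)
    also have "\<dots> = ?f\<^sup>2 / A\<^sup>2" using A0 by (simp add: power2_eq_square)
    finally show ?thesis using A0 by (simp add: distrib_left)
  qed
  \<comment> \<open>\<open>y\<close> differs from \<xi> by the component of
    \<open>\<gamma> t - t *\<^sub>R a\<close> orthogonal to \<open>a\<close>, whose norm is at most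
    a tenth of \<open>\<epsilon> * t\<close>.\<close>
  have "norm y \<ge> 9 / 10 * (\<epsilon> * t)"
  proof -
    define z where "z = \<gamma> t - t *\<^sub>R a"
    have zf: "z \<bullet> a = ?f - A\<^sup>2 * t" by (simp add: z_def height_def inner_diff_left aa mult.commute)
    have yz: "y = \<xi> + (z - ((z \<bullet> a) / A\<^sup>2) *\<^sub>R a)"
    proof -
      have "(?f / A\<^sup>2) = t + (z \<bullet> a) / A\<^sup>2" using A0 by (simp add: zf diff_divide_distrib)
      then show ?thesis by (simp add: y_def x_def z_def scaleR_add_left)
    qed
    let ?w = "z - ((z \<bullet> a) / A\<^sup>2) *\<^sub>R a"
    have "orthogonal ?w (((z \<bullet> a) / A\<^sup>2) *\<^sub>R a)"
      using A0 by (simp add: orthogonal_def inner_diff_left aa)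
    from norm_add_Pythagorean[OF this] have "(norm ?w)\<^sup>2 \<le> (norm z)\<^sup>2" by simp
    then have "norm ?w \<le> norm z" by (rule power2_le_imp_le) simp
    also have "\<dots> \<le> \<epsilon> / 10 * t" using \<gamma>_near[OF tT] by (simp add: z_def)
    finally have "norm (z - ((z \<bullet> a) / A\<^sup>2) *\<^sub>R a) \<le> \<epsilon> / 10 * t" .
    moreover have "norm \<xi> \<le> norm y + norm (z - ((z \<bullet> a) / A\<^sup>2) *\<^sub>R a)"
      using norm_triangle_ineq4[of y "z - ((z \<bullet> a) / A\<^sup>2) *\<^sub>R a"] yz by simp
    ultimately show ?thesis using \<xi>(1) by simp
  qed
  then have "(9 / 10 * (\<epsilon> * t))\<^sup>2 \<le> (norm y)\<^sup>2" using \<epsilon> t0 by (intro power_mono) auto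
  then have y2: "81 / 100 * (\<epsilon>\<^sup>2 * t\<^sup>2) \<le> (norm y)\<^sup>2" by (simp add: power_mult_distrib power_divide)
  have "(?f + 19 / 100 * (\<epsilon>\<^sup>2 * t))\<^sup>2 \<le> (A * norm x)\<^sup>2"
  proof -
    have "(?f + 19 / 100 * (\<epsilon>\<^sup>2 * t))\<^sup>2 = ?f\<^sup>2 + 38 / 100 * (\<epsilon>\<^sup>2 * t) * ?f + 361 / 10000 * (\<epsilon>\<^sup>2 * t\<^sup>2) * \<epsilon>\<^sup>2"
      by (simp add: power2_eq_square algebra_simps)
    also have "38 / 100 * (\<epsilon>\<^sup>2 * t) * ?f \<le> 38 / 100 * (\<epsilon>\<^sup>2 * t) * (21 / 20 * (A\<^sup>2 * t))"
      using f(1) t0 by (intro mult_left_mono) auto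
    also have "361 / 10000 * (\<epsilon>\<^sup>2 * t\<^sup>2) * \<epsilon>\<^sup>2 \<le> 361 / 10000 * (\<epsilon>\<^sup>2 * t\<^sup>2) * (A\<^sup>2 / 4)"
      using e2 by (intro mult_left_mono) auto
    also have "?f\<^sup>2 + 38 / 100 * (\<epsilon>\<^sup>2 * t) * (21 / 20 * (A\<^sup>2 * t)) + 361 / 10000 * (\<epsilon>\<^sup>2 * t\<^sup>2) * (A\<^sup>2 / 4) =
        ?f\<^sup>2 + (399 / 1000 + 361 / 40000) * (A\<^sup>2 * (\<epsilon>\<^sup>2 * t\<^sup>2))"
      by (simp add: power2_eq_square)
    also have "\<dots> \<le> ?f\<^sup>2 + 81 / 100 * (A\<^sup>2 * (\<epsilon>\<^sup>2 * t\<^sup>2))"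
      by (intro add_left_mono mult_right_mono) auto
    also have "\<dots> = ?f\<^sup>2 + A\<^sup>2 * (81 / 100 * (\<epsilon>\<^sup>2 * t\<^sup>2))" by simp
    also have "\<dots> \<le> ?f\<^sup>2 + A\<^sup>2 * (norm y)\<^sup>2" using y2 by (intro add_left_mono mult_left_mono) auto
    also have "\<dots> = (A * norm x)\<^sup>2" using pyth by (simp add: power_mult_distrib)
    finally show ?thesis by simp
  qed
  then have 1: "?f + 19 / 100 * (\<epsilon>\<^sup>2 * t) \<le> A * norm x"
    by (rule power2_le_imp_le) (simp add: A_def)
  \<comment> \<open>The derivative of the difference is \<open>p s \<bullet> (p s - a)\<close>, of
    order \<open>1 / s\<close>. Bounding it by its size at \<open>T1\<close> gives a linear
    estimate, which the third condition in \<open>T_large\<close> makes small enough.\<close>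
  have growth: "(\<sigma> t - height t) - (\<sigma> T1 - height T1) \<le> \<epsilon>\<^sup>2 * t / 20"
  proof -
    have "(\<sigma> t - height t) - (\<sigma> T1 - height T1) \<le> 2 * A * K / T1 * t - 2 * A * K / T1 * T1"
    proof (rule increment_le_of_derivative_le_real[OF t])
      fix s assume s: "s \<in> {T1..t}"
      then have sT: "s \<ge> T" using T1 by auto
      show "((\<lambda>t. \<sigma> t - height t) has_real_derivative (norm (p s))\<^sup>2 - p s \<bullet> a) (at s)"
        by (intro DERIV_diff \<sigma>_deriv height_deriv sT)
      show "((\<lambda>t. 2 * A * K / T1 * t) has_real_derivative 2 * A * K / T1) (at s)"
        by (rule DERIV_cmult_Id)
      have Ks: "K / s \<le> A / 32" using T_large'(1)[OF sT] by (simp add: A_def field_simps)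
      have "norm (p s) \<le> norm a + norm (p s - a)" using norm_triangle_sub by blast
      then have ps: "norm (p s) \<le> 2 * A" using p_near[OF sT] Ks A0 unfolding A_def by linarith
      have "(norm (p s))\<^sup>2 - p s \<bullet> a = p s \<bullet> (p s - a)" by (simp add: power2_norm_eq_inner inner_diff_right)
      also have "\<dots> \<le> norm (p s) * norm (p s - a)" by (rule norm_cauchy_schwarz)
      also have "\<dots> \<le> (2 * A) * (K / s)" using ps p_near[OF sT] A0 by (intro mult_mono) auto
      also have "\<dots> \<le> (2 * A) * (K / T1)"
        using s T1 K_pos A0 by (intro mult_left_mono divide_left_mono) auto
      finally show "(norm (p s))\<^sup>2 - p s \<bullet> a \<le> 2 * A * K / T1" by simp
    qed
    also have "\<dots> \<le> 2 * A * K / T1 * t" using A0 K_pos T1 by simp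
    also have "\<dots> \<le> \<epsilon>\<^sup>2 / 20 * t"
    proof (rule mult_right_mono)
      have "40 * A * K \<le> \<epsilon>\<^sup>2 * T" using T_large(3) \<epsilon>(1) by (simp add: A_def field_simps)
      also have "\<dots> \<le> \<epsilon>\<^sup>2 * T1" using T1 by (intro mult_left_mono) auto
      finally show "2 * A * K / T1 \<le> \<epsilon>\<^sup>2 / 20" using T1 by (simp add: field_simps)
    qed (use t0 in simp)
    finally show ?thesis by simp
  qed
  have q: "(\<xi> \<bullet> \<xi>) / (8 * t) = \<epsilon>\<^sup>2 * t / 8"
  proof -
    have "\<xi> \<bullet> \<xi> = (\<epsilon> * t)\<^sup>2" using \<xi>(1) by (metis power2_norm_eq_inner)
    then show ?thesis using t0 by (simp add: power2_eq_square)
  qed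
  have "p t \<bullet> \<xi> \<le> K * \<epsilon>" using velocity_perp[OF tT _ \<xi>(2)] \<xi>(1) by simp
  moreover have "0 < \<epsilon>\<^sup>2 * T1" using \<epsilon> T1 by simp
  moreover have "0 < \<epsilon>\<^sup>2 * t" using \<epsilon> t0 by simp
  ultimately show ?thesis
    using 1 growth q unfolding profile_def C0_def x_def A_def by linarith
qed

text \<open>Since |a||p| is at most (|a|^2 + |p|^2) / 2 and \<sigma> has derivative |p|^2, the
  difference between \<sigma> and |a||\<gamma>| grows at least by the integral of (|p|^2 - |a|^2) /
  2 = U. The lower bound k/t for U makes this integral at least k times the logarithm of
  t/T.\<close>

lemma calibration_start: "\<exists>t1>T1. \<forall>t\<ge>t1. \<sigma> t > norm a * norm (\<gamma> t) + C0"
proof -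
  define A where "A = norm a"
  have A0: "A > 0" using a_nonzero by (simp add: A_def)
  define D where "D t = \<sigma> t - A * norm (\<gamma> t)" for t
  have D: "D t \<ge> D T + k * (ln t - ln T)" if t: "t \<ge> T" for t
  proof -
    have "norm (\<gamma> t - \<gamma> T) \<le> (A\<^sup>2 * t + \<sigma> t) / (2 * A) - (A\<^sup>2 * T + \<sigma> T) / (2 * A)"
    proof (rule increment_le_of_derivative_le[OF t])
      fix s assume "s \<in> {T..t}"
      then have s: "s \<ge> T" by simp
      show "(\<gamma> has_vector_derivative p s) (at s)" by (rule \<gamma>_deriv[OF s])
      show "((\<lambda>t. (A\<^sup>2 * t + \<sigma> t) / (2 * A)) has_real_derivative (A\<^sup>2 + (norm (p s))\<^sup>2) / (2 * A)) (at s)"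
        by (intro DERIV_cdivide DERIV_add DERIV_cmult_Id \<sigma>_deriv s)
      have "2 * A * norm (p s) \<le> A\<^sup>2 + (norm (p s))\<^sup>2" by (rule sum_squares_bound)
      then show "norm (p s) \<le> (A\<^sup>2 + (norm (p s))\<^sup>2) / (2 * A)" using A0 by (simp add: field_simps)
    qed
    then have "norm (\<gamma> t) - norm (\<gamma> T) \<le> (A\<^sup>2 * (t - T) + (\<sigma> t - \<sigma> T)) / (2 * A)"
      using norm_triangle_ineq2[of "\<gamma> t" "\<gamma> T"] by (simp add: diff_divide_distrib add_divide_distrib right_diff_distrib)
    then have "A * (norm (\<gamma> t) - norm (\<gamma> T)) \<le> A * ((A\<^sup>2 * (t - T) + (\<sigma> t - \<sigma> T)) / (2 * A))"
      using A0 by (intro mult_left_mono) auto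
    then have 1: "A * norm (\<gamma> t) - A * norm (\<gamma> T) \<le> (A\<^sup>2 * (t - T) + (\<sigma> t - \<sigma> T)) / 2"
      using A0 by (simp add: right_diff_distrib)
    have "2 * k * ln t - 2 * k * ln T \<le> (\<sigma> t - A\<^sup>2 * t) - (\<sigma> T - A\<^sup>2 * T)"
    proof (rule increment_le_of_derivative_le_real[OF t])
      fix s assume "s \<in> {T..t}"
      then have s: "s \<ge> T" "s > 0" using T_pos by auto
      show "((\<lambda>t. 2 * k * ln t) has_real_derivative 2 * k / s) (at s)"
        using s by (auto intro!: derivative_eq_intros)
      show "((\<lambda>t. \<sigma> t - A\<^sup>2 * t) has_real_derivative (norm (p s))\<^sup>2 - A\<^sup>2) (at s)"
        by (intro DERIV_diff \<sigma>_deriv s DERIV_cmult_Id)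
      show "2 * k / s \<le> (norm (p s))\<^sup>2 - A\<^sup>2"
        using energy[OF s(1)] U_ge[OF s(2) cone_\<gamma>[OF s(1)]] by (simp add: A_def)
    qed
    then show ?thesis using 1 unfolding D_def by (simp add: algebra_simps)
  qed
  define t1 where "t1 = max (T1 + 1) (exp (ln T + (C0 - D T + 1) / k))"
  have "\<sigma> t > norm a * norm (\<gamma> t) + C0" if t: "t \<ge> t1" for t
  proof -
    have tT: "t \<ge> T" using t T1 by (simp add: t1_def)
    have "exp (ln T + (C0 - D T + 1) / k) \<le> t" using t by (simp add: t1_def)
    then have "ln T + (C0 - D T + 1) / k \<le> ln t" using tT T_pos by (simp add: ln_ge_iff)
    then have "k * ((C0 - D T + 1) / k) \<le> k * (ln t - ln T)" using k_pos by (intro mult_left_mono) auto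
    then have "C0 - D T + 1 \<le> k * (ln t - ln T)" using k_pos by simp
    then show ?thesis using D[OF tT] unfolding D_def A_def by linarith
  qed
  moreover have "t1 > T1" by (simp add: t1_def)
  ultimately show ?thesis by blast
qed

definition W :: "'v set" where
  "W = {x. x \<bullet> a > height T1 \<and> norm (offset x) < \<epsilon> * param x}"

lemma height_mono: "T \<le> s \<Longrightarrow> s < t \<Longrightarrow> height s < height t"
proof -
  assume "T \<le> s" "s < t"
  moreover have "0 < (norm a)\<^sup>2 / 2 * (t - s)" using a_nonzero \<open>s < t\<close> by simp
  ultimately show ?thesis using height_increment[of s t] by linarith
qed

lemma param_ge_T1: assumes "x \<bullet> a \<ge> height T1" shows "param x \<ge> T1"
proof (rule ccontr)
  assume "\<not> param x \<ge> T1"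
  have hx: "x \<bullet> a \<ge> height T" using assms height_mono[OF order_refl T1(1)] by simp
  have "height (param x) < height T1" using height_mono[OF param(1)[OF hx]] \<open>\<not> param x \<ge> T1\<close> by simp
  then show False using param(2)[OF hx] assms by simp
qed

lemma continuous_on_param: "continuous_on {x. x \<bullet> a \<ge> height T} param"
  unfolding param_def by (rule continuous_on_compose2[OF \<theta>_continuous]) (auto intro!: continuous_intros)

lemma \<gamma>_continuous: "continuous_on {T..} \<gamma>" "continuous_on {T..} p" "continuous_on {T..} \<sigma>"
proof -
  show "continuous_on {T..} \<gamma>"
    using has_vector_derivative_continuous[OF \<gamma>_deriv] by (intro continuous_at_imp_continuous_on) auto
  show "continuous_on {T..} p"
    using has_vector_derivative_continuous[OF p_deriv] by (intro continuous_at_imp_continuous_on) auto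
  show "continuous_on {T..} \<sigma>"
    using DERIV_isCont[OF \<sigma>_deriv] by (intro continuous_at_imp_continuous_on) auto
qed

lemma continuous_on_offset: "continuous_on {x. x \<bullet> a \<ge> height T} offset"
  unfolding offset_def
  by (intro continuous_intros continuous_on_compose2[OF \<gamma>_continuous(1) continuous_on_param]) (auto simp: param)

lemma continuous_on_S: "continuous_on {x. x \<bullet> a \<ge> height T} S"
  unfolding S_def profile_def
  using T_pos param(1)
  by (intro continuous_intros continuous_on_offset continuous_on_param
        continuous_on_compose2[OF \<gamma>_continuous(2) continuous_on_param]
        continuous_on_compose2[OF \<gamma>_continuous(3) continuous_on_param]) force+

lemma open_W: "open W"
proof -
  let ?H = "{x. x \<bullet> a > height T}"
  have o: "open ?H" by (rule open_Collect_less) (auto intro!: continuous_intros)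
  have c: "continuous_on ?H (\<lambda>x. norm (offset x) - \<epsilon> * param x)"
    by (intro continuous_intros continuous_on_subset[OF continuous_on_offset] continuous_on_subset[OF continuous_on_param]) auto
  have "open (?H \<inter> (\<lambda>x. norm (offset x) - \<epsilon> * param x) -` {..<0})"
    by (rule continuous_open_preimage[OF c o]) simp
  moreover have "open {x. x \<bullet> a > height T1}" by (rule open_Collect_less) (auto intro!: continuous_intros)
  moreover have "W = (?H \<inter> (\<lambda>x. norm (offset x) - \<epsilon> * param x) -` {..<0}) \<inter> {x. x \<bullet> a > height T1}"
    using height_mono[OF order_refl T1(1)] by (auto simp: W_def)
  ultimately show ?thesis by (simp add: open_Int)
qed

lemma W_D:
  assumes "x \<in> W"
  shows "x \<bullet> a > height T" "param x \<ge> T" "norm (offset x) \<le> \<epsilon> * param x" "offset x \<bullet> a = 0" "x = \<gamma> (param x) + offset x"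
proof -
  show h: "x \<bullet> a > height T" using assms height_mono[OF order_refl T1(1)] by (simp add: W_def)
  show "norm (offset x) \<le> \<epsilon> * param x" using assms by (simp add: W_def)
  show "param x \<ge> T" "offset x \<bullet> a = 0" "x = \<gamma> (param x) + offset x" using param[of x] h by simp_all
qed

text \<open>The second bound is uniform on \<open>W\<close> and serves as a local Lipschitz constant
  of \<open>S\<close>.\<close>

lemma gradS_le:
  assumes "x \<in> W"
  shows "(norm (gradS (param x) (offset x)))\<^sup>2 \<le> (norm a)\<^sup>2 + 2 * U x"
    "norm (gradS (param x) (offset x)) \<le> sqrt ((norm a)\<^sup>2 + 2 * (K / T))"
proof -
  note w = W_D[OF assms]
  show 1: "(norm (gradS (param x) (offset x)))\<^sup>2 \<le> (norm a)\<^sup>2 + 2 * U x"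
    using eikonal[OF w(2-4)] w(5) by simp
  have "U x \<le> K / param x"
    using U_le[OF _ cone_near(1)[OF w(2,3)]] w(2,5) T_pos by simp
  also have "\<dots> \<le> K / T" using w(2) T_pos K_pos by (intro divide_left_mono) auto
  finally show "norm (gradS (param x) (offset x)) \<le> sqrt ((norm a)\<^sup>2 + 2 * (K / T))"
    using 1 by (intro real_le_rsqrt) simp
qed

end

text \<open>Meant for the norm along a curve, which is not covered by the chain rule where the curve
  passes through 0.\<close>

lemma vector_derivative_le_of_dominated:
  fixes g :: "real \<Rightarrow> real" and c :: "real \<Rightarrow> 'v::real_normed_vector"
  assumes c: "(c has_vector_derivative v) (at t)" and g: "(g has_vector_derivative d) (at t)"
    and L: "L \<ge> 0" and le: "\<And>r. \<bar>g r - g t\<bar> \<le> L * norm (c r - c t)"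
  shows "\<bar>d\<bar> \<le> L * norm v"
proof (rule field_le_epsilon)
  fix e :: real assume e: "e > 0"
  define e' where "e' = e / (L + 1)"
  have e': "e' > 0" using e L by (simp add: e'_def)
  obtain d1 where d1: "d1 > 0" "\<And>r. norm (r - t) < d1 \<Longrightarrow> norm (c r - c t - (r - t) *\<^sub>R v) \<le> e' * norm (r - t)"
    using c e' unfolding has_vector_derivative_def has_derivative_at_alt by blast
  obtain d2 where d2: "d2 > 0" "\<And>r. norm (r - t) < d2 \<Longrightarrow> norm (g r - g t - (r - t) *\<^sub>R d) \<le> e' * norm (r - t)"
    using g e' unfolding has_vector_derivative_def has_derivative_at_alt by blast
  define h where "h = min d1 d2 / 2"
  have h: "h > 0" "h < d1" "h < d2" using d1 d2 by (auto simp: h_def)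
  have 1: "norm (c (t + h) - c t - h *\<^sub>R v) \<le> e' * h" using d1(2)[of "t + h"] h by simp
  have 2: "\<bar>g (t + h) - g t - h * d\<bar> \<le> e' * h" using d2(2)[of "t + h"] h by simp
  have "norm (c (t + h) - c t) \<le> norm (h *\<^sub>R v) + e' * h"
    using norm_triangle_sub[of "c (t + h) - c t" "h *\<^sub>R v"] 1 by simp
  then have "L * norm (c (t + h) - c t) \<le> L * (h * norm v + e' * h)" using L h by (intro mult_left_mono) auto
  moreover have "\<bar>h * d\<bar> \<le> \<bar>g (t + h) - g t\<bar> + e' * h" using 2 by linarith
  ultimately have "\<bar>h * d\<bar> \<le> L * (h * norm v + e' * h) + e' * h" using le[of "t + h"] by linarith
  also have "\<dots> = h * (L * norm v + (L + 1) * e')" by (simp add: algebra_simps)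
  also have "(L + 1) * e' = e" using L by (simp add: e'_def)
  finally have "h * \<bar>d\<bar> \<le> h * (L * norm v + e)" using h by (simp add: abs_mult)
  then show "\<bar>d\<bar> \<le> L * norm v + e" using h by simp
qed

text \<open>A certificate for a lower bound of the action of \<open>c\<close> on
  \<open>{r0..r1}\<close>, stated with derivatives only. It is produced in Euclidean coordinates and
  handed to \<open>action_ge\<close> after the change to the mass norm.\<close>

definition subaction :: "('v::real_normed_vector \<Rightarrow> real) \<Rightarrow> real \<Rightarrow> (real \<Rightarrow> 'v) \<Rightarrow> real \<Rightarrow> real \<Rightarrow> (real \<Rightarrow> real) \<Rightarrow> bool" where
  "subaction U h c r0 r1 g \<longleftrightarrow> absolutely_continuous_curve r0 r1 g \<and>
    (\<forall>r v d. r \<in> {r0<..<r1} \<longrightarrow> (c has_vector_derivative v) (at r) \<longrightarrow> (g has_vector_derivative d) (at r) \<longrightarrow>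
       d \<le> (norm v)\<^sup>2 / 2 + U (c r) + h)"

context calibrated_solution
begin

text \<open>\<open>W\<close> need not be convex, so the gradient bound gives Lipschitz estimates
  only on small balls around the compact image of the curve; at small time scales these
  suffice.\<close>

lemma S_along_curve_absolutely_continuous:
  assumes c: "absolutely_continuous_curve u v c" and W: "\<And>r. r \<in> {u..v} \<Longrightarrow> c r \<in> W"
  shows "absolutely_continuous_curve u v (\<lambda>r. S (c r))"
proof -
  have "compact (c ` {u..v})"
    using absolutely_continuous_curve_continuous[OF c] by (rule compact_continuous_image) simp
  moreover have "c ` {u..v} \<subseteq> W" using W by blast
  ultimately obtain e where e: "e > 0" "(\<Union>x\<in>c ` {u..v}. cball x e) \<subseteq> W"
    using compact_subset_open_imp_cball_epsilon_subset[OF _ open_W] by metis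
  obtain \<eta> where \<eta>: "\<eta> > 0" "\<And>x y. u \<le> x \<Longrightarrow> x \<le> y \<Longrightarrow> y \<le> v \<Longrightarrow> y - x < \<eta> \<Longrightarrow> norm (c y - c x) < e"
    by (rule absolutely_continuous_curve_pair[OF c e(1)]) blast
  define L where "L = sqrt ((norm a)\<^sup>2 + 2 * (K / T))"
  show ?thesis
  proof (rule absolutely_continuous_curve_lipschitz_compose[OF c \<eta>(1)])
    fix x y assume xy: "u \<le> x" "x \<le> y" "y \<le> v" "y - x < \<eta>"
    have "x \<in> {u..v}" using xy by simp
    then have sub: "cball (c x) e \<subseteq> W" using e(2) by blast
    show "norm (S (c y) - S (c x)) \<le> L * norm (c y - c x)"
    proof (rule differentiable_bound[of "cball (c x) e" S "\<lambda>z v. gradS (param z) (offset z) \<bullet> v"])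
      fix z assume "z \<in> cball (c x) e"
      then have z: "z \<in> W" using sub by blast
      show "(S has_derivative (\<lambda>v. gradS (param z) (offset z) \<bullet> v)) (at z within cball (c x) e)"
        by (rule has_derivative_at_withinI[OF S_has_derivative[OF W_D(1)[OF z]]])
      show "onorm (\<lambda>v. gradS (param z) (offset z) \<bullet> v) \<le> L"
      proof (rule onorm_le)
        fix v
        have "norm (gradS (param z) (offset z) \<bullet> v) \<le> norm (gradS (param z) (offset z)) * norm v"
          by (simp add: Cauchy_Schwarz_ineq2)
        also have "\<dots> \<le> L * norm v" unfolding L_def by (intro mult_right_mono gradS_le(2)[OF z]) simp
        finally show "norm (gradS (param z) (offset z) \<bullet> v) \<le> L * norm v" .
      qed
    next
      show "c y \<in> cball (c x) e" using \<eta>(2)[OF xy] by (simp add: dist_norm norm_minus_commute)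
    qed (use e(1) in auto)
  qed
qed

lemma S_along_curve_derivative:
  assumes W: "c r \<in> W" and c: "(c has_vector_derivative v) (at r)"
    and d: "((\<lambda>r. S (c r)) has_vector_derivative d) (at r)"
  shows "d \<le> (norm v)\<^sup>2 / 2 + U (c r) + (norm a)\<^sup>2 / 2"
proof -
  let ?N = "gradS (param (c r)) (offset (c r))"
  have "((\<lambda>r. S (c r)) has_vector_derivative (?N \<bullet> v)) (at r)"
    by (rule has_vector_derivative_gradient_compose[OF c S_has_derivative[OF W_D(1)[OF W]]])
  with d have "d = ?N \<bullet> v" by (rule vector_derivative_unique_at)
  also have "\<dots> \<le> norm ?N * norm v" by (rule norm_cauchy_schwarz)
  also have "\<dots> \<le> ((norm ?N)\<^sup>2 + (norm v)\<^sup>2) / 2" using sum_squares_bound[of "norm ?N" "norm v"] by simp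
  also have "\<dots> \<le> (norm v)\<^sup>2 / 2 + U (c r) + (norm a)\<^sup>2 / 2" using gradS_le(1)[OF W] by (simp add: add_divide_distrib)
  finally show ?thesis .
qed

lemma \<gamma>_in_W: "t > T1 \<Longrightarrow> \<gamma> t \<in> W"
  using height_mono[of T1 t] T1 param_\<gamma>[of t] \<epsilon> by (simp add: W_def height_def[symmetric])

text \<open>The last time \<open>u\<close> at which the curve fails to be in the region where \<open>S\<close> exceeds the
  spherical wave: before \<open>u\<close> compare with the spherical wave, after \<open>u\<close> with \<open>S\<close>.\<close>

lemma calibration:
  assumes t1: "t1 > T1" "\<And>t. t \<ge> t1 \<Longrightarrow> \<sigma> t > norm a * norm (\<gamma> t) + C0"
    and st: "s \<ge> t1" "t \<ge> t1"
    and c: "absolutely_continuous_curve s0 s1 c" and s01: "s0 \<le> s1" and ends: "c s0 = \<gamma> s" "c s1 = \<gamma> t"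
  shows "\<exists>u g1 g2. s0 \<le> u \<and> u \<le> s1 \<and> \<sigma> t - \<sigma> s \<le> (g1 u - g1 s0) + (g2 s1 - g2 u) \<and>
    subaction U ((norm a)\<^sup>2 / 2) c s0 u g1 \<and> subaction U ((norm a)\<^sup>2 / 2) c u s1 g2"
proof -
  let ?P = "\<lambda>x. norm a * norm x + C0"
  define good where "good = {x \<in> W. ?P x < S x}"
  have HW: "W \<subseteq> {x. x \<bullet> a \<ge> height T}" using W_D(1) by force
  have og: "open good"
  proof -
    have "continuous_on W (\<lambda>x. S x - ?P x)"
      by (intro continuous_intros continuous_on_subset[OF continuous_on_S HW])
    then have "open (W \<inter> (\<lambda>x. S x - ?P x) -` {0<..})" by (rule continuous_open_preimage[OF _ open_W]) simp
    moreover have "good = W \<inter> (\<lambda>x. S x - ?P x) -` {0<..}" by (auto simp: good_def)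
    ultimately show ?thesis by simp
  qed
  have \<gamma>good: "\<gamma> r \<in> good" if "r \<ge> t1" for r
    using t1(2)[OF that] \<gamma>_in_W[of r] param_\<gamma>(3)[of r] that t1(1) T1 by (simp add: good_def)
  have S\<gamma>: "S (\<gamma> s) = \<sigma> s" "S (\<gamma> t) = \<sigma> t" using param_\<gamma>(3) st t1(1) T1 by simp_all
  have cc: "continuous_on {s0..s1} c" by (rule absolutely_continuous_curve_continuous[OF c])
  define bad where "bad = {s0..s1} \<inter> c -` (- good)"
  have Sder: "d \<le> (norm v)\<^sup>2 / 2 + U (c r) + (norm a)\<^sup>2 / 2"
    if "c r \<in> W" "(c has_vector_derivative v) (at r)" "((\<lambda>r. S (c r)) has_vector_derivative d) (at r)" for r v d
    using S_along_curve_derivative[OF that] .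
  show ?thesis
  proof (cases "bad = {}")
    case True
    then have W: "c r \<in> W" if "r \<in> {s0..s1}" for r using that by (auto simp: bad_def good_def)
    have "absolutely_continuous_curve s0 s0 (\<lambda>_. 0::real)"
      by (rule absolutely_continuous_curve_lipschitz[where L = 0]) simp
    moreover have "absolutely_continuous_curve s0 s1 (\<lambda>r. S (c r))"
      by (rule S_along_curve_absolutely_continuous[OF c W])
    ultimately show ?thesis using s01 ends S\<gamma> Sder W unfolding subaction_def
      by (intro exI[of _ s0] exI[of _ "\<lambda>_. 0"] exI[of _ "\<lambda>r. S (c r)"]) auto
  next
    case False
    have "closed bad"
      unfolding bad_def using og by (intro continuous_closed_preimage[OF cc]) auto
    moreover have "bdd_above bad" unfolding bad_def by (intro bdd_above_Int1) simp
    ultimately have ub: "Sup bad \<in> bad" using closed_contains_Sup[OF False] by blast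
    define u where "u = Sup bad"
    have u: "u \<in> {s0..s1}" "c u \<notin> good" using ub by (auto simp: bad_def u_def)
    have "c s1 \<in> good" using \<gamma>good[OF st(2)] ends by simp
    then have us: "u < s1" using u by (cases "u = s1") auto
    have good: "c r \<in> good" if "r \<in> {u<..s1}" for r
    proof (rule ccontr)
      assume "c r \<notin> good"
      then have "r \<in> bad" using that u by (auto simp: bad_def)
      then have "r \<le> u" unfolding u_def using \<open>bdd_above bad\<close> by (rule cSup_upper)
      then show False using that by simp
    qed
    let ?H = "{x. x \<bullet> a \<ge> height T1}"
    have HH: "?H \<subseteq> {x. x \<bullet> a \<ge> height T}" using height_mono[OF order_refl T1(1)] by auto
    have cH: "closed ?H" by (rule closed_Collect_le) (auto intro!: continuous_intros)
    \<comment> \<open>The weak form of the conditions defining \<open>good\<close>. As a limit of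
      good points \<open>c u\<close> satisfies them, though at this stage it could still lie on the
      boundary of \<open>W\<close>.\<close>
    define F where "F = (?H \<inter> (\<lambda>x. norm (offset x) - \<epsilon> * param x) -` {..0}) \<inter> (?H \<inter> (\<lambda>x. S x - ?P x) -` {0..})"
    have "closed F"
      unfolding F_def
      by (intro closed_Int continuous_closed_preimage[OF _ cH] continuous_on_diff continuous_on_norm continuous_on_mult
        continuous_on_add continuous_on_const continuous_on_id
        continuous_on_subset[OF continuous_on_offset HH] continuous_on_subset[OF continuous_on_param HH]
        continuous_on_subset[OF continuous_on_S HH] closed_atMost closed_atLeast)
    then have cF: "closed ({u..s1} \<inter> c -` F)"
      using u by (intro continuous_closed_preimage[OF continuous_on_subset[OF cc]]) auto
    have "{u<..s1} \<subseteq> {u..s1} \<inter> c -` F"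
      using good by (force simp: F_def good_def W_def)
    then have "closure {u<..s1} \<subseteq> {u..s1} \<inter> c -` F" using cF by (rule closure_minimal)
    moreover have "u \<in> closure {u<..s1}" using us by simp
    ultimately have uF: "c u \<in> F" by blast
    define x where "x = c u"
    have x: "x \<bullet> a \<ge> height T1" "norm (offset x) \<le> \<epsilon> * param x" "S x \<ge> ?P x" using uF by (auto simp: F_def x_def)
    have xT: "x \<bullet> a \<ge> height T" using x(1) HH by auto
    note px = param[OF xT]
    have Sx: "S x = profile (param x) (offset x)" by (simp add: S_def)
    have xW: "x \<in> W"
    proof -
      \<comment> \<open>The strict boundary inequalities exclude the bottom and the lateral
        boundary. So \<open>c u\<close> lies in \<open>W\<close> and can fail to be good only
        because \<open>S\<close> does not exceed the spherical wave there.\<close>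
      have "x \<bullet> a \<noteq> height T1"
      proof
        assume "x \<bullet> a = height T1"
        then have "param x = T1" using \<theta>_height[of T1] T1 by (simp add: param_def)
        then have "S x < ?P x" using bottom_boundary[of "offset x"] x(2) px(3,4) unfolding Sx by simp
        then show False using x(3) by simp
      qed
      moreover have "norm (offset x) \<noteq> \<epsilon> * param x"
      proof
        assume "norm (offset x) = \<epsilon> * param x"
        then have "S x < ?P x"
          using lateral_boundary[OF param_ge_T1[OF x(1)] _ px(3)] px(4) unfolding Sx by simp
        then show False using x(3) by simp
      qed
      ultimately show ?thesis using x by (simp add: W_def)
    qed
    then have SP: "S x \<le> ?P x" using u(2) by (auto simp: good_def x_def)
    have W: "c r \<in> W" if "r \<in> {u..s1}" for r
      using that xW good[of r] by (cases "r = u") (auto simp: x_def good_def)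
    have ac1: "absolutely_continuous_curve s0 u c" and ac2: "absolutely_continuous_curve u s1 c"
      using c u by (auto intro: absolutely_continuous_curve_subinterval)
    let ?g = "\<lambda>r. norm a * norm (c r)"
    have lip: "\<bar>?g r - ?g q\<bar> \<le> norm a * norm (c r - c q)" for r q
    proof -
      have "\<bar>?g r - ?g q\<bar> = norm a * \<bar>norm (c r) - norm (c q)\<bar>"
        unfolding right_diff_distrib[symmetric] by (simp add: abs_mult)
      also have "\<dots> \<le> norm a * norm (c r - c q)" by (intro mult_left_mono norm_triangle_ineq3) simp
      finally show ?thesis .
    qed
    have g1: "absolutely_continuous_curve s0 u ?g"
      by (rule absolutely_continuous_curve_lipschitz_compose[OF ac1 zero_less_one, where L = "norm a"]) (use lip in simp)
    have g2: "absolutely_continuous_curve u s1 (\<lambda>r. S (c r))"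
      by (rule S_along_curve_absolutely_continuous[OF ac2 W])
    have der1: "d \<le> (norm v)\<^sup>2 / 2 + U (c r) + (norm a)\<^sup>2 / 2"
      if "(c has_vector_derivative v) (at r)" "(?g has_vector_derivative d) (at r)" for r v d
    proof -
      have "\<bar>d\<bar> \<le> norm a * norm v" by (rule vector_derivative_le_of_dominated[OF that _ lip]) simp
      also have "\<dots> \<le> ((norm a)\<^sup>2 + (norm v)\<^sup>2) / 2" using sum_squares_bound[of "norm a" "norm v"] by simp
      finally show ?thesis using U_nonneg[of "c r"] by (simp add: add_divide_distrib)
    qed
    \<comment> \<open>Both comparisons go the right way: at the switch \<open>S\<close> is at most
      \<open>?P\<close>, and at the start \<open>\<sigma> s\<close> exceeds \<open>?P\<close>. The
      constant \<open>C0\<close> drops out.\<close>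
    have "\<sigma> t - \<sigma> s \<le> (?g u - ?g s0) + (S (c s1) - S (c u))"
      using SP t1(2)[OF st(1)] S\<gamma> ends by (simp add: x_def)
    then show ?thesis using u g1 g2 der1 Sder W unfolding subaction_def
      by (intro exI[of _ u] exI[of _ ?g] exI[of _ "\<lambda>r. S (c r)"]) auto
  qed
qed

end

theorem (in escaping_solution) eventually_calibrated:
  "\<exists>t1 \<sigma>. t1 \<ge> T0 \<and> (\<forall>t\<ge>t1. (\<sigma> has_real_derivative (norm (p t))\<^sup>2) (at t)) \<and>
    (\<forall>s0 s1 c s t. s \<ge> t1 \<longrightarrow> t \<ge> t1 \<longrightarrow> s0 \<le> s1 \<longrightarrow> absolutely_continuous_curve s0 s1 c \<longrightarrow>
      c s0 = \<gamma> s \<longrightarrow> c s1 = \<gamma> t \<longrightarrow>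
      (\<exists>u g1 g2. s0 \<le> u \<and> u \<le> s1 \<and> \<sigma> t - \<sigma> s \<le> (g1 u - g1 s0) + (g2 s1 - g2 u) \<and>
        subaction U ((norm a)\<^sup>2 / 2) c s0 u g1 \<and> subaction U ((norm a)\<^sup>2 / 2) c u s1 g2))"
proof -
  define \<epsilon> where "\<epsilon> = min (\<epsilon>0 / 2) (norm a / 2)"
  have \<epsilon>: "\<epsilon> > 0" "\<epsilon> \<le> \<epsilon>0 / 2" "\<epsilon> \<le> norm a / 2" using \<epsilon>0_pos a_nonzero by (auto simp: \<epsilon>_def)
  have "\<epsilon> / 10 > 0" using \<epsilon> by simp
  from eventually_conj[OF velocity_limit eventually_conj[OF energy_eventually asymptotic[OF this]]]
  obtain T2 where T2: "\<And>t. t \<ge> T2 \<Longrightarrow> norm (p t - a) \<le> K / t \<and> (norm (p t))\<^sup>2 = (norm a)\<^sup>2 + 2 * U (\<gamma> t) \<and>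
      norm (\<gamma> t - t *\<^sub>R a) \<le> \<epsilon> / 10 * t"
    unfolding eventually_at_top_linorder by blast
  define T where "T = max (max (T0 + 1) T2) (max (32 * K / norm a) (max (16 * K) (40 * norm a * K / \<epsilon>\<^sup>2)))"
  have T: "T \<ge> T0 + 1" "T \<ge> T2" "T \<ge> 32 * K / norm a" "T \<ge> 16 * K" "T \<ge> 40 * norm a * K / \<epsilon>\<^sup>2"
    by (auto simp: T_def)
  have Tpos: "T > 0" using T(1) T0_pos by simp
  \<comment> \<open>Integration starts at \<open>T0\<close>, at least one unit before
    \<open>T\<close>, so that the derivative is two-sided from \<open>T\<close> on.\<close>
  define \<sigma> where "\<sigma> t = integral {T0..t} (\<lambda>s. (norm (p s))\<^sup>2)" for t
  have \<sigma>: "(\<sigma> has_real_derivative (norm (p t))\<^sup>2) (at t)" if t: "t \<ge> T" for t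
  proof -
    have "continuous_on {T0..t + 1} (\<lambda>s. (norm (p s))\<^sup>2)"
      using has_vector_derivative_continuous[OF p_deriv]
      by (intro continuous_intros continuous_at_imp_continuous_on) auto
    then have "(\<sigma> has_vector_derivative (norm (p t))\<^sup>2) (at t within {T0..t + 1})"
      unfolding \<sigma>_def using t T by (intro integral_has_vector_derivative) auto
    moreover have "at t within {T0..t + 1} = at t" using t T by (intro at_within_Icc_at) auto
    ultimately show ?thesis by (simp add: has_real_derivative_iff_has_vector_derivative)
  qed
  interpret C: calibrated_solution U G a \<epsilon>0 K k \<gamma> p \<sigma> T \<epsilon>
  proof
    show "2 * K / T \<le> norm a / 16" using T(3) Tpos a_nonzero by (simp add: field_simps)
    show "2 * K / T \<le> 1 / 8" using T(4) Tpos by (simp add: field_simps)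
  qed (use T Tpos \<epsilon> T2 \<sigma> \<gamma>_deriv p_deriv in auto)
  obtain t1 where t1: "t1 > C.T1" "\<And>t. t \<ge> t1 \<Longrightarrow> \<sigma> t > norm a * norm (\<gamma> t) + C.C0"
    using C.calibration_start by blast
  have tT: "t1 \<ge> T" using t1(1) C.T1 by simp
  show ?thesis
  proof (rule exI[of _ t1], rule exI[of _ \<sigma>], intro conjI allI impI)
    show "T0 \<le> t1" using tT T by simp
    show "(\<sigma> has_real_derivative (norm (p t))\<^sup>2) (at t)" if "t1 \<le> t" for t using \<sigma> that tT by simp
  qed (rule C.calibration[OF t1], assumption+)
qed

section \<open>The Newtonian potential\<close>

text \<open>Expressing the inner product through s = |r + \<eta>| gives the exact remainder (s -
  \<rho>)^2 (s + 2\<rho>) / (2 s \<rho>^3) - n^2 / (2 \<rho>^3), with \<rho> = |r| and n = |\<eta>|.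
  As |s - \<rho>| is at most n and s at least \<rho>/2, it lies between -1/2 and 5/2 times
  n^2/\<rho>^3.\<close>

lemma inverse_norm_expansion:
  fixes r \<eta> :: "'e::real_inner"
  assumes r: "r \<noteq> 0" and \<eta>: "norm \<eta> \<le> norm r / 2"
  shows "\<bar>1 / norm (r + \<eta>) - 1 / norm r + (r \<bullet> \<eta>) / norm r ^ 3\<bar> \<le> 3 * (norm \<eta>)\<^sup>2 / norm r ^ 3"
proof -
  define \<rho> where "\<rho> = norm r"
  define n where "n = norm \<eta>"
  define s where "s = norm (r + \<eta>)"
  have \<rho>: "\<rho> > 0" using r by (simp add: \<rho>_def)
  have sn: "\<bar>s - \<rho>\<bar> \<le> n" using norm_triangle_ineq3[of "r + \<eta>" r] by (simp add: s_def \<rho>_def n_def)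
  have s: "s \<ge> \<rho> / 2" using sn \<eta> unfolding \<rho>_def[symmetric] n_def[symmetric] by linarith
  then have s0: "s > 0" using \<rho> by linarith
  have "s\<^sup>2 = \<rho>\<^sup>2 + 2 * (r \<bullet> \<eta>) + n\<^sup>2"
    unfolding s_def \<rho>_def n_def power2_norm_eq_inner
    by (simp add: inner_add_left inner_add_right inner_commute[of \<eta> r])
  then have re: "r \<bullet> \<eta> = (s\<^sup>2 - \<rho>\<^sup>2 - n\<^sup>2) / 2" by simp
  have "1 / s - 1 / \<rho> + (r \<bullet> \<eta>) / \<rho> ^ 3 = (s - \<rho>)\<^sup>2 * (s + 2 * \<rho>) / (2 * s * \<rho> ^ 3) - n\<^sup>2 / (2 * \<rho> ^ 3)"
    unfolding re using s0 \<rho> by (simp add: field_simps power2_eq_square power3_eq_cube)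
  moreover have "(s - \<rho>)\<^sup>2 * (s + 2 * \<rho>) / (2 * s * \<rho> ^ 3) \<le> 5 / 2 * (n\<^sup>2 / \<rho> ^ 3)"
  proof -
    have "(s - \<rho>)\<^sup>2 \<le> n\<^sup>2" using sn by (metis abs_ge_zero power2_abs power_mono)
    moreover have "(s + 2 * \<rho>) / (2 * s) \<le> 5 / 2" using s s0 by (simp add: field_simps)
    ultimately have "(s - \<rho>)\<^sup>2 * ((s + 2 * \<rho>) / (2 * s)) \<le> n\<^sup>2 * (5 / 2)"
      using s0 \<rho> by (intro mult_mono) auto
    then have "(s - \<rho>)\<^sup>2 * ((s + 2 * \<rho>) / (2 * s)) / \<rho> ^ 3 \<le> n\<^sup>2 * (5 / 2) / \<rho> ^ 3"
      using \<rho> by (intro divide_right_mono) auto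
    then show ?thesis by (simp add: mult.commute)
  qed
  moreover have "0 \<le> (s - \<rho>)\<^sup>2 * (s + 2 * \<rho>) / (2 * s * \<rho> ^ 3)" using s0 \<rho> by simp
  moreover have "n\<^sup>2 / (2 * \<rho> ^ 3) = (n\<^sup>2 / \<rho> ^ 3) / 2" by simp
  moreover have "0 \<le> n\<^sup>2 / \<rho> ^ 3" using \<rho> by simp
  moreover have "3 * n\<^sup>2 / \<rho> ^ 3 = 3 * (n\<^sup>2 / \<rho> ^ 3)" by simp
  ultimately have "\<bar>1 / s - 1 / \<rho> + (r \<bullet> \<eta>) / \<rho> ^ 3\<bar> \<le> 3 * n\<^sup>2 / \<rho> ^ 3" by linarith
  then show ?thesis by (simp only: s_def \<rho>_def n_def)
qed

text \<open>Linear maps \<open>L e\<close> in place of coordinate differences, because in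
  mass-scaled coordinates the difference of two bodies is a weighted one.\<close>

definition newton_potential :: "'i set \<Rightarrow> ('i \<Rightarrow> real) \<Rightarrow> ('i \<Rightarrow> 'v::euclidean_space \<Rightarrow> 'e::euclidean_space) \<Rightarrow> 'v \<Rightarrow> real" where
  "newton_potential E w L y = (\<Sum>e\<in>E. w e / norm (L e y))"

definition newton_gradient :: "'i set \<Rightarrow> ('i \<Rightarrow> real) \<Rightarrow> ('i \<Rightarrow> 'v::euclidean_space \<Rightarrow> 'e::euclidean_space) \<Rightarrow> 'v \<Rightarrow> 'v" where
  "newton_gradient E w L y =
    (\<Sum>e\<in>E. (- w e / norm (L e y) ^ 3) *\<^sub>R adjoint (L e) (L e y))"

text \<open>The opening is such that \<open>L e\<close> varies by at most \<rho>\<tau>/4 in the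
  cone, while the norm of \<open>L e\<close> at \<open>\<tau> *\<^sub>R a\<close> is at least
  \<rho>\<tau>. Hence \<open>norm (L e x)\<close> is at least 3/4 of \<rho>\<tau>, and a further
  displacement \<xi> changes \<open>L e x\<close> by at most half its norm, as the expansion of the
  inverse norm requires. \<open>K1\<close>, \<open>K2\<close>, \<open>K3\<close> serve the bounds on
  value, gradient and remainder.\<close>

lemma newton_potential_conical:
  fixes L :: "'i \<Rightarrow> 'v::euclidean_space \<Rightarrow> 'e::euclidean_space"
  assumes E: "finite E" "E \<noteq> {}" and w: "\<And>e. e \<in> E \<Longrightarrow> w e > 0"
    and L: "\<And>e. e \<in> E \<Longrightarrow> linear (L e)" and a: "\<And>e. e \<in> E \<Longrightarrow> L e a \<noteq> 0"
  shows "\<exists>\<epsilon>0 K k. conical_potential (newton_potential E w L) (newton_gradient E w L) a \<epsilon>0 K k \<and>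
    (\<forall>\<tau>>0. \<forall>x. norm (x - \<tau> *\<^sub>R a) \<le> \<epsilon>0 * \<tau> \<longrightarrow> (\<forall>e\<in>E. L e x \<noteq> 0))"
proof -
  have a0: "a \<noteq> 0" using E(2) a L by (metis linear_0 ex_in_conv)
  have "\<exists>B>0. \<forall>v. norm (L e v) \<le> B * norm v" if "e \<in> E" for e
    using linear_bounded_pos[OF L[OF that]] by blast
  then obtain b where b: "\<And>e. e \<in> E \<Longrightarrow> b e > 0" "\<And>e v. e \<in> E \<Longrightarrow> norm (L e v) \<le> b e * norm v" by metis
  define B where "B = Max (b ` E)"
  have B0: "B > 0" using E b(1) by (auto simp: B_def Max_gr_iff)
  have B: "norm (L e v) \<le> B * norm v" if "e \<in> E" for e v
  proof -
    have "b e \<le> B" using E that by (simp add: B_def)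
    then have "b e * norm v \<le> B * norm v" by (intro mult_right_mono) auto
    then show ?thesis using b(2)[OF that, of v] by simp
  qed
  define \<rho> where "\<rho> = Min ((\<lambda>e. norm (L e a)) ` E)"
  have \<rho>0: "\<rho> > 0" using E a by (auto simp: \<rho>_def Min_gr_iff)
  have \<rho>: "\<rho> \<le> norm (L e a)" if "e \<in> E" for e using E that by (simp add: \<rho>_def)
  define \<epsilon> where "\<epsilon> = \<rho> / (4 * B)"
  have \<epsilon>0: "\<epsilon> > 0" using \<rho>0 B0 by (simp add: \<epsilon>_def)
  have B\<epsilon>: "B * \<epsilon> = \<rho> / 4" using B0 by (simp add: \<epsilon>_def)
  define Wt where "Wt = sum w E"
  have Wt: "Wt > 0" unfolding Wt_def using E w by (intro sum_pos) auto
  define K1 where "K1 = Wt / (3 / 4 * \<rho>)"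
  define K2 where "K2 = Wt * B / (3 / 4 * \<rho>)\<^sup>2"
  define K3 where "K3 = Wt * (3 * B\<^sup>2) / (3 / 4 * \<rho>) ^ 3"
  have K0: "K1 > 0" "K2 > 0" "K3 > 0" using Wt \<rho>0 B0 by (auto simp: K1_def K2_def K3_def)
  define K where "K = K1 + K2 + K3"
  define M where "M = B * (norm a + \<epsilon>)"
  have M0: "M > 0" using B0 \<epsilon>0 by (simp add: M_def add_nonneg_pos)
  define k where "k = Wt / M"
  have low: "3 / 4 * \<rho> * \<tau> \<le> norm (L e x)" if "\<tau> > 0" "norm (x - \<tau> *\<^sub>R a) \<le> \<epsilon> * \<tau>" "e \<in> E" for e \<tau> x
  proof -
    have "norm (L e (x - \<tau> *\<^sub>R a)) \<le> B * (\<epsilon> * \<tau>)"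
      using B[OF that(3), of "x - \<tau> *\<^sub>R a"] mult_left_mono[OF that(2) less_imp_le[OF B0]] by linarith
    then have 1: "norm (L e x - \<tau> *\<^sub>R L e a) \<le> \<rho> / 4 * \<tau>"
      using B\<epsilon> by (simp add: linear_diff[OF L[OF that(3)]] linear_cmul[OF L[OF that(3)]] mult.assoc[symmetric])
    have "\<rho> * \<tau> \<le> norm (L e a) * \<tau>" using \<rho>[OF that(3)] that(1) by (intro mult_right_mono) auto
    also have "\<dots> = norm (\<tau> *\<^sub>R L e a)" using that(1) by simp
    also have "\<dots> \<le> norm (L e x) + norm (L e x - \<tau> *\<^sub>R L e a)"
      using norm_triangle_sub[of "\<tau> *\<^sub>R L e a" "L e x"] by (simp add: norm_minus_commute)
    finally show ?thesis using 1 by simp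
  qed
  have up: "norm (L e x) \<le> M * \<tau>" if "\<tau> > 0" "norm (x - \<tau> *\<^sub>R a) \<le> \<epsilon> * \<tau>" "e \<in> E" for e \<tau> x
  proof -
    have "norm x \<le> norm (\<tau> *\<^sub>R a) + norm (x - \<tau> *\<^sub>R a)" by (rule norm_triangle_sub)
    then have "norm x \<le> (norm a + \<epsilon>) * \<tau>" using that(1,2) by (simp add: algebra_simps)
    then have "B * norm x \<le> B * ((norm a + \<epsilon>) * \<tau>)" using B0 by (intro mult_left_mono) auto
    then show ?thesis using B[OF that(3), of x] by (simp add: M_def)
  qed
  have 1: "conical_potential (newton_potential E w L) (newton_gradient E w L) a \<epsilon> K k"
  proof
    fix x :: 'v
    show "0 \<le> newton_potential E w L x" unfolding newton_potential_def
      using w by (intro sum_nonneg) (auto simp: less_imp_le)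
  next
    fix \<tau> :: real and x :: 'v assume \<tau>: "\<tau> > 0" and x: "norm (x - \<tau> *\<^sub>R a) \<le> \<epsilon> * \<tau>"
    have lp: "3 / 4 * \<rho> * \<tau> > 0" using \<rho>0 \<tau> by simp
    have "newton_potential E w L x \<le> (\<Sum>e\<in>E. w e / (3 / 4 * \<rho> * \<tau>))"
      unfolding newton_potential_def
    proof (rule sum_mono)
      fix e assume e: "e \<in> E"
      have "norm (L e x) > 0" using low[OF \<tau> x e] lp by linarith
      then have "0 < norm (L e x) * (3 / 4 * \<rho> * \<tau>)" using lp by (rule mult_pos_pos)
      then show "w e / norm (L e x) \<le> w e / (3 / 4 * \<rho> * \<tau>)"
        using low[OF \<tau> x e] w[OF e] by (intro divide_left_mono) auto
    qed
    also have "\<dots> = Wt / (3 / 4 * \<rho> * \<tau>)" unfolding Wt_def by (rule sum_divide_distrib[symmetric])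
    also have "\<dots> = K1 / \<tau>" by (simp add: K1_def)
    also have "\<dots> \<le> K / \<tau>" using \<tau> K0 by (intro divide_right_mono) (auto simp: K_def)
    finally show "newton_potential E w L x \<le> K / \<tau>" .
    have "k / \<tau> = Wt / (M * \<tau>)" by (simp add: k_def)
    also have "\<dots> = (\<Sum>e\<in>E. w e / (M * \<tau>))" unfolding Wt_def by (rule sum_divide_distrib)
    also have "\<dots> \<le> newton_potential E w L x"
      unfolding newton_potential_def
    proof (rule sum_mono)
      fix e assume e: "e \<in> E"
      have "norm (L e x) > 0" using low[OF \<tau> x e] lp by linarith
      then show "w e / (M * \<tau>) \<le> w e / norm (L e x)"
        using up[OF \<tau> x e] w[OF e] M0 \<tau> by (intro divide_left_mono) auto
    qed
    finally show "k / \<tau> \<le> newton_potential E w L x" .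
    have "norm (newton_gradient E w L x) \<le> (\<Sum>e\<in>E. w e * B / (3 / 4 * \<rho> * \<tau>)\<^sup>2)"
      unfolding newton_gradient_def
    proof (rule order_trans[OF norm_sum sum_mono])
      fix e assume e: "e \<in> E"
      let ?l = "norm (L e x)"
      have l0: "?l > 0" using low[OF \<tau> x e] lp by linarith
      have adj: "norm (adjoint (L e) (L e x)) \<le> B * ?l"
      proof (cases "adjoint (L e) (L e x) = 0")
        case False
        let ?z = "adjoint (L e) (L e x)"
        have "norm ?z * norm ?z = ?z \<bullet> ?z" by (simp add: power2_norm_eq_inner[symmetric] power2_eq_square)
        also have "\<dots> = L e x \<bullet> L e ?z" using adjoint_works[OF L[OF e], of ?z "L e x"] by (simp add: inner_commute)
        also have "\<dots> \<le> ?l * norm (L e ?z)" by (rule norm_cauchy_schwarz)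
        also have "\<dots> \<le> ?l * (B * norm ?z)" using B[OF e, of ?z] by (intro mult_left_mono) auto
        finally have "norm ?z * norm ?z \<le> (B * ?l) * norm ?z" by (simp add: mult.commute mult.left_commute)
        then show ?thesis using False by (simp add: mult_le_cancel_right)
      qed (use B0 in simp)
      have "norm ((- w e / ?l ^ 3) *\<^sub>R adjoint (L e) (L e x)) = w e / ?l ^ 3 * norm (adjoint (L e) (L e x))"
        using w[OF e] l0 by simp
      also have "\<dots> \<le> w e / ?l ^ 3 * (B * ?l)" using adj w[OF e] l0 by (intro mult_left_mono) auto
      also have "\<dots> = w e * B / ?l\<^sup>2" using l0 by (simp add: power2_eq_square power3_eq_cube)
      also have "\<dots> \<le> w e * B / (3 / 4 * \<rho> * \<tau>)\<^sup>2"
      proof (rule divide_left_mono)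
        show "(3 / 4 * \<rho> * \<tau>)\<^sup>2 \<le> ?l\<^sup>2" using low[OF \<tau> x e] less_imp_le[OF lp] by (rule power_mono)
        show "0 < ?l\<^sup>2 * (3 / 4 * \<rho> * \<tau>)\<^sup>2" using l0 \<rho>0 \<tau> by (intro mult_pos_pos zero_less_power) auto
      qed (use w[OF e] B0 in simp)
      finally show "norm ((- w e / ?l ^ 3) *\<^sub>R adjoint (L e) (L e x)) \<le> w e * B / (3 / 4 * \<rho> * \<tau>)\<^sup>2" .
    qed
    also have "\<dots> = Wt * B / (3 / 4 * \<rho> * \<tau>)\<^sup>2"
      by (simp only: Wt_def sum_distrib_right sum_divide_distrib)
    also have "\<dots> = K2 / \<tau>\<^sup>2" by (simp add: K2_def power_mult_distrib power_divide)
    also have "\<dots> \<le> K / \<tau>\<^sup>2" using \<tau> K0 by (intro divide_right_mono) (auto simp: K_def)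
    finally show "norm (newton_gradient E w L x) \<le> K / \<tau>\<^sup>2" .
    fix \<xi> :: 'v assume \<xi>: "norm \<xi> \<le> \<epsilon> * \<tau>"
    have "newton_potential E w L (x + \<xi>) - newton_potential E w L x - newton_gradient E w L x \<bullet> \<xi> =
      (\<Sum>e\<in>E. w e * (1 / norm (L e x + L e \<xi>) - 1 / norm (L e x) + (L e x \<bullet> L e \<xi>) / norm (L e x) ^ 3))"
      (is "_ = sum ?f E")
    proof -
      have "newton_gradient E w L x \<bullet> \<xi> = (\<Sum>e\<in>E. - w e * ((L e x \<bullet> L e \<xi>) / norm (L e x) ^ 3))"
        unfolding newton_gradient_def inner_sum_left
      proof (rule sum.cong[OF refl])
        fix e assume e: "e \<in> E"
        have "adjoint (L e) (L e x) \<bullet> \<xi> = L e x \<bullet> L e \<xi>"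
          using adjoint_works[OF L[OF e], of \<xi> "L e x"] by (simp add: inner_commute)
        then show "(- w e / norm (L e x) ^ 3) *\<^sub>R adjoint (L e) (L e x) \<bullet> \<xi> = - w e * ((L e x \<bullet> L e \<xi>) / norm (L e x) ^ 3)"
          by simp
      qed
      moreover have "newton_potential E w L (x + \<xi>) = (\<Sum>e\<in>E. w e / norm (L e x + L e \<xi>))"
        unfolding newton_potential_def using L by (intro sum.cong refl) (simp add: linear_add)
      ultimately show ?thesis
        unfolding newton_potential_def by (simp add: sum_subtractf[symmetric] algebra_simps)
    qed
    also have "\<bar>sum ?f E\<bar> \<le> (\<Sum>e\<in>E. w e * (3 * B\<^sup>2) / (3 / 4 * \<rho> * \<tau>) ^ 3 * (norm \<xi>)\<^sup>2)"
    proof (rule order_trans[OF sum_abs sum_mono])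
      fix e assume e: "e \<in> E"
      let ?l = "norm (L e x)"
      have l0: "?l > 0" using low[OF \<tau> x e] lp by linarith
      have "norm (L e \<xi>) \<le> B * (\<epsilon> * \<tau>)" using B[OF e, of \<xi>] mult_left_mono[OF \<xi> less_imp_le[OF B0]] by linarith
      then have "norm (L e \<xi>) \<le> \<rho> / 4 * \<tau>" using B\<epsilon> by (simp add: mult.assoc[symmetric])
      moreover have "3 / 4 * \<rho> * \<tau> = 3 / 4 * (\<rho> * \<tau>)" "\<rho> / 4 * \<tau> = (\<rho> * \<tau>) / 4" by simp_all
      moreover have "0 < \<rho> * \<tau>" using \<rho>0 \<tau> by simp
      ultimately have l2: "norm (L e \<xi>) \<le> ?l / 2" using low[OF \<tau> x e] by linarith
      have "\<bar>?f e\<bar> = w e * \<bar>1 / norm (L e x + L e \<xi>) - 1 / norm (L e x) + (L e x \<bullet> L e \<xi>) / norm (L e x) ^ 3\<bar>"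
        using w[OF e] by (simp add: abs_mult)
      also have "\<dots> \<le> w e * (3 * (norm (L e \<xi>))\<^sup>2 / ?l ^ 3)"
        using inverse_norm_expansion[OF _ l2] l0 w[OF e] by (intro mult_left_mono) auto
      also have "\<dots> \<le> w e * (3 * (B * norm \<xi>)\<^sup>2 / (3 / 4 * \<rho> * \<tau>) ^ 3)"
      proof (intro mult_left_mono frac_le power_mono)
        show "0 < (3 / 4 * \<rho> * \<tau>) ^ 3" using lp by (rule zero_less_power)
      qed (use low[OF \<tau> x e] less_imp_le[OF lp] w[OF e] B[OF e, of \<xi>] in simp_all)
      also have "\<dots> = w e * (3 * B\<^sup>2) / (3 / 4 * \<rho> * \<tau>) ^ 3 * (norm \<xi>)\<^sup>2" by (simp add: power_mult_distrib)
      finally show "\<bar>?f e\<bar> \<le> w e * (3 * B\<^sup>2) / (3 / 4 * \<rho> * \<tau>) ^ 3 * (norm \<xi>)\<^sup>2" .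
    qed
    also have "\<dots> = Wt * (3 * B\<^sup>2) / (3 / 4 * \<rho> * \<tau>) ^ 3 * (norm \<xi>)\<^sup>2"
      by (simp only: Wt_def sum_distrib_right sum_divide_distrib)
    also have "\<dots> = K3 * (norm \<xi>)\<^sup>2 / \<tau> ^ 3" by (simp add: K3_def power_mult_distrib power_divide)
    also have "\<dots> \<le> K * (norm \<xi>)\<^sup>2 / \<tau> ^ 3"
      using \<tau> K0 by (intro divide_right_mono mult_right_mono) (auto simp: K_def)
    finally show "\<bar>newton_potential E w L (x + \<xi>) - newton_potential E w L x - newton_gradient E w L x \<bullet> \<xi>\<bar> \<le> K * (norm \<xi>)\<^sup>2 / \<tau> ^ 3" .
  qed (use a0 \<epsilon>0 K0 Wt M0 in \<open>auto simp: K_def k_def\<close>)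
  have 2: "\<forall>\<tau>>0. \<forall>x. norm (x - \<tau> *\<^sub>R a) \<le> \<epsilon> * \<tau> \<longrightarrow> (\<forall>e\<in>E. L e x \<noteq> 0)"
  proof (intro allI impI ballI)
    fix \<tau> :: real and x e assume "\<tau> > 0" "norm (x - \<tau> *\<^sub>R a) \<le> \<epsilon> * \<tau>" "e \<in> E"
    from low[OF this] have "0 < norm (L e x)" using \<rho>0 \<open>\<tau> > 0\<close> by (smt (verit) mult_pos_pos zero_less_divide_iff)
    then show "L e x \<noteq> 0" by simp
  qed
  from 1 2 show ?thesis by blast
qed

section \<open>The N-body potential in mass-scaled coordinates\<close>

definition body_pairs :: "('n::{finite,linorder} \<times> 'n) set" where "body_pairs = {(i, j). i < j}"

definition pair_difference :: "('n::finite \<Rightarrow> real) \<Rightarrow> 'n \<times> 'n \<Rightarrow> ('e::euclidean_space, 'n) vec \<Rightarrow> 'e" where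
  "pair_difference m = (\<lambda>(i, j) y. mass_scale (\<lambda>i. inverse (m i)) y $ i - mass_scale (\<lambda>i. inverse (m i)) y $ j)"

definition scaled_potential :: "('n::{finite,linorder} \<Rightarrow> real) \<Rightarrow> ('e::euclidean_space, 'n) vec \<Rightarrow> real" where
  "scaled_potential m = newton_potential body_pairs (\<lambda>(i, j). m i * m j) (pair_difference m)"

definition scaled_gradient :: "('n::{finite,linorder} \<Rightarrow> real) \<Rightarrow> ('e::euclidean_space, 'n) vec \<Rightarrow> ('e, 'n) vec" where
  "scaled_gradient m = newton_gradient body_pairs (\<lambda>(i, j). m i * m j) (pair_difference m)"

lemma pair_difference_scale:
  assumes "\<forall>i. 0 < m i"
  shows "pair_difference m (i, j) (mass_scale m x) = x $ i - x $ j"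
  by (simp add: pair_difference_def mass_scale_inverse(1)[OF assms])

lemma linear_pair_difference: "linear (pair_difference m e)"
  by (rule linearI) (auto simp: pair_difference_def mass_scale_simps case_prod_beta algebra_simps)

lemma scaled_potential:
  assumes "\<forall>i. 0 < m i"
  shows "scaled_potential m (mass_scale m x) = potential_real m x"
  unfolding scaled_potential_def newton_potential_def potential_real_def body_pairs_def
  by (rule sum.cong[OF refl]) (auto simp: pair_difference_scale[OF assms])

lemma collision_free_pairs:
  fixes x :: "('e::euclidean_space, 'n::{finite,linorder}) vec"
  assumes "\<forall>i. 0 < m i"
  shows "x \<in> collision_free \<longleftrightarrow> (\<forall>e\<in>body_pairs. pair_difference m e (mass_scale m x) \<noteq> 0)"
proof
  assume r: "\<forall>e\<in>body_pairs. pair_difference m e (mass_scale m x) \<noteq> 0"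
  have "x $ i \<noteq> x $ j" if "i \<noteq> j" for i j
  proof (cases "i < j")
    case True
    then show ?thesis using r pair_difference_scale[OF assms, of i j x] by (force simp: body_pairs_def)
  next
    case False
    then have "j < i" using that by simp
    then show ?thesis using r pair_difference_scale[OF assms, of j i x] by (force simp: body_pairs_def)
  qed
  then show "x \<in> collision_free" by (simp add: collision_free_def)
qed (auto simp: collision_free_def body_pairs_def pair_difference_scale[OF assms])

lemma body_pairs_nonempty:
  assumes "CARD('n::{finite,linorder}) \<ge> 2"
  shows "(body_pairs :: ('n \<times> 'n) set) \<noteq> {}"
proof -
  obtain i j :: 'n where "i \<noteq> j"
  proof (rule ccontr)
    assume "\<not> thesis"
    then have "i = j" for i j :: 'n using that by blast
    then have "UNIV = {undefined :: 'n}" by blast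
    then have "CARD('n) = card {undefined :: 'n}" by (rule arg_cong)
    then show False using assms by simp
  qed
  then have "(i, j) \<in> body_pairs \<or> (j, i) \<in> body_pairs"
    unfolding body_pairs_def using linorder_less_linear[of i j] by simp
  then show ?thesis by blast
qed

text \<open>The second conjunct keeps perturbed competitors inside the cone away from collisions,
  where \<open>potential\<close> is infinite.\<close>

lemma scaled_potential_conical:
  fixes a :: "('e::euclidean_space, 'n::{finite,linorder}) vec"
  assumes m: "\<forall>i. 0 < m i" and card: "CARD('n) \<ge> 2" and a: "a \<in> collision_free"
  shows "\<exists>\<epsilon>0 K k. conical_potential (scaled_potential m) (scaled_gradient m) (mass_scale m a) \<epsilon>0 K k \<and>
    (\<forall>\<tau>>0. \<forall>x. norm (mass_scale m x - \<tau> *\<^sub>R mass_scale m a) \<le> \<epsilon>0 * \<tau> \<longrightarrow> x \<in> collision_free)"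
proof -
  have w: "(case e of (i, j) \<Rightarrow> m i * m j) > 0" for e :: "'n \<times> 'n" using m by (auto split: prod.split)
  have "pair_difference m e (mass_scale m a) \<noteq> 0" if "e \<in> body_pairs" for e
    using a that collision_free_pairs[OF m] by blast
  from newton_potential_conical[OF _ body_pairs_nonempty[OF card] w linear_pair_difference this]
  show ?thesis unfolding scaled_potential_def scaled_gradient_def collision_free_pairs[OF m]
    by (meson finite)
qed

lemma mass_grad_eqI:
  fixes x :: "('e::euclidean_space, 'n::finite) vec"
  assumes m: "\<forall>i. 0 < m i" and d: "(f has_derivative (\<lambda>v. mass_inner m g v)) (at x)"
  shows "mass_grad m f x = g"
  unfolding mass_grad_def
proof (rule the_equality)
  show "(f has_derivative (\<lambda>v. mass_inner m g v)) (at x)" by (rule d)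
next
  fix g' assume "(f has_derivative (\<lambda>v. mass_inner m g' v)) (at x)"
  from has_derivative_unique[OF this d] have "mass_inner m g' (g' - g) = mass_inner m g (g' - g)" by metis
  then have "mass_scale m (g' - g) \<bullet> mass_scale m (g' - g) = 0"
    by (simp add: mass_inner_scale[OF m] mass_scale_simps inner_diff_left)
  then have "mass_scale m (g' - g) = 0" by simp
  then have "mass_scale (\<lambda>i. inverse (m i)) (mass_scale m (g' - g)) = 0" by (simp add: mass_scale_simps)
  then show "g' = g" by (simp add: mass_scale_inverse(1)[OF m])
qed

text \<open>A collision-free \<open>x\<close> may serve as its own limit shape: the conical
  estimates at \<tau> = 1 give differentiability at \<open>x\<close>, and scaling turns the
  Euclidean gradient into the mass gradient.\<close>

lemma mass_grad_potential:
  fixes x :: "('e::euclidean_space, 'n::{finite,linorder}) vec"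
  assumes m: "\<forall>i. 0 < m i" and card: "CARD('n) \<ge> 2" and x: "x \<in> collision_free"
  shows "mass_scale m (mass_grad m (potential_real m) x) = scaled_gradient m (mass_scale m x)"
proof -
  obtain \<epsilon>0 K k where "conical_potential (scaled_potential m) (scaled_gradient m) (mass_scale m x) \<epsilon>0 K k"
    using scaled_potential_conical[OF m card x] by blast
  then interpret conical_potential "scaled_potential m" "scaled_gradient m" "mass_scale m x" \<epsilon>0 K k .
  have "(scaled_potential m has_derivative (\<lambda>v. scaled_gradient m (mass_scale m x) \<bullet> v)) (at (mass_scale m x))"
    by (rule U_has_derivative[of 1]) (use \<epsilon>0_pos in auto)
  from has_derivative_compose[OF bounded_linear_imp_has_derivative[OF bounded_linear_mass_scale[of m]] this]
  have "(potential_real m has_derivative (\<lambda>v. scaled_gradient m (mass_scale m x) \<bullet> mass_scale m v)) (at x)"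
    by (simp add: scaled_potential[OF m])
  then have "mass_grad m (potential_real m) x = mass_scale (\<lambda>i. inverse (m i)) (scaled_gradient m (mass_scale m x))"
    by (intro mass_grad_eqI[OF m]) (simp add: mass_inner_scale[OF m] mass_scale_inverse(2)[OF m])
  then show ?thesis by (simp add: mass_scale_inverse(2)[OF m])
qed

text \<open>\<open>motion\<close> takes derivatives within its interval; at interior points they are
  two-sided, so that closed and open half-lines can be treated alike.\<close>

lemma motion_interior:
  fixes c :: "real \<Rightarrow> ('e::euclidean_space, 'n::{finite,linorder}) vec"
  assumes c: "motion m I c" and J: "open J" "J \<subseteq> I" and t: "t \<in> J"
  shows "c t \<in> collision_free" "(c has_vector_derivative vector_derivative c (at t)) (at t)"
    "((\<lambda>s. vector_derivative c (at s)) has_vector_derivative mass_grad m (potential_real m) (c t)) (at t)"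
proof -
  have int: "at s within I = at s" if "s \<in> J" for s
    using that J by (intro at_within_interior) (metis interior_maximal subsetD)
  have tI: "t \<in> I" using t J by blast
  show "c t \<in> collision_free" using c tI by (simp add: motion_def)
  have "c differentiable (at t within I)" using c tI by (simp add: motion_def)
  then show "(c has_vector_derivative vector_derivative c (at t)) (at t)"
    by (simp add: int[OF t] vector_derivative_works)
  have "((\<lambda>s. vector_derivative c (at s within I)) has_vector_derivative mass_grad m (potential_real m) (c t)) (at t within I)"
    using c tI unfolding motion_def by blast
  then have "((\<lambda>s. vector_derivative c (at s within I)) has_vector_derivative mass_grad m (potential_real m) (c t)) (at t)"
    unfolding int[OF t] .
  then show "((\<lambda>s. vector_derivative c (at s)) has_vector_derivative mass_grad m (potential_real m) (c t)) (at t)"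
    by (rule has_vector_derivative_transform_within_open[OF _ J(1) t]) (simp add: int)
qed

section \<open>Minimizing solutions of the N-body problem\<close>

lemma sum_increments_mono_le:
  fixes F :: "real \<Rightarrow> real" and p q :: "nat \<Rightarrow> real"
  assumes mono: "\<And>x y. a \<le> x \<Longrightarrow> x \<le> y \<Longrightarrow> y \<le> b \<Longrightarrow> F x \<le> F y" and ab: "a \<le> b"
    and pq: "\<And>k. k < n \<Longrightarrow> a \<le> p k \<and> p k \<le> q k \<and> q k \<le> b"
    and dis: "disjoint_family_on (\<lambda>k. {p k<..<q k}) {..<n}"
  shows "(\<Sum>k<n. F (q k) - F (p k)) \<le> F b - F a"
proof -
  let ?I = "\<lambda>k. {F (p k)<..<F (q k)}"
  have le: "F (p k) \<le> F (q k)" if "k < n" for k using pq[OF that] mono by simp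
  have "(\<Sum>k<n. F (q k) - F (p k)) = (\<Sum>k<n. measure lebesgue (?I k))"
    using le by (intro sum.cong) auto
  also have "\<dots> = measure lebesgue (\<Union>(?I ` {..<n}))"
  proof (rule measure_negligible_finite_Union_image[symmetric])
    show "pairwise (\<lambda>x y. negligible (?I x \<inter> ?I y)) {..<n}"
      unfolding pairwise_def
    proof (intro ballI impI)
      fix i j assume ij: "i \<in> {..<n}" "j \<in> {..<n}" "i \<noteq> j"
      have "?I i \<inter> ?I j = {}"
      proof (cases "p i < q i \<and> p j < q j")
        case True
        have "{max (p i) (p j)<..<min (q i) (q j)} \<subseteq> {p i<..<q i} \<inter> {p j<..<q j}" by auto
        then have "{max (p i) (p j)<..<min (q i) (q j)} = {}" using disjoint_family_onD[OF dis ij] by simp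
        then have "min (q i) (q j) \<le> max (p i) (p j)" by (simp add: not_less)
        then have "q i \<le> p j \<or> q j \<le> p i" using True by (auto simp: min_def max_def split: if_splits)
        then have "F (q i) \<le> F (p j) \<or> F (q j) \<le> F (p i)" using mono[of "q i" "p j"] mono[of "q j" "p i"] pq[of i] pq[of j] ij by auto
        then show ?thesis by auto
      next
        case False
        then have "p i = q i \<or> p j = q j" using pq[of i] pq[of j] ij by auto
        then show ?thesis by auto
      qed
      then show "negligible (?I i \<inter> ?I j)" by simp
    qed
    show "?I k \<in> lmeasurable" for k using lmeasurable_box[of "F (p k)" "F (q k)"] by simp
  qed simp
  also have "\<dots> \<le> measure lebesgue {F a..F b}"
  proof (rule measure_mono_fmeasurable)
    have "?I k \<subseteq> {F a..F b}" if "k < n" for k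
      using pq[OF that] mono[of a "p k"] mono[of "q k" b] by auto
    then show "\<Union>(?I ` {..<n}) \<subseteq> {F a..F b}" by blast
    show "\<Union>(?I ` {..<n}) \<in> sets lebesgue" by auto
    show "{F a..F b} \<in> lmeasurable" using lmeasurable_cbox[of "F a" "F b"] by simp
  qed
  also have "\<dots> = F b - F a" using mono[OF order_refl ab order_refl] by simp
  finally show ?thesis .
qed

text \<open>For e < 1 the derivative is unbounded at 0. Below \<eta> monotonicity bounds the total
  increment by \<open>\<eta> powr e\<close>, however the intervals lie; above \<eta> the function is
  continuously differentiable.\<close>

lemma absolutely_continuous_curve_powr:
  assumes e: "0 < e"
  shows "absolutely_continuous_curve 0 1 (\<lambda>x::real. x powr e)"
proof (rule absolutely_continuous_curveI)
  fix \<epsilon> :: real assume \<epsilon>: "\<epsilon> > 0"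
  define \<eta> where "\<eta> = min 1 ((\<epsilon> / 2) powr (1 / e)) / 2"
  have \<eta>: "\<eta> > 0" "\<eta> < 1" using \<epsilon> by (auto simp: \<eta>_def)
  have "\<eta> powr e < ((\<epsilon> / 2) powr (1 / e)) powr e"
  proof (rule powr_less_mono2[OF e])
    have "0 < (\<epsilon> / 2) powr (1 / e)" using \<epsilon> by simp
    then show "\<eta> < (\<epsilon> / 2) powr (1 / e)" unfolding \<eta>_def by linarith
  qed (use \<eta> in simp)
  then have \<eta>e: "\<eta> powr e < \<epsilon> / 2" using e \<epsilon> by (simp add: powr_powr)
  have "absolutely_continuous_curve \<eta> 1 (\<lambda>x::real. x powr e)"
  proof (rule absolutely_continuous_curve_C1)
    fix x assume "x \<in> {\<eta>..1}"
    then have "((\<lambda>x. x powr e) has_real_derivative e * x powr (e - 1)) (at x)"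
      using \<eta> has_real_derivative_powr[of x e] by simp
    then show "((\<lambda>x. x powr e) has_vector_derivative e * x powr (e - 1)) (at x within {\<eta>..1})"
      by (simp add: has_real_derivative_iff_has_vector_derivative has_vector_derivative_at_within)
  next
    show "continuous_on {\<eta>..1} (\<lambda>x. e * x powr (e - 1))"
      using \<eta> by (intro continuous_intros) auto
  qed
  moreover have "\<epsilon> / 2 > 0" using \<epsilon> by simp
  ultimately show "\<exists>\<delta>>0. \<forall>(n::nat) p q.
       (\<forall>k<n. 0 \<le> p k \<and> p k \<le> q k \<and> q k \<le> 1) \<longrightarrow>
       disjoint_family_on (\<lambda>k. {p k<..<q k}) {..<n} \<longrightarrow>
       (\<Sum>k<n. q k - p k) < \<delta> \<longrightarrow>
       (\<Sum>k<n. norm (q k powr e - p k powr e)) < \<epsilon>"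
  proof (rule absolutely_continuous_curveE, intro exI conjI allI impI)
    fix \<delta> :: real and n :: nat and p q :: "nat \<Rightarrow> real"
    assume *: "\<And>(n::nat) p q. (\<And>k. k < n \<Longrightarrow> \<eta> \<le> p k \<and> p k \<le> q k \<and> q k \<le> 1) \<Longrightarrow>
       disjoint_family_on (\<lambda>k. {p k<..<q k}) {..<n} \<Longrightarrow>
       (\<Sum>k<n. q k - p k) < \<delta> \<Longrightarrow>
       (\<Sum>k<n. norm (q k powr e - p k powr e)) < \<epsilon> / 2"
      and pq: "\<forall>k<n. 0 \<le> p k \<and> p k \<le> q k \<and> q k \<le> 1"
      and dis: "disjoint_family_on (\<lambda>k. {p k<..<q k}) {..<n}" and len: "(\<Sum>k<n. q k - p k) < \<delta>"
    have A: "(\<Sum>k<n. norm ((max \<eta> (q k)) powr e - (max \<eta> (p k)) powr e)) < \<epsilon> / 2"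
    proof (rule *)
      show "\<eta> \<le> max \<eta> (p k) \<and> max \<eta> (p k) \<le> max \<eta> (q k) \<and> max \<eta> (q k) \<le> 1" if "k < n" for k
        using pq[rule_format, OF that] \<eta> by auto
      show "disjoint_family_on (\<lambda>k. {max \<eta> (p k)<..<max \<eta> (q k)}) {..<n}"
        using dis unfolding disjoint_family_on_def by fastforce
      have "(\<Sum>k<n. max \<eta> (q k) - max \<eta> (p k)) \<le> (\<Sum>k<n. q k - p k)"
        using pq by (intro sum_mono) (auto simp: max_def)
      then show "(\<Sum>k<n. max \<eta> (q k) - max \<eta> (p k)) < \<delta>" using len by linarith
    qed
    have B: "(\<Sum>k<n. (min \<eta> (q k)) powr e - (min \<eta> (p k)) powr e) \<le> \<eta> powr e - 0 powr e"
    proof (rule sum_increments_mono_le[where F = "\<lambda>x. x powr e"])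
      show "x powr e \<le> y powr e" if "0 \<le> x" "x \<le> y" for x y :: real
        using that e by (intro powr_mono2) auto
      show "0 \<le> min \<eta> (p k) \<and> min \<eta> (p k) \<le> min \<eta> (q k) \<and> min \<eta> (q k) \<le> \<eta>" if "k < n" for k
        using pq[rule_format, OF that] \<eta> by auto
      show "disjoint_family_on (\<lambda>k. {min \<eta> (p k)<..<min \<eta> (q k)}) {..<n}"
        using dis unfolding disjoint_family_on_def by fastforce
    qed (use \<eta> in simp)
    have "(\<Sum>k<n. norm (q k powr e - p k powr e)) \<le>
        (\<Sum>k<n. ((min \<eta> (q k)) powr e - (min \<eta> (p k)) powr e) + norm ((max \<eta> (q k)) powr e - (max \<eta> (p k)) powr e))"
    proof (rule sum_mono)
      fix k assume "k \<in> {..<n}"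
      then have k: "0 \<le> p k" "p k \<le> q k" using pq by auto
      have "(min \<eta> (p k)) powr e \<le> (min \<eta> (q k)) powr e" using k e \<eta> by (intro powr_mono2) auto
      moreover have "q k powr e - p k powr e =
          ((min \<eta> (q k)) powr e - (min \<eta> (p k)) powr e) + ((max \<eta> (q k)) powr e - (max \<eta> (p k)) powr e)"
        by (auto simp: min_def max_def)
      ultimately show "norm (q k powr e - p k powr e) \<le>
          ((min \<eta> (q k)) powr e - (min \<eta> (p k)) powr e) + norm ((max \<eta> (q k)) powr e - (max \<eta> (p k)) powr e)"
        unfolding real_norm_def by linarith
    qed
    also have "\<dots> < \<epsilon>" using A B \<eta>e by (simp add: sum.distrib)
    finally show "(\<Sum>k<n. norm (q k powr e - p k powr e)) < \<epsilon>" .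
  qed
qed

text \<open>A segment run through as \<open>\<theta> \<mapsto> \<theta>\<^bsup>2/3\<^esup>\<close>, like a parabolic ejection, leaves a collision with
  finite action.\<close>

lemma jm_dist_finite_ejection:
  fixes x y :: "('e::euclidean_space, 'n::{finite,linorder}) vec"
  assumes m: "\<forall>i. 0 < m i" and h: "h \<ge> 0" and y: "y \<in> collision_free"
    and close: "\<And>i j. x $ i \<noteq> x $ j \<Longrightarrow> norm ((y $ i - y $ j) - (x $ i - x $ j)) < norm (x $ i - x $ j)"
  shows "jm_dist m h x y < top"
proof -
  define d where "d = y - x"
  \<comment> \<open>A pair colliding at \<open>x\<close> separates linearly along the segment; for
    any other pair \<open>close\<close> leaves a positive margin. In both cases the distance is at
    least \<rho> times the fraction of the segment covered.\<close>
  define \<rho> where "\<rho> i j = (if x $ i = x $ j then norm (y $ i - y $ j)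
      else norm (x $ i - x $ j) - norm ((y $ i - y $ j) - (x $ i - x $ j)))" for i j
  have \<rho>: "\<rho> i j > 0" if "i \<noteq> j" for i j
    using that y close[of i j] by (auto simp: \<rho>_def collision_free_def)
  have frac: "A / (t * r) = A / r * inverse t" for A t r :: real by (simp add: field_simps)
  define c where "c \<theta> = x + (\<theta> powr (2/3)) *\<^sub>R d" for \<theta> :: real
  have sep: "\<theta> powr (2/3) * \<rho> i j \<le> norm (c \<theta> $ i - c \<theta> $ j)" if "0 < \<theta>" "\<theta> < 1" for \<theta> i j
  proof -
    define l where "l = \<theta> powr (2/3)"
    have l: "0 < l" "l \<le> 1" using that by (auto simp: l_def powr_le1)
    have cij: "c \<theta> $ i - c \<theta> $ j = (x $ i - x $ j) + l *\<^sub>R ((y $ i - y $ j) - (x $ i - x $ j))"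
      by (simp add: c_def d_def l_def algebra_simps)
    show ?thesis
    proof (cases "x $ i = x $ j")
      case True
      then show ?thesis using l unfolding cij l_def[symmetric] by (simp add: \<rho>_def)
    next
      case False
      let ?A = "norm (x $ i - x $ j)" and ?B = "norm ((y $ i - y $ j) - (x $ i - x $ j))"
      have "l * (?A - ?B) \<le> ?A - l * ?B" using l by (simp add: right_diff_distrib mult_left_le_one_le)
      also have "\<dots> \<le> norm ((x $ i - x $ j) + l *\<^sub>R ((y $ i - y $ j) - (x $ i - x $ j)))"
        using norm_diff_ineq[of "x $ i - x $ j" "l *\<^sub>R ((y $ i - y $ j) - (x $ i - x $ j))"] l by simp
      finally show ?thesis using False unfolding cij l_def[symmetric] by (simp add: \<rho>_def)
    qed
  qed
  define \<kappa>1 where "\<kappa>1 = (\<Sum>(i, j)\<in>{(i, j :: 'n). i < j}. m i * m j / \<rho> i j)"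
  \<comment> \<open>Kinetic and potential energy are both bounded by multiples of
    \<open>\<theta> powr (-2/3)\<close>, which is integrable at 0. The factor 2/9 is half the square
    of the exponent 2/3.\<close>
  define \<kappa> where "\<kappa> = 2 / 9 * (mass_norm m d)\<^sup>2 + \<kappa>1"
  let ?Q = "\<lambda>\<theta>. 3 * \<kappa> * \<theta> powr (1/3) + h * \<theta>"
  let ?Q' = "\<lambda>\<theta>. \<kappa> * \<theta> powr (-2/3) + h"
  let ?v = "\<lambda>\<theta>. (2/3 * \<theta> powr (-1/3)) *\<^sub>R d"
  have ac: "absolutely_continuous_curve 0 1 c"
    by (rule absolutely_continuous_curve_lipschitz_compose[OF absolutely_continuous_curve_powr[of "2/3"] zero_less_one, where L = "norm d"])
      (simp_all add: c_def scaleR_diff_left[symmetric] mult.commute)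
  have "action m h 0 1 c \<le> ennreal (?Q 1 - ?Q 0)"
  proof (rule action_le[OF m h])
    fix \<theta> :: real assume "\<theta> \<in> {0<..<1}"
    then have th: "0 < \<theta>" "\<theta> < 1" by auto
    have "((\<lambda>\<theta>. \<theta> powr (2/3)) has_real_derivative 2/3 * \<theta> powr (2/3 - 1)) (at \<theta>)"
      by (rule has_real_derivative_powr[OF th(1)])
    then have dp: "((\<lambda>\<theta>. \<theta> powr (2/3)) has_vector_derivative 2/3 * \<theta> powr (-1/3)) (at \<theta>)"
      by (simp add: has_real_derivative_iff_has_vector_derivative)
    show "(c has_vector_derivative ?v \<theta>) (at \<theta>)"
      unfolding c_def[abs_def] using bounded_linear.has_vector_derivative[OF bounded_linear_scaleR_left dp, of d]
      by (simp add: has_vector_derivative_def has_derivative_add_const add.commute[of x])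
    show "c \<theta> \<in> collision_free"
      unfolding collision_free_def
    proof (intro CollectI allI impI)
      fix i j :: 'n assume "i \<noteq> j"
      have "0 < \<theta> powr (2/3) * \<rho> i j" using \<rho>[OF \<open>i \<noteq> j\<close>] th by simp
      then have "0 < norm (c \<theta> $ i - c \<theta> $ j)" using sep[OF th, of i j] by linarith
      then show "c \<theta> $ i \<noteq> c \<theta> $ j" by simp
    qed
    have "((\<lambda>\<theta>. \<theta> powr (1/3)) has_real_derivative 1/3 * \<theta> powr (1/3 - 1)) (at \<theta>)"
      by (rule has_real_derivative_powr[OF th(1)])
    then have "((\<lambda>\<theta>. 3 * \<kappa> * \<theta> powr (1/3) + h * \<theta>) has_real_derivative 3 * \<kappa> * (1/3 * \<theta> powr (1/3 - 1)) + h) (at \<theta>)"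
      by (intro DERIV_add DERIV_cmult DERIV_cmult_Id)
    then show "(?Q has_vector_derivative ?Q' \<theta>) (at \<theta>)"
      by (simp add: has_real_derivative_iff_has_vector_derivative)
    have pot: "potential_real m (c \<theta>) \<le> \<kappa>1 * \<theta> powr (-2/3)"
    proof -
      have "potential_real m (c \<theta>) \<le> (\<Sum>(i, j)\<in>{(i, j :: 'n). i < j}. m i * m j / \<rho> i j * \<theta> powr (-2/3))"
        unfolding potential_real_def
      proof (rule sum_mono, clarify)
        fix i j :: 'n assume ij: "i < j"
        then have r: "\<rho> i j > 0" using \<rho> by simp
        have tp: "\<theta> powr (2/3) > 0" using th by simp
        have mm: "0 \<le> m i * m j" using m by (simp add: less_imp_le)
        have pos: "0 < \<theta> powr (2/3) * \<rho> i j" using tp r by simp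
        have "m i * m j / norm (c \<theta> $ i - c \<theta> $ j) \<le> m i * m j / (\<theta> powr (2/3) * \<rho> i j)"
          using sep[OF th, of i j] mm pos by (intro frac_le) auto
        also have "\<dots> = m i * m j / \<rho> i j * inverse (\<theta> powr (2/3))" by (rule frac)
        also have "inverse (\<theta> powr (2/3)) = \<theta> powr (-2/3)" using powr_minus[of \<theta> "2/3"] by simp
        finally show "m i * m j / norm (c \<theta> $ i - c \<theta> $ j) \<le> m i * m j / \<rho> i j * \<theta> powr (-2/3)" .
      qed
      also have "\<dots> = \<kappa>1 * \<theta> powr (-2/3)" by (simp add: \<kappa>1_def sum_distrib_right case_prod_beta)
      finally show ?thesis .
    qed
    have e1: "(\<theta> powr (-1/3))\<^sup>2 = \<theta> powr (-2/3)" by (simp add: power2_eq_square powr_add[symmetric])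
    have e2: "mass_norm m (?v \<theta>) = 2/3 * \<theta> powr (-1/3) * mass_norm m d"
      by (simp add: mass_norm_scale[OF m] mass_scale_simps)
    have "1/2 * (mass_norm m (?v \<theta>))\<^sup>2 = 2/9 * (mass_norm m d)\<^sup>2 * \<theta> powr (-2/3)"
      unfolding e2 power_mult_distrib e1 by (simp add: power2_eq_square)
    then show "1/2 * (mass_norm m (?v \<theta>))\<^sup>2 + potential_real m (c \<theta>) + h \<le> ?Q' \<theta>"
      using pot unfolding \<kappa>_def distrib_right by linarith
  next
    show "continuous_on {0..1} ?Q"
      by (intro continuous_on_add continuous_on_mult continuous_on_const continuous_on_id
        absolutely_continuous_curve_continuous absolutely_continuous_curve_powr) simp
  qed simp
  moreover have "jm_dist m h x y \<le> action m h 0 1 c"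
    by (rule jm_dist_le_action[OF _ ac]) (auto simp: c_def d_def)
  ultimately show ?thesis by (meson ennreal_less_top order_le_less_trans)
qed

section \<open>Competitors near a solution and minimality\<close>

locale nbody_limit_shape =
  conical_potential "scaled_potential m" "scaled_gradient m" "mass_scale m a" \<epsilon>0 K k
  for m :: "'n::{finite,linorder} \<Rightarrow> real" and a :: "('e::euclidean_space, 'n) vec" and \<epsilon>0 K k :: real +
  fixes h :: real
  assumes mass_pos: "\<forall>i. 0 < m i" and two_bodies: "CARD('n) \<ge> 2"
    and cone_free: "\<tau> > 0 \<Longrightarrow> norm (mass_scale m x - \<tau> *\<^sub>R mass_scale m a) \<le> \<epsilon>0 * \<tau> \<Longrightarrow> x \<in> collision_free"
    and h_eq: "h = (mass_norm m a)\<^sup>2 / 2"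
begin

abbreviation M :: "('e, 'n) vec \<Rightarrow> ('e, 'n) vec" where "M \<equiv> mass_scale m"

abbreviation vel :: "(real \<Rightarrow> ('e, 'n) vec) \<Rightarrow> real \<Rightarrow> ('e, 'n) vec" where "vel c t \<equiv> vector_derivative c (at t)"

lemma h_norm: "h = (norm (M a))\<^sup>2 / 2"
  by (simp add: h_eq mass_norm_scale[OF mass_pos])

lemma h_pos: "h > 0"
  using a_nonzero by (simp add: h_norm)

text \<open>What the given motion, defined on a closed half-line, shares with a geodesic ray, which
  is a motion on an open one: the equation of motion with two-sided derivatives after
  \<open>r\<close>, and the limit shape.\<close>

definition escapes :: "real \<Rightarrow> (real \<Rightarrow> ('e, 'n) vec) \<Rightarrow> bool" where
  "escapes r c \<longleftrightarrow> asymptotic_to m c a \<and> (\<forall>t>r. c t \<in> collision_free \<and>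
     (c has_vector_derivative vel c t) (at t) \<and>
     (vel c has_vector_derivative mass_grad m (potential_real m) (c t)) (at t))"

lemma escapes_if_motion:
  assumes "motion m I c" "{r<..} \<subseteq> I" "asymptotic_to m c a"
  shows "escapes r c"
  unfolding escapes_def using motion_interior[OF assms(1) _ assms(2)] assms(3) by auto

lemma escapes_scaled:
  assumes c: "escapes r c" and t: "t > r"
  shows "((\<lambda>t. M (c t)) has_vector_derivative M (vel c t)) (at t)"
    "((\<lambda>t. M (vel c t)) has_vector_derivative scaled_gradient m (M (c t))) (at t)"
proof -
  have d: "(c has_vector_derivative vel c t) (at t)"
    "(vel c has_vector_derivative mass_grad m (potential_real m) (c t)) (at t)"
    and f: "c t \<in> collision_free" using c t by (auto simp: escapes_def)
  show "((\<lambda>t. M (c t)) has_vector_derivative M (vel c t)) (at t)"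
    by (rule bounded_linear.has_vector_derivative[OF bounded_linear_mass_scale d(1)])
  show "((\<lambda>t. M (vel c t)) has_vector_derivative scaled_gradient m (M (c t))) (at t)"
    using bounded_linear.has_vector_derivative[OF bounded_linear_mass_scale d(2), of m]
    by (simp add: mass_grad_potential[OF mass_pos two_bodies f])
qed

lemma escaping_solution_if_escapes:
  assumes c: "escapes r c"
  shows "escaping_solution (scaled_potential m) (scaled_gradient m) (M a) \<epsilon>0 K k
    (\<lambda>t. M (c t)) (\<lambda>t. M (vel c t)) (max r 0 + 1)"
proof
  show "((\<lambda>t. M (c t)) has_vector_derivative M (vel c t)) (at t)"
    "((\<lambda>t. M (vel c t)) has_vector_derivative scaled_gradient m (M (c t))) (at t)"
    if "max r 0 + 1 \<le> t" for t
    using escapes_scaled[OF c, of t] that by auto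
  fix e :: real assume e: "e > 0"
  have "(\<lambda>t. mass_norm m (c t - t *\<^sub>R a)) \<in> o[at_top](\<lambda>t. t)"
    using c by (simp add: escapes_def asymptotic_to_def)
  from landau_o.smallD[OF this e]
  show "\<forall>\<^sub>F t in at_top. norm (M (c t) - t *\<^sub>R M a) \<le> e * t"
    using eventually_ge_at_top[of 0]
    by eventually_elim (simp add: mass_norm_scale[OF mass_pos] mass_scale_simps)
qed simp

text \<open>\<open>\<sigma>\<close> is an antiderivative of the Lagrangian plus \<open>h\<close> along \<open>c\<close>, which equals the squared
  speed by conservation of energy.\<close>

definition regular :: "(real \<Rightarrow> ('e, 'n) vec) \<Rightarrow> (real \<Rightarrow> real) \<Rightarrow> real \<Rightarrow> bool" where
  "regular c \<sigma> T \<longleftrightarrow> T > 0 \<and> (\<forall>t\<ge>T. c t \<in> collision_free \<and>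
     (c has_vector_derivative vel c t) (at t) \<and>
     ((\<lambda>t. M (vel c t)) has_vector_derivative scaled_gradient m (M (c t))) (at t) \<and>
     (\<sigma> has_real_derivative (norm (M (vel c t)))\<^sup>2) (at t) \<and>
     (norm (M (vel c t)))\<^sup>2 = 2 * h + 2 * potential_real m (c t) \<and>
     norm (M (c t) - t *\<^sub>R M a) \<le> \<epsilon>0 / 2 * t)"

lemma regularD:
  assumes "regular c \<sigma> T"
  shows "T > 0"
    and "t \<ge> T \<Longrightarrow> c t \<in> collision_free"
    and "t \<ge> T \<Longrightarrow> (c has_vector_derivative vel c t) (at t)"
    and "t \<ge> T \<Longrightarrow> ((\<lambda>t. M (vel c t)) has_vector_derivative scaled_gradient m (M (c t))) (at t)"
    and "t \<ge> T \<Longrightarrow> (\<sigma> has_real_derivative (norm (M (vel c t)))\<^sup>2) (at t)"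
    and "t \<ge> T \<Longrightarrow> (norm (M (vel c t)))\<^sup>2 = 2 * h + 2 * potential_real m (c t)"
    and "t \<ge> T \<Longrightarrow> norm (M (c t) - t *\<^sub>R M a) \<le> \<epsilon>0 / 2 * t"
  using assms by (auto simp: regular_def)

lemma velocity_continuous:
  assumes "\<And>t. t \<in> I \<Longrightarrow> ((\<lambda>t. M (vel c t)) has_vector_derivative g t) (at t)"
  shows "continuous_on I (vel c)"
proof -
  have "continuous_on I (\<lambda>t. M (vel c t))"
    using has_vector_derivative_continuous[OF assms] by (intro continuous_at_imp_continuous_on) auto
  then have "continuous_on I (\<lambda>t. mass_scale (\<lambda>i. inverse (m i)) (M (vel c t)))"
    by (rule bounded_linear.continuous_on[OF bounded_linear_mass_scale])
  then show ?thesis by (simp add: mass_scale_inverse(1)[OF mass_pos])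
qed

text \<open>The competitor is \<open>c\<close> plus an affine displacement; the first-order terms only see the
  endpoints, since \<open>c\<close> is an extremal.\<close>

lemma jm_dist_perturbed:
  assumes c: "regular c \<sigma> T" and st: "T \<le> s" "s < t"
    and V: "norm (M w1) \<le> V" "norm (M w2) \<le> V" "V \<le> \<epsilon>0 / 2 * s"
  defines "X \<equiv> \<sigma> t - \<sigma> s + (M (vel c t) \<bullet> M w2 - M (vel c s) \<bullet> M w1)
      + (norm (M (w2 - w1)))\<^sup>2 / (2 * (t - s)) + (t - s) * (K * V\<^sup>2 / s ^ 3)"
  shows "jm_dist m h (c s + w1) (c t + w2) \<le> ennreal X" "0 \<le> X"
proof -
  note r = regularD[OF c]
  have s0: "s > 0" using r(1) st by simp
  have V0: "V \<ge> 0" using V(1) norm_ge_zero order_trans by blast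
  define \<omega> where "\<omega> = (1 / (t - s)) *\<^sub>R (w2 - w1)"
  define v where "v \<tau> = w1 + (\<tau> - s) *\<^sub>R \<omega>" for \<tau>
  have vs: "v s = w1" by (simp add: v_def)
  have vt: "v t = w2" using st by (simp add: v_def \<omega>_def)
  have dv: "(v has_vector_derivative \<omega>) (at \<tau>)" for \<tau>
    unfolding v_def[abs_def] by (auto intro!: derivative_eq_intros)
  have dMv: "((\<lambda>\<tau>. M (v \<tau>)) has_vector_derivative M \<omega>) (at \<tau>)" for \<tau>
    by (rule bounded_linear.has_vector_derivative[OF bounded_linear_mass_scale dv])
  have vV: "norm (M (v \<tau>)) \<le> V" if "\<tau> \<in> {s..t}" for \<tau>
  proof -
    define l where "l = (\<tau> - s) / (t - s)"
    have l: "0 \<le> l" "l \<le> 1" using that st by (auto simp: l_def)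
    have "v \<tau> = (1 - l) *\<^sub>R w1 + l *\<^sub>R w2"
      by (simp add: v_def \<omega>_def l_def algebra_simps diff_divide_distrib)
    then have "norm (M (v \<tau>)) \<le> norm ((1 - l) *\<^sub>R M w1) + norm (l *\<^sub>R M w2)"
      by (simp only: mass_scale_simps norm_triangle_ineq)
    also have "\<dots> = (1 - l) * norm (M w1) + l * norm (M w2)" using l by simp
    also have "\<dots> \<le> (1 - l) * V + l * V" using l V by (intro add_mono mult_left_mono) auto
    finally show ?thesis by (simp add: algebra_simps)
  qed
  define d where "d \<tau> = c \<tau> + v \<tau>" for \<tau>
  define \<kappa> where "\<kappa> = (norm (M \<omega>))\<^sup>2 / 2 + K * V\<^sup>2 / s ^ 3"
  \<comment> \<open>By the equation of motion the derivative of
    \<open>M (vel c \<tau>) \<bullet> M (v \<tau>)\<close> is the sum of the first-order terms of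
    kinetic and potential energy, which therefore integrate to boundary values. The constant
    \<kappa> covers the quadratic terms.\<close>
  define Q where "Q \<tau> = \<sigma> \<tau> + M (vel c \<tau>) \<bullet> M (v \<tau>) + \<kappa> * \<tau>" for \<tau>
  define Q' where "Q' \<tau> = (norm (M (vel c \<tau>)))\<^sup>2 + (M (vel c \<tau>) \<bullet> M \<omega> + scaled_gradient m (M (c \<tau>)) \<bullet> M (v \<tau>)) + \<kappa>" for \<tau>
  have dQ: "(Q has_real_derivative Q' \<tau>) (at \<tau>)" if "\<tau> \<in> {s..t}" for \<tau>
  proof -
    have \<tau>: "\<tau> \<ge> T" using that st by simp
    have "((\<lambda>\<tau>. M (vel c \<tau>) \<bullet> M (v \<tau>)) has_vector_derivative (M (vel c \<tau>) \<bullet> M \<omega> + scaled_gradient m (M (c \<tau>)) \<bullet> M (v \<tau>))) (at \<tau>)"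
      using bounded_bilinear.has_vector_derivative[OF bounded_bilinear_inner r(4)[OF \<tau>] dMv] .
    then show ?thesis unfolding Q_def[abs_def] Q'_def
      by (intro DERIV_add r(5)[OF \<tau>] DERIV_cmult_Id) (simp add: has_real_derivative_iff_has_vector_derivative)
  qed
  have cone: "norm (M (c \<tau>) - \<tau> *\<^sub>R M a) \<le> \<epsilon>0 * \<tau>" "norm (M (v \<tau>)) \<le> \<epsilon>0 * \<tau>"
    "norm (M (d \<tau>) - \<tau> *\<^sub>R M a) \<le> \<epsilon>0 * \<tau>" if "\<tau> \<in> {s..t}" for \<tau>
  proof -
    have \<tau>: "\<tau> \<ge> T" "\<tau> > 0" using that st s0 by auto
    have "\<epsilon>0 / 2 * s \<le> \<epsilon>0 / 2 * \<tau>" using that \<epsilon>0_pos by (intro mult_left_mono) auto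
    then have 1: "norm (M (v \<tau>)) \<le> \<epsilon>0 / 2 * \<tau>" using vV[OF that] V(3) by linarith
    note 2 = r(7)[OF \<tau>(1)]
    have 3: "\<epsilon>0 * \<tau> = \<epsilon>0 / 2 * \<tau> + \<epsilon>0 / 2 * \<tau>" "0 \<le> \<epsilon>0 / 2 * \<tau>" using \<epsilon>0_pos \<tau> by auto
    show "norm (M (c \<tau>) - \<tau> *\<^sub>R M a) \<le> \<epsilon>0 * \<tau>" "norm (M (v \<tau>)) \<le> \<epsilon>0 * \<tau>" using 1 2 3 by linarith+
    have "M (d \<tau>) - \<tau> *\<^sub>R M a = (M (c \<tau>) - \<tau> *\<^sub>R M a) + M (v \<tau>)" by (simp add: d_def mass_scale_simps)
    then have "norm (M (d \<tau>) - \<tau> *\<^sub>R M a) \<le> norm (M (c \<tau>) - \<tau> *\<^sub>R M a) + norm (M (v \<tau>))"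
      by (simp only: norm_triangle_ineq)
    then show "norm (M (d \<tau>) - \<tau> *\<^sub>R M a) \<le> \<epsilon>0 * \<tau>" using 1 2 3 by linarith
  qed
  have le: "1/2 * (mass_norm m (vel c \<tau> + \<omega>))\<^sup>2 + potential_real m (d \<tau>) + h \<le> Q' \<tau>" if "\<tau> \<in> {s..t}" for \<tau>
  proof -
    have \<tau>: "\<tau> \<ge> T" "\<tau> > 0" using that st s0 by auto
    have "scaled_potential m (M (c \<tau>) + M (v \<tau>)) \<le> scaled_potential m (M (c \<tau>)) + scaled_gradient m (M (c \<tau>)) \<bullet> M (v \<tau>)
        + K * (norm (M (v \<tau>)))\<^sup>2 / \<tau> ^ 3"
      using U_quadratic[OF \<tau>(2) cone(1,2)[OF that]] by (simp add: abs_le_iff)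
    also have "K * (norm (M (v \<tau>)))\<^sup>2 / \<tau> ^ 3 \<le> K * V\<^sup>2 / s ^ 3"
      using vV[OF that] K_pos s0 that V0 by (intro frac_le mult_left_mono power_mono) auto
    finally have U: "potential_real m (d \<tau>) \<le> potential_real m (c \<tau>) + scaled_gradient m (M (c \<tau>)) \<bullet> M (v \<tau>) + K * V\<^sup>2 / s ^ 3"
      by (simp add: d_def mass_scale_simps[symmetric] scaled_potential[OF mass_pos])
    have "(mass_norm m (vel c \<tau> + \<omega>))\<^sup>2 = (norm (M (vel c \<tau>)))\<^sup>2 + 2 * (M (vel c \<tau>) \<bullet> M \<omega>) + (norm (M \<omega>))\<^sup>2"
      unfolding mass_norm_scale[OF mass_pos] mass_scale_simps power2_norm_eq_inner
      by (simp add: inner_add_left inner_add_right inner_commute[of "M \<omega>" "M (vel c \<tau>)"])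
    then show ?thesis using U r(6)[OF \<tau>(1)] unfolding Q'_def \<kappa>_def by linarith
  qed
  have Q'0: "0 \<le> Q' \<tau>" if "\<tau> \<in> {s..t}" for \<tau>
  proof -
    have "0 \<le> 1/2 * (mass_norm m (vel c \<tau> + \<omega>))\<^sup>2" by simp
    then show ?thesis using le[OF that] potential_real_nonneg[OF mass_pos, of "d \<tau>"] h_pos by linarith
  qed
  have dd: "(d has_vector_derivative vel c \<tau> + \<omega>) (at \<tau>)" if "\<tau> \<in> {s..t}" for \<tau>
    unfolding d_def[abs_def] using r(3) that st by (intro has_vector_derivative_add dv) auto
  have X: "X = Q t - Q s"
  proof -
    have "(t - s) * ((norm (M \<omega>))\<^sup>2 / 2) = (norm (M (w2 - w1)))\<^sup>2 / (2 * (t - s))"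
    proof -
      have "norm (M \<omega>) = norm (M (w2 - w1)) / (t - s)"
        using st unfolding \<omega>_def mass_scale_simps(3) by simp
      then show ?thesis using st by (simp add: power_divide power2_eq_square)
    qed
    moreover have "\<kappa> * t - \<kappa> * s = (t - s) * ((norm (M \<omega>))\<^sup>2 / 2) + (t - s) * (K * V\<^sup>2 / s ^ 3)"
      by (simp add: \<kappa>_def algebra_simps diff_divide_distrib)
    ultimately show ?thesis unfolding X_def Q_def vs vt by argo
  qed
  have "Q s \<le> Q t"
    using st dQ Q'0 by (intro DERIV_nonneg_imp_nondecreasing[of s t Q]) (auto intro!: exI)
  then show "0 \<le> X" by (simp add: X)
  have "absolutely_continuous_curve s t d"
  proof (rule absolutely_continuous_curve_C1)
    show "(d has_vector_derivative vel c \<tau> + \<omega>) (at \<tau> within {s..t})" if "\<tau> \<in> {s..t}" for \<tau>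
      using dd[OF that] by (rule has_vector_derivative_at_within)
    show "continuous_on {s..t} (\<lambda>\<tau>. vel c \<tau> + \<omega>)"
      using r(4) st by (intro continuous_intros velocity_continuous[where g = "\<lambda>t. scaled_gradient m (M (c t))"]) auto
  qed
  then have "jm_dist m h (c s + w1) (c t + w2) \<le> action m h s t d"
    using st by (intro jm_dist_le_action) (auto simp: d_def vs vt)
  also have "\<dots> \<le> ennreal (Q t - Q s)"
  proof (rule action_le[OF mass_pos less_imp_le[OF h_pos]])
    show "continuous_on {s..t} Q" using DERIV_isCont[OF dQ] by (intro continuous_at_imp_continuous_on) auto
    fix \<tau> assume "\<tau> \<in> {s<..<t}"
    then have \<tau>: "\<tau> \<in> {s..t}" by auto
    show "(d has_vector_derivative vel c \<tau> + \<omega>) (at \<tau>)" by (rule dd[OF \<tau>])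
    show "d \<tau> \<in> collision_free" by (rule cone_free[OF _ cone(3)[OF \<tau>]]) (use \<tau> s0 in auto)
    show "(Q has_vector_derivative Q' \<tau>) (at \<tau>)" using dQ[OF \<tau>] by (simp add: has_real_derivative_iff_has_vector_derivative)
    show "1/2 * (mass_norm m (vel c \<tau> + \<omega>))\<^sup>2 + potential_real m (d \<tau>) + h \<le> Q' \<tau>" by (rule le[OF \<tau>])
  qed (use st in simp)
  finally show "jm_dist m h (c s + w1) (c t + w2) \<le> ennreal X" by (simp add: X)
qed

definition minimizing :: "(real \<Rightarrow> ('e, 'n) vec) \<Rightarrow> (real \<Rightarrow> real) \<Rightarrow> real \<Rightarrow> bool" where
  "minimizing c \<sigma> T \<longleftrightarrow> regular c \<sigma> T \<and> (\<forall>s t. T \<le> s \<longrightarrow> s < t \<longrightarrow>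
     0 \<le> \<sigma> t - \<sigma> s \<and> jm_dist m h (c s) (c t) = ennreal (\<sigma> t - \<sigma> s) \<and> action m h s t c = ennreal (\<sigma> t - \<sigma> s))"

lemma exists_minimizing:
  assumes c: "escapes r c"
  shows "\<exists>\<sigma> T. T > r \<and> minimizing c \<sigma> T"
proof -
  interpret E: escaping_solution "scaled_potential m" "scaled_gradient m" "M a" \<epsilon>0 K k "\<lambda>t. M (c t)" "\<lambda>t. M (vel c t)" "max r 0 + 1"
    by (rule escaping_solution_if_escapes[OF c])
  obtain t1 \<sigma> where t1: "t1 \<ge> max r 0 + 1" "\<And>t. t \<ge> t1 \<Longrightarrow> (\<sigma> has_real_derivative (norm (M (vel c t)))\<^sup>2) (at t)"
    and cal: "\<And>s0 s1 d s t. s \<ge> t1 \<Longrightarrow> t \<ge> t1 \<Longrightarrow> s0 \<le> s1 \<Longrightarrow> absolutely_continuous_curve s0 s1 d \<Longrightarrow>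
      d s0 = M (c s) \<Longrightarrow> d s1 = M (c t) \<Longrightarrow>
      \<exists>u g1 g2. s0 \<le> u \<and> u \<le> s1 \<and> \<sigma> t - \<sigma> s \<le> (g1 u - g1 s0) + (g2 s1 - g2 u) \<and>
        subaction (scaled_potential m) ((norm (M a))\<^sup>2 / 2) d s0 u g1 \<and> subaction (scaled_potential m) ((norm (M a))\<^sup>2 / 2) d u s1 g2"
    using E.eventually_calibrated by blast
  have "\<epsilon>0 / 2 > 0" using \<epsilon>0_pos by simp
  from eventually_conj[OF E.energy_eventually E.asymptotic[OF this]]
  obtain T2 where T2: "\<And>t. t \<ge> T2 \<Longrightarrow> (norm (M (vel c t)))\<^sup>2 = (norm (M a))\<^sup>2 + 2 * scaled_potential m (M (c t)) \<and>
      norm (M (c t) - t *\<^sub>R M a) \<le> \<epsilon>0 / 2 * t"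
    unfolding eventually_at_top_linorder by blast
  define T where "T = max t1 T2"
  have T: "T \<ge> t1" "T \<ge> T2" "T > r" "T > 0" using t1(1) by (auto simp: T_def)
  have reg: "regular c \<sigma> T"
    unfolding regular_def
  proof (intro conjI allI impI)
    fix t assume t: "t \<ge> T"
    have tr: "t > r" "t \<ge> t1" "t \<ge> T2" using t T by auto
    show "c t \<in> collision_free" "(c has_vector_derivative vel c t) (at t)" using c tr by (auto simp: escapes_def)
    show "((\<lambda>t. M (vel c t)) has_vector_derivative scaled_gradient m (M (c t))) (at t)" by (rule escapes_scaled(2)[OF c tr(1)])
    show "(\<sigma> has_real_derivative (norm (M (vel c t)))\<^sup>2) (at t)" by (rule t1(2)[OF tr(2)])
    show "(norm (M (vel c t)))\<^sup>2 = 2 * h + 2 * potential_real m (c t)" "norm (M (c t) - t *\<^sub>R M a) \<le> \<epsilon>0 / 2 * t"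
      using T2[OF tr(3)] by (simp_all add: h_norm scaled_potential[OF mass_pos])
  qed (rule T)
  have ge: "ennreal (\<sigma> t - \<sigma> s) \<le> action m h s0 s1 d"
    if st: "T \<le> s" "T \<le> t" and d: "s0 \<le> s1" "absolutely_continuous_curve s0 s1 d" "d s0 = c s" "d s1 = c t" for s t s0 s1 d
  proof -
    let ?d = "\<lambda>r. M (d r)"
    obtain B where B: "\<And>v. norm (M v) \<le> B * norm v"
      using bounded_linear.bounded[OF bounded_linear_mass_scale, of m] by (metis mult.commute)
    have "absolutely_continuous_curve s0 s1 ?d"
      by (rule absolutely_continuous_curve_lipschitz_compose[OF d(2) zero_less_one, where L = B])
        (use B in \<open>simp add: mass_scale_simps(2)[symmetric]\<close>)
    from cal[OF _ _ d(1) this, of s t]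
    obtain u g1 g2 where u: "s0 \<le> u" "u \<le> s1" "\<sigma> t - \<sigma> s \<le> (g1 u - g1 s0) + (g2 s1 - g2 u)"
      "subaction (scaled_potential m) ((norm (M a))\<^sup>2 / 2) ?d s0 u g1" "subaction (scaled_potential m) ((norm (M a))\<^sup>2 / 2) ?d u s1 g2"
      using st T(1) d by auto
    have piece: "ennreal (g q1 - g q0) \<le> action m h q0 q1 d"
      if q: "s0 \<le> q0" "q0 \<le> q1" "q1 \<le> s1" "subaction (scaled_potential m) ((norm (M a))\<^sup>2 / 2) ?d q0 q1 g" for q0 q1 g
    proof (rule action_ge[OF mass_pos less_imp_le[OF h_pos] q(2)])
      show "absolutely_continuous_curve q0 q1 d" using d(2) q by (auto intro: absolutely_continuous_curve_subinterval)
      show "absolutely_continuous_curve q0 q1 g" using q(4) by (simp add: subaction_def)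
      fix r v e assume r: "r \<in> {q0<..<q1}" "(d has_vector_derivative v) (at r)" "(g has_vector_derivative e) (at r)"
      have "(?d has_vector_derivative M v) (at r)"
        by (rule bounded_linear.has_vector_derivative[OF bounded_linear_mass_scale r(2)])
      with q(4) r(1,3) have "e \<le> (norm (M v))\<^sup>2 / 2 + scaled_potential m (?d r) + (norm (M a))\<^sup>2 / 2"
        unfolding subaction_def by blast
      then show "e \<le> 1/2 * (mass_norm m v)\<^sup>2 + potential_real m (d r) + h"
        by (simp add: mass_norm_scale[OF mass_pos] scaled_potential[OF mass_pos] h_norm)
    qed
    \<comment> \<open>Either increment may be negative and is then truncated by
      \<open>ennreal\<close>, so the sum splits only with an inequality.\<close>
    have "ennreal (\<sigma> t - \<sigma> s) \<le> ennreal ((g1 u - g1 s0) + (g2 s1 - g2 u))" by (rule ennreal_leI[OF u(3)])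
    also have "\<dots> \<le> ennreal (g1 u - g1 s0) + ennreal (g2 s1 - g2 u)" by (auto simp: ennreal_plus_if intro!: ennreal_leI)
    also have "\<dots> \<le> action m h s0 u d + action m h u s1 d"
      using u by (intro add_mono piece) auto
    also have "\<dots> = action m h s0 s1 d" using u by (intro action_split[symmetric])
    finally show ?thesis .
  qed
  have "0 \<le> \<sigma> t - \<sigma> s \<and> jm_dist m h (c s) (c t) = ennreal (\<sigma> t - \<sigma> s) \<and> action m h s t c = ennreal (\<sigma> t - \<sigma> s)"
    if st: "T \<le> s" "s < t" for s t
  proof (intro conjI antisym)
    note r = regularD[OF reg]
    have mono: "\<sigma> s \<le> \<sigma> t"
      using st by (intro DERIV_nonneg_imp_nondecreasing[of s t \<sigma>]) (auto intro!: exI r(5))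
    then show "0 \<le> \<sigma> t - \<sigma> s" by simp
    have "absolutely_continuous_curve s t c"
    proof (rule absolutely_continuous_curve_C1)
      show "(c has_vector_derivative vel c \<tau>) (at \<tau> within {s..t})" if "\<tau> \<in> {s..t}" for \<tau>
        using r(3)[of \<tau>] that st by (auto intro: has_vector_derivative_at_within)
      show "continuous_on {s..t} (vel c)"
        using r(4) st by (intro velocity_continuous[where g = "\<lambda>t. scaled_gradient m (M (c t))"]) auto
    qed
    then show "ennreal (\<sigma> t - \<sigma> s) \<le> action m h s t c" using st by (intro ge) auto
    show "ennreal (\<sigma> t - \<sigma> s) \<le> jm_dist m h (c s) (c t)"
      using st by (intro jm_dist_greatest ge) auto
    show le: "action m h s t c \<le> ennreal (\<sigma> t - \<sigma> s)"
    proof (rule action_le[OF mass_pos less_imp_le[OF h_pos]])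
      show "continuous_on {s..t} \<sigma>"
        using DERIV_isCont[OF r(5)] st by (intro continuous_at_imp_continuous_on) auto
      fix \<tau> assume "\<tau> \<in> {s<..<t}"
      then have \<tau>: "\<tau> \<ge> T" using st by auto
      show "(c has_vector_derivative vel c \<tau>) (at \<tau>)" "c \<tau> \<in> collision_free" by (rule r(3)[OF \<tau>], rule r(2)[OF \<tau>])
      show "(\<sigma> has_vector_derivative (norm (M (vel c \<tau>)))\<^sup>2) (at \<tau>)"
        using r(5)[OF \<tau>] by (simp add: has_real_derivative_iff_has_vector_derivative)
      show "1/2 * (mass_norm m (vel c \<tau>))\<^sup>2 + potential_real m (c \<tau>) + h \<le> (norm (M (vel c \<tau>)))\<^sup>2"
        using r(6)[OF \<tau>] by (simp add: mass_norm_scale[OF mass_pos])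
    qed (use st in simp)
    have "jm_dist m h (c s) (c t) \<le> action m h s t c"
      using st \<open>absolutely_continuous_curve s t c\<close> by (intro jm_dist_le_action) auto
    then show "jm_dist m h (c s) (c t) \<le> ennreal (\<sigma> t - \<sigma> s)" using le by (rule order_trans)
  qed
  then have "minimizing c \<sigma> T" using reg by (simp add: minimizing_def)
  then show ?thesis using T(3) by blast
qed

end

section \<open>Busemann functions of geodesic rays\<close>

lemma tendsto_at_top_antimono_bounded:
  fixes F :: "real \<Rightarrow> real"
  assumes mono: "\<And>u v. r < u \<Longrightarrow> u \<le> v \<Longrightarrow> F v \<le> F u" and bdd: "\<And>u. r < u \<Longrightarrow> B \<le> F u"
  shows "\<exists>l. (F \<longlongrightarrow> l) at_top"
proof
  define l where "l = Inf (F ` {r<..})"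
  have bb: "bdd_below (F ` {r<..})" using bdd by (auto intro!: bdd_belowI[of _ B])
  show "(F \<longlongrightarrow> l) at_top"
  proof (rule order_tendstoI)
    fix y assume y: "y < l"
    have lb: "l \<le> F u" if "r < u" for u unfolding l_def using that by (intro cInf_lower[OF _ bb]) auto
    show "\<forall>\<^sub>F u in at_top. y < F u"
      using eventually_gt_at_top[of r] by eventually_elim (rule less_le_trans[OF y lb])
  next
    fix y assume "l < y"
    then obtain u where u: "r < u" "F u < y"
      using cInf_less_iff[OF _ bb, of y] unfolding l_def by auto
    show "\<forall>\<^sub>F v in at_top. F v < y"
      using eventually_ge_at_top[of u] by eventually_elim (use mono u in fastforce)
  qed
qed

context nbody_limit_shape
begin

abbreviation dist_jm :: "('e, 'n) vec \<Rightarrow> ('e, 'n) vec \<Rightarrow> real" where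
  "dist_jm x y \<equiv> enn2real (jm_dist m h x y)"

text \<open>\<open>enn2real\<close> sends infinity to 0, which would spoil the inequality;
  finiteness is therefore carried along.\<close>

lemma dist_jm_triangle:
  assumes "jm_dist m h x y < top" "jm_dist m h y z < top"
  shows "jm_dist m h x z < top" "dist_jm x z \<le> dist_jm x y + dist_jm y z"
proof -
  have le: "jm_dist m h x z \<le> jm_dist m h x y + jm_dist m h y z" by (rule jm_dist_triangle[OF mass_pos])
  also have "\<dots> < top" using assms by simp
  finally show "jm_dist m h x z < top" .
  have "dist_jm x z \<le> enn2real (jm_dist m h x y + jm_dist m h y z)"
    using le assms by (intro enn2real_mono) auto
  also have "\<dots> = dist_jm x y + dist_jm y z" using assms by (intro enn2real_plus) auto
  finally show "dist_jm x z \<le> dist_jm x y + dist_jm y z" .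
qed

lemma dist_jm_leI:
  assumes "jm_dist m h x y \<le> ennreal r" "0 \<le> r"
  shows "jm_dist m h x y < top" "dist_jm x y \<le> r"
  using assms by (auto intro: order_le_less_trans enn2real_leI)

lemma mass_scale_bound: "\<exists>B>0. \<forall>v. norm (M v) \<le> B * norm v"
  using linear_bounded_pos[OF linear_mass_scale] by blast

end

section \<open>Finiteness and additivity of the distance along a ray\<close>

locale geodesic_ray = nbody_limit_shape m a \<epsilon>0 K k h
  for m :: "'n::{finite,linorder} \<Rightarrow> real" and a :: "('e::euclidean_space, 'n) vec" and \<epsilon>0 K k h :: real +
  fixes c :: "real \<Rightarrow> ('e, 'n) vec" and r :: real
  assumes ray: "hyperbolic_geodesic_ray m h r c" and shape: "asymptotic_to m c a"
begin

lemma escapes_ray: "escapes r c"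
proof (rule escapes_if_motion[OF _ order_refl shape])
  show "motion m {r<..} c" using ray by (simp add: hyperbolic_geodesic_ray_def hyperbolic_motion_def)
qed

lemma ray_energy: "t > r \<Longrightarrow> 1/2 * (mass_norm m (vel c t))\<^sup>2 - potential_real m (c t) = h"
  using ray by (auto simp: hyperbolic_geodesic_ray_def energy_def at_within_open[OF _ open_greaterThan])

lemma ray_action: "t > r \<Longrightarrow> action m h r t c = jm_dist m h (c r) (c t)"
  using ray by (simp add: hyperbolic_geodesic_ray_def)

lemma ray_absolutely_continuous: "t > r \<Longrightarrow> absolutely_continuous_curve r t c"
  using ray by (simp add: hyperbolic_geodesic_ray_def)

text \<open>By conservation of energy the integrand of the action is the squared speed, which is
  continuous on compact intervals inside the open half-line.\<close>

lemma ray_action_finite: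
  assumes u: "r < u" "u < v"
  shows "action m h u v c < top"
proof -
  let ?f = "\<lambda>t. (norm (M (vel c t)))\<^sup>2"
  define Q where "Q t = integral {u..t} ?f" for t
  have cont: "continuous_on {u..v} ?f"
    using has_vector_derivative_continuous[OF escapes_scaled(2)[OF escapes_ray]] u
    by (intro continuous_intros continuous_at_imp_continuous_on) auto
  have dQ: "(Q has_vector_derivative ?f t) (at t within {u..v})" if "t \<in> {u..v}" for t
    unfolding Q_def using integral_has_vector_derivative[OF cont that] .
  have "action m h u v c \<le> ennreal (Q v - Q u)"
  proof (rule action_le[OF mass_pos less_imp_le[OF h_pos]])
    show "continuous_on {u..v} Q"
      using has_vector_derivative_continuous[OF dQ] by (auto simp: continuous_on_eq_continuous_within)
    fix t assume t: "t \<in> {u<..<v}"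
    then have tr: "t > r" using u by simp
    show "(c has_vector_derivative vel c t) (at t)" "c t \<in> collision_free"
      using escapes_ray tr by (auto simp: escapes_def)
    show "(Q has_vector_derivative ?f t) (at t)" using dQ[of t] t by (simp add: at_within_Icc_at)
    show "1/2 * (mass_norm m (vel c t))\<^sup>2 + potential_real m (c t) + h \<le> ?f t"
      using ray_energy[OF tr] by (simp add: mass_norm_scale[OF mass_pos])
  qed (use u in simp)
  then show ?thesis by (meson ennreal_less_top order_le_less_trans)
qed

text \<open>The initial point of the ray may be a collision. By continuity, pairs that are apart
  there have moved by less than their distance at nearby times, and the ejection estimate
  applies.\<close>

lemma ray_finite_start: "\<exists>u0>r. \<forall>u. r < u \<longrightarrow> u < u0 \<longrightarrow> jm_dist m h (c r) (c u) < top"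
proof -
  have "continuous_on {r..r + 1} c"
    by (rule absolutely_continuous_curve_continuous[OF ray_absolutely_continuous]) simp
  then have lim: "(c \<longlongrightarrow> c r) (at_right r)"
    by (intro continuous_on_Icc_at_rightD[of r "r + 1"]) auto
  have ev: "\<forall>\<^sub>F u in at_right r. c r $ i \<noteq> c r $ j \<longrightarrow>
      norm ((c u $ i - c u $ j) - (c r $ i - c r $ j)) < norm (c r $ i - c r $ j)" for i j
  proof (cases "c r $ i = c r $ j")
    case False
    have "((\<lambda>u. norm ((c u $ i - c u $ j) - (c r $ i - c r $ j))) \<longlongrightarrow>
        norm ((c r $ i - c r $ j) - (c r $ i - c r $ j))) (at_right r)"
      by (intro tendsto_intros lim)
    then have "((\<lambda>u. norm ((c u $ i - c u $ j) - (c r $ i - c r $ j))) \<longlongrightarrow> 0) (at_right r)" by simp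
    from order_tendstoD(2)[OF this, of "norm (c r $ i - c r $ j)"] False show ?thesis by simp
  qed simp
  have "\<forall>\<^sub>F u in at_right r. \<forall>i j. c r $ i \<noteq> c r $ j \<longrightarrow>
      norm ((c u $ i - c u $ j) - (c r $ i - c r $ j)) < norm (c r $ i - c r $ j)"
    by (intro eventually_all_finite) (rule ev)
  then obtain u0 where u0: "u0 > r" "\<And>u. r < u \<Longrightarrow> u < u0 \<Longrightarrow> \<forall>i j. c r $ i \<noteq> c r $ j \<longrightarrow>
      norm ((c u $ i - c u $ j) - (c r $ i - c r $ j)) < norm (c r $ i - c r $ j)"
    unfolding eventually_at_right_field by blast
  have "jm_dist m h (c r) (c u) < top" if u: "r < u" "u < u0" for u
  proof (rule jm_dist_finite_ejection[OF mass_pos less_imp_le[OF h_pos]])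
    show "c u \<in> collision_free" using escapes_ray u by (auto simp: escapes_def)
  qed (use u0(2)[OF u] in blast)
  then show ?thesis using u0(1) by blast
qed

text \<open>The ray minimizes from its initial point, and its action splits at \<open>u\<close>;
  this gives the reverse triangle inequality along the ray.\<close>

lemma ray_distance:
  assumes u: "r < u" "u < v"
  shows "jm_dist m h (c u) (c v) < top" "jm_dist m h (c r) (c u) < top"
    "dist_jm (c r) (c u) + dist_jm (c u) (c v) \<le> dist_jm (c r) (c v)"
proof -
  have fin: "jm_dist m h (c r) (c w) < top" if "r < w" for w
  proof -
    obtain u0 where u0: "u0 > r" "\<And>u. r < u \<Longrightarrow> u < u0 \<Longrightarrow> jm_dist m h (c r) (c u) < top"
      using ray_finite_start by blast
    define q where "q = (r + min u0 w) / 2"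
    have q: "r < q" "q < u0" "q < w" using u0(1) that by (auto simp: q_def)
    have "action m h r w c = action m h r q c + action m h q w c"
      using q by (intro action_split) auto
    also have "\<dots> < top" using u0(2)[OF q(1,2)] ray_action_finite[OF q(1,3)] ray_action[OF q(1)] by simp
    finally show ?thesis using ray_action[OF that] by simp
  qed
  show 1: "jm_dist m h (c r) (c u) < top" by (rule fin[OF u(1)])
  have ac: "absolutely_continuous_curve u v c"
    using ray_absolutely_continuous[of v] u by (auto intro: absolutely_continuous_curve_subinterval)
  have le: "jm_dist m h (c u) (c v) \<le> action m h u v c" using u ac by (intro jm_dist_le_action) auto
  show 2: "jm_dist m h (c u) (c v) < top" using le ray_action_finite[OF u] by (rule order_le_less_trans)
  have 3: "jm_dist m h (c r) (c v) < top" using fin u by simp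
  have "jm_dist m h (c r) (c u) + jm_dist m h (c u) (c v) \<le> action m h r u c + action m h u v c"
    using le ray_action[OF u(1)] by (intro add_mono) auto
  also have "\<dots> = jm_dist m h (c r) (c v)"
    using u ray_action[of v] action_split[of r u v m h c] by simp
  finally have "enn2real (jm_dist m h (c r) (c u) + jm_dist m h (c u) (c v)) \<le> dist_jm (c r) (c v)"
    using 3 by (intro enn2real_mono) auto
  then show "dist_jm (c r) (c u) + dist_jm (c u) (c v) \<le> dist_jm (c r) (c v)"
    using 1 2 by (simp add: enn2real_plus)
qed

text \<open>Points from which the ray can be reached at finite cost, so that \<open>enn2real\<close> is harmless.\<close>

definition reach :: "('e, 'n) vec set" where
  "reach = {x. \<exists>u>r. jm_dist m h x (c u) < top}"

definition defect :: "('e, 'n) vec \<Rightarrow> real \<Rightarrow> real" where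
  "defect x u = dist_jm x (c u) - dist_jm (c u) (c r)"

lemma reach_finite:
  assumes "x \<in> reach" "r < u" shows "jm_dist m h x (c u) < top"
proof -
  obtain v where v: "r < v" "jm_dist m h x (c v) < top" using assms(1) by (auto simp: reach_def)
  consider "u = v" | "u < v" | "v < u" by linarith
  then show ?thesis
  proof cases
    case 2
    have "jm_dist m h (c v) (c u) < top" using ray_distance(1)[OF assms(2) 2] by (simp add: jm_dist_sym[OF mass_pos])
    then show ?thesis using dist_jm_triangle(1)[OF v(2)] by blast
  next
    case 3
    then show ?thesis using dist_jm_triangle(1)[OF v(2) ray_distance(1)[OF v(1) 3]] by blast
  qed (use v in simp)
qed

lemma reach_if_finite: "y \<in> reach \<Longrightarrow> jm_dist m h x y < top \<Longrightarrow> x \<in> reach"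
  using dist_jm_triangle(1)[of x y "c (r + 1)"] reach_finite[of y "r + 1"]
  by (auto simp: reach_def intro!: exI[of _ "r + 1"])

text \<open>\<open>defect x\<close> decreases, by the triangle inequality and its reverse along the
  ray, and is bounded below by minus the distance from \<open>c r\<close> to
  \<open>x\<close>.\<close>

lemma busemann_limit:
  assumes x: "x \<in> reach"
  shows "(defect x \<longlongrightarrow> busemann_ray m h r c x) at_top"
proof -
  have "jm_dist m h (c r) (c (r + 1)) < top" using ray_distance(2)[of "r + 1" "r + 2"] by simp
  moreover have "jm_dist m h (c (r + 1)) x < top" using reach_finite[OF x, of "r + 1"] by (simp add: jm_dist_sym[OF mass_pos])
  ultimately have rx: "jm_dist m h (c r) x < top" by (rule dist_jm_triangle(1))
  have "\<exists>l. (defect x \<longlongrightarrow> l) at_top"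
  proof (rule tendsto_at_top_antimono_bounded)
    fix u v assume u: "r < u" "u \<le> v"
    show "defect x v \<le> defect x u"
    proof (cases "u = v")
      case False
      then have uv: "u < v" using u by simp
      note d = ray_distance[OF u(1) uv]
      have "dist_jm x (c v) \<le> dist_jm x (c u) + dist_jm (c u) (c v)"
        by (rule dist_jm_triangle(2)[OF reach_finite[OF x u(1)] d(1)])
      then show ?thesis using d(3) unfolding defect_def
        by (simp add: jm_dist_sym[OF mass_pos, of h "c u" "c r"] jm_dist_sym[OF mass_pos, of h "c v" "c r"])
    qed simp
  next
    fix u assume u: "r < u"
    have "dist_jm (c r) (c u) \<le> dist_jm (c r) x + dist_jm x (c u)"
      by (rule dist_jm_triangle(2)[OF rx reach_finite[OF x u]])
    then show "- dist_jm (c r) x \<le> defect x u"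
      unfolding defect_def by (simp add: jm_dist_sym[OF mass_pos, of h "c u" "c r"])
  qed
  then obtain l where l: "(defect x \<longlongrightarrow> l) at_top" by blast
  have "busemann_ray m h r c x = l"
    unfolding busemann_ray_def using l by (intro tendsto_Lim) (auto simp: defect_def[abs_def])
  then show ?thesis using l by simp
qed

lemma busemann_lipschitz:
  assumes y: "y \<in> reach" and xy: "jm_dist m h x y < top"
  shows "busemann_ray m h r c x \<le> dist_jm x y + busemann_ray m h r c y"
proof (rule tendsto_le[OF trivial_limit_at_top_linorder])
  show "((\<lambda>u. dist_jm x y + defect y u) \<longlongrightarrow> dist_jm x y + busemann_ray m h r c y) at_top"
    by (intro tendsto_intros busemann_limit y)
  show "(defect x \<longlongrightarrow> busemann_ray m h r c x) at_top"
    by (rule busemann_limit[OF reach_if_finite[OF y xy]])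
  show "\<forall>\<^sub>F u in at_top. defect x u \<le> dist_jm x y + defect y u"
    using eventually_gt_at_top[of r]
  proof eventually_elim
    case (elim u)
    from dist_jm_triangle(2)[OF xy reach_finite[OF y elim]] show ?case by (simp add: defect_def)
  qed
qed

text \<open>The ray \<open>c\<close> and the minimizing solution \<open>\<gamma>\<close> have the same limit shape, hence deviate at most
  logarithmically; going from one to the other during a time interval of length of order \<open>u\<close> costs
  only the boundary term up to an error that tends to 0.\<close>

lemma busemann_calibrated:
  assumes \<gamma>: "minimizing \<gamma> \<sigma> T" and esc: "escapes r' \<gamma>" and st: "T \<le> s" "s < t"
  shows "\<gamma> s \<in> reach" "\<sigma> t - \<sigma> s \<le> busemann_ray m h r c (\<gamma> s) - busemann_ray m h r c (\<gamma> t)"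
proof -
  have reg: "regular \<gamma> \<sigma> T" using \<gamma> by (simp add: minimizing_def)
  have min: "jm_dist m h (\<gamma> p) (\<gamma> q) = ennreal (\<sigma> q - \<sigma> p)" "0 \<le> \<sigma> q - \<sigma> p" if "T \<le> p" "p < q" for p q
    using \<gamma> that by (auto simp: minimizing_def)
  interpret E1: escaping_solution "scaled_potential m" "scaled_gradient m" "M a" \<epsilon>0 K k "\<lambda>t. M (\<gamma> t)" "\<lambda>t. M (vel \<gamma> t)" "max r' 0 + 1"
    by (rule escaping_solution_if_escapes[OF esc])
  interpret E2: escaping_solution "scaled_potential m" "scaled_gradient m" "M a" \<epsilon>0 K k "\<lambda>t. M (c t)" "\<lambda>t. M (vel c t)" "max r 0 + 1"
    by (rule escaping_solution_if_escapes[OF escapes_ray])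
  obtain C1 where C1: "\<forall>\<^sub>F u in at_top. norm (M (\<gamma> u) - u *\<^sub>R M a) \<le> C1 + K * ln u" using E1.logarithmic_deviation by blast
  obtain C2 where C2: "\<forall>\<^sub>F u in at_top. norm (M (c u) - u *\<^sub>R M a) \<le> C2 + K * ln u" using E2.logarithmic_deviation by blast
  define \<delta> where "\<delta> u = norm (M (c u - \<gamma> u))" for u
  define C where "C = C1 + C2"
  have \<delta>: "\<forall>\<^sub>F u in at_top. \<delta> u \<le> C + 2 * K * ln u"
    using C1 C2
  proof eventually_elim
    case (elim u)
    have "\<delta> u = norm ((M (c u) - u *\<^sub>R M a) - (M (\<gamma> u) - u *\<^sub>R M a))" by (simp add: \<delta>_def mass_scale_simps)
    also have "\<dots> \<le> norm (M (c u) - u *\<^sub>R M a) + norm (M (\<gamma> u) - u *\<^sub>R M a)" by (rule norm_triangle_ineq4)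
    finally show ?case using elim by (simp add: C_def)
  qed
  \<comment> \<open>\<open>\<epsilon>0 / 4 * u\<close> is \<open>\<epsilon>0 / 2\<close> times
    \<open>u / 2\<close>: the displacement allowed by \<open>jm_dist_perturbed\<close> when the
    transition starts at time \<open>u / 2\<close>.\<close>
  have small: "\<forall>\<^sub>F u in at_top. C + 2 * K * ln u \<le> \<epsilon>0 / 4 * u"
    using \<epsilon>0_pos K_pos by real_asymp
  \<comment> \<open>Bounds the sum of the errors of the upper and the lower estimate below; squared
    logarithms divided by \<open>u\<close> tend to 0.\<close>
  define e where "e u = 2 * ((C + 2 * K * ln u)\<^sup>2 / u) + 5 * (K * (C + 2 * K * ln u)\<^sup>2 / u\<^sup>2)" for u
  have e0: "(e \<longlongrightarrow> 0) at_top"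
    unfolding e_def[abs_def] using K_pos by real_asymp
  \<comment> \<open>The first-order boundary term. It is not estimated: it enters both bounds with
    the same sign and cancels in their difference.\<close>
  define p where "p u = M (vel \<gamma> u) \<bullet> M (c u - \<gamma> u)" for u
  \<comment> \<open>Follow \<gamma> up to time \<open>u / 2\<close>, then move over to the ray
    during the interval from \<open>u / 2\<close> to \<open>u\<close>.\<close>
  have upper: "\<forall>\<^sub>F u in at_top. jm_dist m h (\<gamma> q) (c u) < top \<and>
      dist_jm (\<gamma> q) (c u) \<le> \<sigma> u - \<sigma> q + p u + ((\<delta> u)\<^sup>2 / u + 4 * (K * (\<delta> u)\<^sup>2 / u\<^sup>2))"
    if q: "T \<le> q" for q
    using \<delta> small eventually_gt_at_top[of "2 * q"] eventually_gt_at_top[of "0::real"]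
  proof eventually_elim
    case (elim u)
    let ?v = "u / 2"
    have v: "T \<le> ?v" "?v < u" "q < ?v" using elim q by auto
    have d: "\<delta> u \<le> \<epsilon>0 / 2 * ?v" using elim by simp
    note P = jm_dist_perturbed[OF reg v(1,2), of 0 "\<delta> u" "c u - \<gamma> u"]
    have X: "\<sigma> u - \<sigma> ?v + (M (vel \<gamma> u) \<bullet> M (c u - \<gamma> u) - M (vel \<gamma> ?v) \<bullet> M 0)
      + (norm (M (c u - \<gamma> u - 0)))\<^sup>2 / (2 * (u - ?v)) + (u - ?v) * (K * (\<delta> u)\<^sup>2 / ?v ^ 3) =
      \<sigma> u - \<sigma> ?v + p u + ((\<delta> u)\<^sup>2 / u + 4 * (K * (\<delta> u)\<^sup>2 / u\<^sup>2))"
      using elim by (simp add: \<delta>_def p_def mass_scale_simps(4) power2_eq_square power3_eq_cube)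
    have j1: "jm_dist m h (\<gamma> ?v) (c u) < top"
      "dist_jm (\<gamma> ?v) (c u) \<le> \<sigma> u - \<sigma> ?v + p u + ((\<delta> u)\<^sup>2 / u + 4 * (K * (\<delta> u)\<^sup>2 / u\<^sup>2))"
      using dist_jm_leI[OF P] d unfolding X by (simp_all add: \<delta>_def mass_scale_simps(4))
    have j2: "jm_dist m h (\<gamma> q) (\<gamma> ?v) < top" "dist_jm (\<gamma> q) (\<gamma> ?v) = \<sigma> ?v - \<sigma> q"
      using min[OF q v(3)] by simp_all
    show ?case using dist_jm_triangle[OF j2(1) j1(1)] j1(2) j2(2) by simp
  qed
  have inreach: "\<gamma> q \<in> reach" if q: "T \<le> q" for q
  proof -
    have "\<forall>\<^sub>F u in at_top. jm_dist m h (\<gamma> q) (c u) < top \<and> r < u"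
      using upper[OF q] eventually_gt_at_top[of r] by eventually_elim simp
    then obtain u where "jm_dist m h (\<gamma> q) (c u) < top" "r < u"
      using eventually_happens trivial_limit_at_top_linorder by (metis (no_types, lifting))
    then show ?thesis by (auto simp: reach_def)
  qed
  then show "\<gamma> s \<in> reach" using st by simp
  \<comment> \<open>Returning from \<open>c u\<close> to \<open>\<gamma> (2 * u)\<close> has a
    controlled cost; as \<gamma> minimizes between \<open>s\<close> and \<open>2 * u\<close>, the
    way from \<open>\<gamma> s\<close> to \<open>c u\<close> cannot be much cheaper than the action
    of \<gamma>.\<close>
  have lower: "\<forall>\<^sub>F u in at_top. \<sigma> u - \<sigma> s + p u - ((\<delta> u)\<^sup>2 / (2 * u) + K * (\<delta> u)\<^sup>2 / u\<^sup>2) \<le> dist_jm (\<gamma> s) (c u)"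
    using \<delta> small eventually_gt_at_top[of s] eventually_gt_at_top[of r] eventually_gt_at_top[of "0::real"]
  proof eventually_elim
    case (elim u)
    have v: "T \<le> u" "u < 2 * u" using elim st by auto
    have "\<epsilon>0 / 4 * u \<le> \<epsilon>0 / 2 * u" using elim \<epsilon>0_pos by simp
    then have d: "\<delta> u \<le> \<epsilon>0 / 2 * u" using elim by linarith
    note P = jm_dist_perturbed[OF reg v, of "c u - \<gamma> u" "\<delta> u" 0]
    have X: "\<sigma> (2 * u) - \<sigma> u + (M (vel \<gamma> (2 * u)) \<bullet> M 0 - M (vel \<gamma> u) \<bullet> M (c u - \<gamma> u))
      + (norm (M (0 - (c u - \<gamma> u))))\<^sup>2 / (2 * (2 * u - u)) + (2 * u - u) * (K * (\<delta> u)\<^sup>2 / u ^ 3) =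
      \<sigma> (2 * u) - \<sigma> u - p u + ((\<delta> u)\<^sup>2 / (2 * u) + K * (\<delta> u)\<^sup>2 / u\<^sup>2)"
    proof -
      have "norm (M (0 - (c u - \<gamma> u))) = \<delta> u" unfolding \<delta>_def mass_scale_simps(2,4) by (simp add: norm_minus_commute)
      then show ?thesis using elim by (simp add: p_def mass_scale_simps(4) power2_eq_square power3_eq_cube)
    qed
    have j1: "jm_dist m h (c u) (\<gamma> (2 * u)) < top"
      "dist_jm (c u) (\<gamma> (2 * u)) \<le> \<sigma> (2 * u) - \<sigma> u - p u + ((\<delta> u)\<^sup>2 / (2 * u) + K * (\<delta> u)\<^sup>2 / u\<^sup>2)"
      using dist_jm_leI[OF P] d unfolding X by (simp_all add: \<delta>_def mass_scale_simps(4))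
    have j2: "jm_dist m h (\<gamma> s) (c u) < top" using reach_finite[OF inreach[OF st(1)]] elim by simp
    have "dist_jm (\<gamma> s) (\<gamma> (2 * u)) = \<sigma> (2 * u) - \<sigma> s"
      using min[OF st(1), of "2 * u"] elim by simp
    then show ?case using dist_jm_triangle(2)[OF j2 j1(1)] j1(2) by simp
  qed
  have T_t: "T \<le> t" using st by simp
  show "\<sigma> t - \<sigma> s \<le> busemann_ray m h r c (\<gamma> s) - busemann_ray m h r c (\<gamma> t)"
  proof (rule tendsto_le[OF trivial_limit_at_top_linorder])
    show "((\<lambda>u. defect (\<gamma> s) u - defect (\<gamma> t) u) \<longlongrightarrow> busemann_ray m h r c (\<gamma> s) - busemann_ray m h r c (\<gamma> t)) at_top"
      using inreach st by (intro tendsto_diff busemann_limit) auto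
    have "((\<lambda>u. \<sigma> t - \<sigma> s - e u) \<longlongrightarrow> \<sigma> t - \<sigma> s - 0) at_top" by (intro tendsto_intros e0)
    then show "((\<lambda>u. \<sigma> t - \<sigma> s - e u) \<longlongrightarrow> \<sigma> t - \<sigma> s) at_top" by simp
    show "\<forall>\<^sub>F u in at_top. \<sigma> t - \<sigma> s - e u \<le> defect (\<gamma> s) u - defect (\<gamma> t) u"
      using lower upper[OF T_t] \<delta> eventually_gt_at_top[of "0::real"]
    proof eventually_elim
      case (elim u)
      define D where "D = (\<delta> u)\<^sup>2"
      define E where "E = (C + 2 * K * ln u)\<^sup>2"
      have DE: "D \<le> E" unfolding D_def E_def using elim by (intro power_mono) (auto simp: \<delta>_def)
      have "D / u \<le> E / u" using DE elim by (intro divide_right_mono) auto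
      moreover have "K * D / u\<^sup>2 \<le> K * E / u\<^sup>2" using DE K_pos by (intro divide_right_mono mult_left_mono) auto
      moreover have "0 \<le> E / u" using elim by (simp add: E_def)
      moreover have "e u = 2 * (E / u) + 5 * (K * E / u\<^sup>2)" by (simp add: e_def E_def)
      moreover have "\<sigma> u - \<sigma> s + p u - (D / u / 2 + K * D / u\<^sup>2) \<le> dist_jm (\<gamma> s) (c u)"
        using elim by (simp add: D_def)
      moreover have "dist_jm (\<gamma> t) (c u) \<le> \<sigma> u - \<sigma> t + p u + (D / u + 4 * (K * D / u\<^sup>2))"
        using elim by (simp add: D_def)
      ultimately show ?case unfolding defect_def by argo
    qed
  qed
qed

lemma busemann_has_derivative:
  assumes \<gamma>: "minimizing \<gamma> \<sigma> T" and esc: "escapes r' \<gamma>" and t: "T + 1 \<le> t"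
  shows "(busemann_ray m h r c has_derivative (\<lambda>v. - (M (vel \<gamma> t) \<bullet> M v))) (at (\<gamma> t))"
proof -
  have reg: "regular \<gamma> \<sigma> T" using \<gamma> by (simp add: minimizing_def)
  note R = regularD[OF reg]
  obtain B where B: "B > 0" "\<And>v. norm (M v) \<le> B * norm v" using mass_scale_bound by blast
  let ?b = "busemann_ray m h r c"
  \<comment> \<open>The transitions last one unit of time: \<open>1 / 2\<close> comes from the
    kinetic cost, and \<open>K / T ^ 3\<close> bounds the Taylor term uniformly because
    \<open>t - 1\<close> is still at least \<open>T\<close>.\<close>
  define \<kappa> where "\<kappa> = 1 / 2 + K / T ^ 3"
  show ?thesis
  proof (rule has_derivative_quadratic_remainder[where \<delta> = "\<epsilon>0 / 2 * T / B" and C = "\<kappa> * B\<^sup>2"])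
    show "bounded_linear (\<lambda>v. - (M (vel \<gamma> t) \<bullet> M v))"
      by (intro bounded_linear_minus bounded_linear_compose[OF bounded_linear_inner_right bounded_linear_mass_scale])
    show "\<epsilon>0 / 2 * T / B > 0" using \<epsilon>0_pos R(1) B(1) by simp
    fix \<xi> :: "('e, 'n) vec" assume \<xi>: "norm \<xi> \<le> \<epsilon>0 / 2 * T / B"
    define n where "n = norm (M \<xi>)"
    have n: "n \<le> \<epsilon>0 / 2 * T"
    proof -
      have "n \<le> B * norm \<xi>" using B(2) by (simp add: n_def)
      also have "\<dots> \<le> B * (\<epsilon>0 / 2 * T / B)" using \<xi> B(1) by (intro mult_left_mono) auto
      finally show ?thesis using B(1) by simp
    qed
    have nB: "\<kappa> * n\<^sup>2 \<le> \<kappa> * B\<^sup>2 * (norm \<xi>)\<^sup>2"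
    proof -
      have "n\<^sup>2 \<le> (B * norm \<xi>)\<^sup>2" using B(2) by (intro power_mono) (auto simp: n_def)
      moreover have "0 \<le> \<kappa>" using K_pos R(1) by (simp add: \<kappa>_def)
      ultimately have "\<kappa> * n\<^sup>2 \<le> \<kappa> * (B * norm \<xi>)\<^sup>2" by (intro mult_left_mono)
      then show ?thesis by (simp add: power_mult_distrib)
    qed
    have err: "n\<^sup>2 / 2 + K * n\<^sup>2 / q ^ 3 \<le> \<kappa> * n\<^sup>2" if "T \<le> q" for q
    proof -
      have "K * n\<^sup>2 / q ^ 3 \<le> K * n\<^sup>2 / T ^ 3"
        using that R(1) K_pos by (intro divide_left_mono mult_pos_pos power_mono mult_nonneg_nonneg) auto
      then show ?thesis by (simp add: \<kappa>_def distrib_right)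
    qed
    have big: "n \<le> \<epsilon>0 / 2 * q" if "T \<le> q" for q
    proof -
      have "\<epsilon>0 / 2 * T \<le> \<epsilon>0 / 2 * q" using that \<epsilon>0_pos by (intro mult_left_mono) auto
      then show ?thesis using n by linarith
    qed
    have tt: "T \<le> t" "t < t + 1" "T \<le> t - 1" "t - 1 < t" "T \<le> t + 1" using t by auto
    note P1 = jm_dist_perturbed[OF reg tt(1,2), of \<xi> n 0]
    have X1: "\<sigma> (t + 1) - \<sigma> t + (M (vel \<gamma> (t + 1)) \<bullet> M 0 - M (vel \<gamma> t) \<bullet> M \<xi>)
      + (norm (M (0 - \<xi>)))\<^sup>2 / (2 * (t + 1 - t)) + (t + 1 - t) * (K * n\<^sup>2 / t ^ 3) =
      \<sigma> (t + 1) - \<sigma> t - M (vel \<gamma> t) \<bullet> M \<xi> + (n\<^sup>2 / 2 + K * n\<^sup>2 / t ^ 3)"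
      by (simp add: mass_scale_simps n_def)
    have j1: "jm_dist m h (\<gamma> t + \<xi>) (\<gamma> (t + 1)) < top"
      "dist_jm (\<gamma> t + \<xi>) (\<gamma> (t + 1)) \<le> \<sigma> (t + 1) - \<sigma> t - M (vel \<gamma> t) \<bullet> M \<xi> + (n\<^sup>2 / 2 + K * n\<^sup>2 / t ^ 3)"
      using dist_jm_leI[OF P1] big[OF tt(1)] unfolding X1 by (simp_all add: mass_scale_simps n_def)
    note P2 = jm_dist_perturbed[OF reg tt(3,4), of 0 n \<xi>]
    have X2: "\<sigma> t - \<sigma> (t - 1) + (M (vel \<gamma> t) \<bullet> M \<xi> - M (vel \<gamma> (t - 1)) \<bullet> M 0)
      + (norm (M (\<xi> - 0)))\<^sup>2 / (2 * (t - (t - 1))) + (t - (t - 1)) * (K * n\<^sup>2 / (t - 1) ^ 3) =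
      \<sigma> t - \<sigma> (t - 1) + M (vel \<gamma> t) \<bullet> M \<xi> + (n\<^sup>2 / 2 + K * n\<^sup>2 / (t - 1) ^ 3)"
      by (simp add: mass_scale_simps n_def)
    have j2: "jm_dist m h (\<gamma> (t - 1)) (\<gamma> t + \<xi>) < top"
      "dist_jm (\<gamma> (t - 1)) (\<gamma> t + \<xi>) \<le> \<sigma> t - \<sigma> (t - 1) + M (vel \<gamma> t) \<bullet> M \<xi> + (n\<^sup>2 / 2 + K * n\<^sup>2 / (t - 1) ^ 3)"
      using dist_jm_leI[OF P2] big[OF tt(3)] unfolding X2 by (simp_all add: mass_scale_simps n_def)
    have r1: "\<gamma> (t + 1) \<in> reach" by (rule busemann_calibrated(1)[OF \<gamma> esc tt(5), of "t + 2"]) simp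
    have rx: "\<gamma> t + \<xi> \<in> reach" by (rule reach_if_finite[OF r1 j1(1)])
    have "?b (\<gamma> t + \<xi>) \<le> dist_jm (\<gamma> t + \<xi>) (\<gamma> (t + 1)) + ?b (\<gamma> (t + 1))"
      by (rule busemann_lipschitz[OF r1 j1(1)])
    moreover have "?b (\<gamma> (t - 1)) \<le> dist_jm (\<gamma> (t - 1)) (\<gamma> t + \<xi>) + ?b (\<gamma> t + \<xi>)"
      by (rule busemann_lipschitz[OF rx j2(1)])
    moreover have "\<sigma> (t + 1) - \<sigma> t \<le> ?b (\<gamma> t) - ?b (\<gamma> (t + 1))"
      by (rule busemann_calibrated(2)[OF \<gamma> esc tt(1,2)])
    moreover have "\<sigma> t - \<sigma> (t - 1) \<le> ?b (\<gamma> (t - 1)) - ?b (\<gamma> t)"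
      by (rule busemann_calibrated(2)[OF \<gamma> esc tt(3,4)])
    ultimately have "\<bar>?b (\<gamma> t + \<xi>) - ?b (\<gamma> t) - - (M (vel \<gamma> t) \<bullet> M \<xi>)\<bar> \<le> \<kappa> * n\<^sup>2"
      using j1(2) j2(2) err[OF tt(1)] err[OF tt(3)] unfolding abs_le_iff by linarith
    then show "\<bar>?b (\<gamma> t + \<xi>) - ?b (\<gamma> t) - - (M (vel \<gamma> t) \<bullet> M \<xi>)\<bar> \<le> \<kappa> * B\<^sup>2 * (norm \<xi>)\<^sup>2"
      using nB by linarith
  qed
qed

end

section \<open>From an arbitrary ray to the gradient of \<open>busemann\<close>\<close>

context nbody_limit_shape
begin

text \<open>\<open>busemann\<close> selects a ray of unspecified energy; the limit shape determines
  that energy through the limit velocity.\<close>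

lemma ray_energy_eq:
  assumes ray: "hyperbolic_geodesic_ray m h' r c" and shape: "asymptotic_to m c a"
  shows "h' = h"
proof -
  have esc: "escapes r c"
    by (rule escapes_if_motion[OF _ order_refl shape])
      (use ray in \<open>simp add: hyperbolic_geodesic_ray_def hyperbolic_motion_def\<close>)
  obtain \<sigma> T where T: "T > r" "minimizing c \<sigma> T" using exists_minimizing[OF esc] by blast
  then have "(norm (M (vel c T)))\<^sup>2 = 2 * h + 2 * potential_real m (c T)"
    using regularD(6)[of c \<sigma> T T] by (simp add: minimizing_def)
  moreover have "energy m {r<..} c T = h'" using ray T(1) by (simp add: hyperbolic_geodesic_ray_def)
  moreover have "at T within {r<..} = at T" using T(1) by (intro at_within_open) auto
  ultimately show ?thesis by (simp add: energy_def mass_norm_scale[OF mass_pos] add_divide_distrib)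
qed

lemma minimizing_is_ray:
  assumes \<gamma>: "minimizing \<gamma> \<sigma> T" and mot: "motion m {t0..} \<gamma>" and shape: "asymptotic_to m \<gamma> a"
    and a: "a \<in> collision_free" and t1: "T \<le> t1" "t0 \<le> t1"
  shows "hyperbolic_geodesic_ray m h t1 \<gamma>"
  unfolding hyperbolic_geodesic_ray_def
proof (intro conjI allI impI)
  have reg: "regular \<gamma> \<sigma> T" using \<gamma> by (simp add: minimizing_def)
  note R = regularD[OF reg]
  show "h > 0" by (rule h_pos)
  have at: "at t within {t1<..} = at t" if "t > t1" for t using that by (intro at_within_open) auto
  have mo: "motion m {t1<..} \<gamma>"
    unfolding motion_def
  proof (intro conjI ballI)
    fix t assume t: "t \<in> {t1<..}"
    then have tt: "t > t1" by simp
    have sub: "{t1<..} \<subseteq> {t0..}" using t1 by auto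
    note mi = motion_interior[OF mot open_greaterThan sub]
    show "\<gamma> t \<in> collision_free" by (rule mi(1)[OF t])
    show "\<gamma> differentiable at t within {t1<..}" using mi(2)[OF t] at[OF tt] by (simp add: differentiableI_vector)
    have "((\<lambda>s. vector_derivative \<gamma> (at s within {t1<..})) has_vector_derivative mass_grad m (potential_real m) (\<gamma> t)) (at t)"
      by (rule has_vector_derivative_transform_within_open[OF mi(3)[OF t] open_greaterThan t]) (simp add: at)
    then show "((\<lambda>s. vector_derivative \<gamma> (at s within {t1<..})) has_vector_derivative mass_grad m (potential_real m) (\<gamma> t)) (at t within {t1<..})"
      by (rule has_vector_derivative_at_within)
  qed (simp add: is_interval_def)
  have "\<not> bdd_above {t1<..}"
    by (metis bdd_above_def gt_ex greaterThan_iff max.strict_coboundedI1 max_less_iff_conj not_le)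
  then show "hyperbolic_motion m {t1<..} \<gamma>"
    using mo a shape by (auto simp: hyperbolic_motion_def)
  fix t assume t: "t1 < t"
  show "absolutely_continuous_curve t1 t \<gamma>"
  proof (rule absolutely_continuous_curve_C1)
    show "(\<gamma> has_vector_derivative vel \<gamma> \<tau>) (at \<tau> within {t1..t})" if "\<tau> \<in> {t1..t}" for \<tau>
      using R(3)[of \<tau>] that t1 by (auto intro: has_vector_derivative_at_within)
    show "continuous_on {t1..t} (vel \<gamma>)"
      using R(4) t1 by (intro velocity_continuous[where g = "\<lambda>t. scaled_gradient m (M (\<gamma> t))"]) auto
  qed
  show "energy m {t1<..} \<gamma> t = h"
    using R(6)[of t] t t1 at[OF t] by (simp add: energy_def mass_norm_scale[OF mass_pos] add_divide_distrib)
  show "action m h t1 t \<gamma> = jm_dist m h (\<gamma> t1) (\<gamma> t)"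
    using \<gamma> t t1 by (simp add: minimizing_def)
qed

text \<open>The ray behind \<open>busemann\<close> is chosen by \<open>SOME\<close>, and \<gamma>
  itself shows that there is one to choose. The derivative along \<gamma> is computed for whichever
  ray was selected; subtracting the value at 0 changes only a constant.\<close>

theorem busemann_gradient:
  assumes \<gamma>: "minimizing \<gamma> \<sigma> T" and esc: "escapes r' \<gamma>" and t: "T + 1 \<le> t"
    and ray: "hyperbolic_geodesic_ray m h t1 \<gamma>" and shape: "asymptotic_to m \<gamma> a"
  shows "busemann m a differentiable (at (\<gamma> t))" "vel \<gamma> t = - mass_grad m (busemann m a) (\<gamma> t)"
proof -
  let ?P = "\<lambda>b. \<exists>h t0 c. hyperbolic_geodesic_ray m h t0 c \<and> asymptotic_to m c a \<and>
       b = (\<lambda>x. busemann_ray m h t0 c x - busemann_ray m h t0 c 0)"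
  have "\<exists>b. ?P b" using ray shape by blast
  then have "?P (busemann m a)" unfolding busemann_def by (rule someI_ex)
  then obtain h' r c where c: "hyperbolic_geodesic_ray m h' r c" "asymptotic_to m c a"
    "busemann m a = (\<lambda>x. busemann_ray m h' r c x - busemann_ray m h' r c 0)" by blast
  have h': "h' = h" by (rule ray_energy_eq[OF c(1,2)])
  interpret geodesic_ray m a \<epsilon>0 K k h c r
    by unfold_locales (use c h' in simp_all)
  have "(busemann_ray m h r c has_derivative (\<lambda>v. - (M (vel \<gamma> t) \<bullet> M v))) (at (\<gamma> t))"
    by (rule busemann_has_derivative[OF \<gamma> esc t])
  then have "(busemann m a has_derivative (\<lambda>v. - (M (vel \<gamma> t) \<bullet> M v) - 0)) (at (\<gamma> t))"
    unfolding c(3) h' by (intro has_derivative_diff has_derivative_const)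
  then have d: "(busemann m a has_derivative (\<lambda>v. mass_inner m (- vel \<gamma> t) v)) (at (\<gamma> t))"
    by (simp add: mass_inner_scale[OF mass_pos] mass_scale_simps)
  then show "busemann m a differentiable (at (\<gamma> t))" by (rule differentiableI)
  show "vel \<gamma> t = - mass_grad m (busemann m a) (\<gamma> t)"
    using mass_grad_eqI[OF mass_pos d] by simp
qed

end

theorem theorem1p2:
  fixes m :: "'n::{finite,linorder} \<Rightarrow> real"
    and a :: "('e::euclidean_space, 'n) vec"
    and \<gamma> :: "real \<Rightarrow> ('e, 'n) vec"
    and t0 :: real
  assumes "DIM('e) \<ge> 2" and "CARD('n) \<ge> 2"
    and "\<And>i. m i > 0"
    and "a \<in> collision_free"
    and "hyperbolic_motion m {t0..} \<gamma>"
    and "asymptotic_to m \<gamma> a"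
  shows "\<exists>t1>t0.
    hyperbolic_geodesic_ray m ((mass_norm m a)\<^sup>2 / 2) t1 \<gamma> \<and>
    (\<forall>t\<ge>t1. busemann m a differentiable (at (\<gamma> t)) \<and>
       vector_derivative \<gamma> (at t) = - mass_grad m (busemann m a) (\<gamma> t))"
proof -
  have m: "\<forall>i. 0 < m i" using assms(3) by blast
  obtain \<epsilon>0 K k where con: "conical_potential (scaled_potential m) (scaled_gradient m) (mass_scale m a) \<epsilon>0 K k"
    and free: "\<forall>\<tau>>0. \<forall>x. norm (mass_scale m x - \<tau> *\<^sub>R mass_scale m a) \<le> \<epsilon>0 * \<tau> \<longrightarrow> x \<in> collision_free"
    using scaled_potential_conical[OF m assms(2,4)] by blast
  define h where "h = (mass_norm m a)\<^sup>2 / 2"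
  interpret conical_potential "scaled_potential m" "scaled_gradient m" "mass_scale m a" \<epsilon>0 K k by (rule con)
  interpret nbody_limit_shape m a \<epsilon>0 K k h
    by unfold_locales (use m assms(2) free h_def in auto)
  have mot: "motion m {t0..} \<gamma>" using assms(5) by (simp add: hyperbolic_motion_def)
  have esc: "escapes t0 \<gamma>" by (rule escapes_if_motion[OF mot _ assms(6)]) auto
  obtain \<sigma> T where T: "T > t0" and min: "minimizing \<gamma> \<sigma> T" using exists_minimizing[OF esc] by blast
  \<comment> \<open>One unit after \<open>T\<close>, because the gradient at time \<open>t\<close>
    is found by comparison with the times \<open>t - 1\<close> and \<open>t + 1\<close>.\<close>
  have ray: "hyperbolic_geodesic_ray m h (T + 1) \<gamma>"
    by (rule minimizing_is_ray[OF min mot assms(6,4)]) (use T in auto)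
  show ?thesis
    using T ray busemann_gradient[OF min esc _ ray assms(6)]
    by (intro exI[of _ "T + 1"]) (auto simp: h_def)
qed

end
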